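(* Let $(R,\mathfrak{m})$ be a complete Noetherian regular local ring containing a field of characteristic $p>0$, and let $\mathcal{M}$ be an $\mathcal{F}$-finite module over $R$ such that $(0)\notin \operatorname{Ass}_R(\mathcal{M})$. Then $(0)\in \operatorname{Ass}_R(D(\mathcal{M}))$, where $D(\mathcal{M})=\operatorname{Hom}_R(\mathcal{M},E_R(R/\mathfrak{m}))$ is the Matlis dual of $\mathcal{M}$.
   Context: All rings are commutative with unity. $E_R(R/\mathfrak{m})$ denotes an injective hull of the residue field $R/\mathfrak{m}$ as an $R$-module, and for any $R$-module $M$ (not necessarily finitely generated), $D(M):=\operatorname{Hom}_R(M,E_R(R/\mathfrak{m}))$. $\operatorname{Ass}_R(M)$ is the set of associated primes of $M$; since $R$ is a domain, the zero ideal $(0)$ is prime, and $(0)\in\operatorname{Ass}_R(M)$ means that some element of $M$ has zero annihilator. Frobenius functor: let $R'$ be the additive group of $R$ regarded as an $R$-bimodule with the usual left action and with right action $r'r=r^p r'$ for $r\in R$, $r'\in R'$. The Frobenius functor $F$ from $R$-modules to $R$-modules is $F(M)=R'\otimes_R M$, with $F(h)=\operatorname{id}\otimes_R h$ for a homomorphism $h$, where the $R$-module structure on $F(M)$ comes from the left $R$-module structure on $R'$. The iterates are $F^1=F$, $F^{i+1}=F\circ F^i$. Since $R$ is regular, $F$ is exact. An $\mathcal{F}$-module is an $R$-module $\mathcal{M}$ equipped with an $R$-module isomorphism $\theta:\mathcal{M}\to F(\mathcal{M})$ (the structure morphism). A generating morphism of an $\mathcal{F}$-module $\mathcal{M}$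 is an $R$-module homomorphism $\beta:M\to F(M)$, for some $R$-module $M$, such that $\mathcal{M}$ is the direct limit of the system $M\xrightarrow{\beta}F(M)\xrightarrow{F(\beta)}F^2(M)\xrightarrow{F^2(\beta)}\cdots$ and $\theta:\mathcal{M}\to F(\mathcal{M})$ is the map induced on direct limits by the maps $F^i(\beta):F^i(M)\to F^{i+1}(M)$ (with $F^0(\beta)=\beta$) from this system to the system $F(M)\xrightarrow{F(\beta)}F^2(M)\xrightarrow{F^2(\beta)}F^3(M)\to\cdots$ (whose limit is $F(\mathcal{M})$). If $\beta$ is injective it is called a root morphism and $M$ a root of $\mathcal{M}$. An $\mathcal{F}$-module is called $\mathcal{F}$-finite if it possesses a root morphism $\beta:M\to F(M)$ with $M$ a finitely generated $R$-module.
   Formalization: The module ℳ is additionally assumed to be nonzero; for ℳ = 0 (F-finite with root 0) the claim as printed fails, since both ℳ and D(ℳ) are then zero and have no associated primes. *)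

theory Defs
  imports
    "HOL-Algebra.Algebra"
    "HOL-Algebra.Free_Abelian_Groups"
    "HOL-Library.Extended_Nat"
begin

section \<open>Complete regular local rings of positive characteristic\<close>

definition local_ring :: "('a, 'r) ring_scheme \<Rightarrow> 'a set \<Rightarrow> bool" where
  "local_ring R \<mm> \<longleftrightarrow> cring R \<and> maximalideal \<mm> R \<and> (\<forall>J. maximalideal J R \<longrightarrow> J = \<mm>)"

definition krull_dim :: "('a, 'r) ring_scheme \<Rightarrow> enat" where
  "krull_dim R = Sup {enat n | n. \<exists>P. (\<forall>i\<le>n. primeideal (P i) R) \<and> (\<forall>i<n. P i \<subset> P (Suc i))}"

definition min_generators :: "('a, 'r) ring_scheme \<Rightarrow> 'a set \<Rightarrow> enat" where
  "min_generators R I = Inf {enat (card S) | S. finite S \<and> S \<subseteq> carrier R \<and> genideal R S = I}"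

definition regular_local_ring :: "('a, 'r) ring_scheme \<Rightarrow> 'a set \<Rightarrow> bool" where
  "regular_local_ring R \<mm> \<longleftrightarrow>
     noetherian_ring R \<and> local_ring R \<mm> \<and> min_generators R \<mm> = krull_dim R"

primrec ideal_power :: "('a, 'r) ring_scheme \<Rightarrow> 'a set \<Rightarrow> nat \<Rightarrow> 'a set" where
  "ideal_power R I 0 = carrier R"
| "ideal_power R I (Suc n) = ideal_prod R I (ideal_power R I n)"

text \<open>A sequence \<open>x\<close> with \<open>x (n+1) - x n \<in> I\<^sup>n\<close> is an element of the inverse limit of the rings
  \<open>R/I\<^sup>n\<close>; existence and uniqueness of \<open>a\<close> say that \<open>R\<close> maps bijectively to this limit (so
  \<open>R\<close> is also \<open>I\<close>-adically separated).\<close>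

definition adically_complete :: "('a, 'r) ring_scheme \<Rightarrow> 'a set \<Rightarrow> bool" where
  "adically_complete R I \<longleftrightarrow>
     (\<forall>x. (\<forall>n::nat. x n \<in> carrier R \<and> x (Suc n) \<ominus>\<^bsub>R\<^esub> x n \<in> ideal_power R I n) \<longrightarrow>
        (\<exists>!a. a \<in> carrier R \<and> (\<forall>n. a \<ominus>\<^bsub>R\<^esub> x n \<in> ideal_power R I n)))"

definition characteristic :: "('a, 'r) ring_scheme \<Rightarrow> nat" where
  "characteristic R =
     (if \<exists>n>0. add_pow R (n::nat) \<one>\<^bsub>R\<^esub> = \<zero>\<^bsub>R\<^esub>
      then LEAST n. n > 0 \<and> add_pow R n \<one>\<^bsub>R\<^esub> = \<zero>\<^bsub>R\<^esub> else 0)"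


section \<open>Modules\<close>

definition mod_hom :: "('a, 'r) ring_scheme \<Rightarrow> ('a, 'b) module \<Rightarrow> ('a, 'c) module \<Rightarrow> ('b \<Rightarrow> 'c) set" where
  "mod_hom R M N =
     {h \<in> carrier M \<rightarrow> carrier N.
        (\<forall>x\<in>carrier M. \<forall>y\<in>carrier M. h (x \<oplus>\<^bsub>M\<^esub> y) = h x \<oplus>\<^bsub>N\<^esub> h y) \<and>
        (\<forall>r\<in>carrier R. \<forall>x\<in>carrier M. h (r \<odot>\<^bsub>M\<^esub> x) = r \<odot>\<^bsub>N\<^esub> h x)}"

definition mod_iso :: "('a, 'r) ring_scheme \<Rightarrow> ('a, 'b) module \<Rightarrow> ('a, 'c) module \<Rightarrow> ('b \<Rightarrow> 'c) set" where
  "mod_iso R M N = {h \<in> mod_hom R M N. bij_betw h (carrier M) (carrier N)}"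

definition finitely_generated :: "('a, 'r) ring_scheme \<Rightarrow> ('a, 'b) module \<Rightarrow> bool" where
  "finitely_generated R M \<longleftrightarrow>
     (\<exists>S. finite S \<and> S \<subseteq> carrier M \<and> (\<forall>N. submodule N R M \<and> S \<subseteq> N \<longrightarrow> N = carrier M))"

definition annihilator :: "('a, 'r) ring_scheme \<Rightarrow> ('a, 'b) module \<Rightarrow> 'b \<Rightarrow> 'a set" where
  "annihilator R M x = {r \<in> carrier R. r \<odot>\<^bsub>M\<^esub> x = \<zero>\<^bsub>M\<^esub>}"

definition Ass :: "('a, 'r) ring_scheme \<Rightarrow> ('a, 'b) module \<Rightarrow> 'a set set" where
  "Ass R M = {P. primeideal P R \<and> (\<exists>x\<in>carrier M. P = annihilator R M x)}"

text \<open>Modules do not use the fields \<open>mult\<close> and \<open>one\<close> that the record inherits from rings; they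
  are \<open>undefined\<close> below. Homomorphisms are made extensional so that equality in the carrier
  of \<open>Hom_R(M, N)\<close> is equality of maps on \<open>M\<close>.\<close>

definition Hom_module ::
    "('a, 'r) ring_scheme \<Rightarrow> ('a, 'b) module \<Rightarrow> ('a, 'c) module \<Rightarrow> ('a, 'b \<Rightarrow> 'c) module" where
  "Hom_module R M N =
     \<lparr>carrier = mod_hom R M N \<inter> extensional (carrier M), monoid.mult = undefined, one = undefined,
      ring.zero = (\<lambda>x\<in>carrier M. \<zero>\<^bsub>N\<^esub>),
      ring.add = (\<lambda>f g. \<lambda>x\<in>carrier M. f x \<oplus>\<^bsub>N\<^esub> g x),
      smult = (\<lambda>r f. \<lambda>x\<in>carrier M. r \<odot>\<^bsub>N\<^esub> f x)\<rparr>"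

definition residue_module :: "('a, 'r) ring_scheme \<Rightarrow> 'a set \<Rightarrow> ('a, 'a set) module" where
  "residue_module R \<mm> =
     \<lparr>carrier = carrier (R Quot \<mm>), monoid.mult = undefined, one = undefined,
      ring.zero = \<zero>\<^bsub>R Quot \<mm>\<^esub>, ring.add = ring.add (R Quot \<mm>),
      smult = (\<lambda>r C. (\<mm> +>\<^bsub>R\<^esub> r) \<otimes>\<^bsub>R Quot \<mm>\<^esub> C)\<rparr>"

text \<open>A definition cannot quantify over types, so the test modules \<open>A\<close>, \<open>B\<close> range over the
  modules on the type of \<open>R\<close>. By Baer's criterion nothing is lost: lemma \<open>injective_module_extend\<close>
  below proves the extension property for test modules on arbitrary types.\<close>

definition injective_module :: "('a, 'r) ring_scheme \<Rightarrow> ('a, 'e) module \<Rightarrow> bool" where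
  "injective_module R E \<longleftrightarrow> module R E \<and>
     (\<forall>(A::('a, 'a) module) (B::('a, 'a) module) j f.
        module R A \<and> module R B \<and> j \<in> mod_hom R A B \<and> inj_on j (carrier A) \<and> f \<in> mod_hom R A E \<longrightarrow>
        (\<exists>g\<in>mod_hom R B E. \<forall>x\<in>carrier A. g (j x) = f x))"

definition injective_hull ::
    "('a, 'r) ring_scheme \<Rightarrow> ('a, 'b) module \<Rightarrow> ('a, 'e) module \<Rightarrow> ('b \<Rightarrow> 'e) \<Rightarrow> bool" where
  "injective_hull R K E \<iota> \<longleftrightarrow>
     injective_module R E \<and> \<iota> \<in> mod_hom R K E \<and> inj_on \<iota> (carrier K) \<and>
     (\<forall>N. submodule N R E \<and> N \<noteq> {\<zero>\<^bsub>E\<^esub>} \<longrightarrow> N \<inter> \<iota> ` carrier K \<noteq> {\<zero>\<^bsub>E\<^esub>})"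


section \<open>The Frobenius functor\<close>

text \<open>\<open>F(M)\<close> is the free abelian group on \<open>R \<times> M\<close> modulo the relations of the tensor product
  \<open>R' \<otimes>\<^sub>R M\<close>; the right action on \<open>R'\<close> enters in the last one, \<open>a \<cdot> r \<otimes> x = a \<otimes> r x\<close> with
  \<open>a \<cdot> r = r\<^sup>p a\<close>.\<close>

abbreviation frob_free :: "('a, 'r) ring_scheme \<Rightarrow> ('a, 'b) module \<Rightarrow> ('a \<times> 'b \<Rightarrow>\<^sub>0 int) monoid" where
  "frob_free R M \<equiv> free_Abelian_group (carrier R \<times> carrier M)"

definition frob_rels :: "('a, 'r) ring_scheme \<Rightarrow> nat \<Rightarrow> ('a, 'b) module \<Rightarrow> ('a \<times> 'b \<Rightarrow>\<^sub>0 int) set" where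
  "frob_rels R p M = generate (frob_free R M)
     ({frag_of (a \<oplus>\<^bsub>R\<^esub> b, x) - frag_of (a, x) - frag_of (b, x) | a b x.
          a \<in> carrier R \<and> b \<in> carrier R \<and> x \<in> carrier M} \<union>
      {frag_of (a, x \<oplus>\<^bsub>M\<^esub> y) - frag_of (a, x) - frag_of (a, y) | a x y.
          a \<in> carrier R \<and> x \<in> carrier M \<and> y \<in> carrier M} \<union>
      {frag_of ((r [^]\<^bsub>R\<^esub> p) \<otimes>\<^bsub>R\<^esub> a, x) - frag_of (a, r \<odot>\<^bsub>M\<^esub> x) | r a x.
          r \<in> carrier R \<and> a \<in> carrier R \<and> x \<in> carrier M})"

text \<open>An additive map \<open>f\<close> of formal sums that respects the relations induces \<open>c + K \<mapsto> f c + K'\<close>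
  on cosets of the relation subgroups \<open>K\<close>, \<open>K'\<close>; as a set, \<open>f c + K'\<close> is \<open>K' <#> f ` (c + K)\<close>.\<close>

definition frob :: "('a, 'r) ring_scheme \<Rightarrow> nat \<Rightarrow> ('a, 'b) module \<Rightarrow> ('a, ('a \<times> 'b \<Rightarrow>\<^sub>0 int) set) module" where
  "frob R p M =
     \<lparr>carrier = carrier (frob_free R M Mod frob_rels R p M), monoid.mult = undefined, one = undefined,
      ring.zero = \<one>\<^bsub>frob_free R M Mod frob_rels R p M\<^esub>,
      ring.add = monoid.mult (frob_free R M Mod frob_rels R p M),
      smult = (\<lambda>r C. frob_rels R p M <#>\<^bsub>frob_free R M\<^esub>
                 (frag_extend (\<lambda>(a, x). frag_of (r \<otimes>\<^bsub>R\<^esub> a, x)) ` C))\<rparr>"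

definition frob_map ::
    "('a, 'r) ring_scheme \<Rightarrow> nat \<Rightarrow> ('a, 'c) module \<Rightarrow> ('b \<Rightarrow> 'c) \<Rightarrow>
     ('a \<times> 'b \<Rightarrow>\<^sub>0 int) set \<Rightarrow> ('a \<times> 'c \<Rightarrow>\<^sub>0 int) set" where
  "frob_map R p N h = (\<lambda>C. frob_rels R p N <#>\<^bsub>frob_free R N\<^esub>
     (frag_extend (\<lambda>(a, x). frag_of (a, h x)) ` C))"

text \<open>The type of \<open>frob R p M\<close> differs from that of \<open>M\<close>, so to iterate \<open>F\<close> all \<open>F\<^sup>i(M)\<close> are
  transported to one type of nested formal sums of pure tensors: \<open>frob_code\<close> names a class in
  \<open>F(N)\<close> by a sum of pure tensors representing it, and is injective on \<open>F(N)\<close>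
  (lemma \<open>frob_code_inj\<close>).\<close>

datatype ('a, 'm) frob_term = FBase 'm | FSum "('a \<times> ('a, 'm) frob_term) list"

definition frob_code ::
    "('a \<times> ('a, 'm) frob_term \<Rightarrow>\<^sub>0 int) set \<Rightarrow> ('a, 'm) frob_term" where
  "frob_code C = FSum (SOME l. (\<Sum>t\<leftarrow>l. frag_of t) \<in> C)"

definition transport :: "('b \<Rightarrow> 'c) \<Rightarrow> ('a, 'b) module \<Rightarrow> ('a, 'c) module" where
  "transport f N = (let g = inv_into (carrier N) f in
     \<lparr>carrier = f ` carrier N, monoid.mult = undefined, one = undefined, ring.zero = f \<zero>\<^bsub>N\<^esub>,
      ring.add = (\<lambda>x y. f (g x \<oplus>\<^bsub>N\<^esub> g y)), smult = (\<lambda>r x. f (r \<odot>\<^bsub>N\<^esub> g x))\<rparr>)"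

primrec frob_iter ::
    "('a, 'r) ring_scheme \<Rightarrow> nat \<Rightarrow> ('a, 'm) module \<Rightarrow> nat \<Rightarrow> ('a, ('a, 'm) frob_term) module" where
  "frob_iter R p M 0 = transport FBase M"
| "frob_iter R p M (Suc i) = transport frob_code (frob R p (frob_iter R p M i))"

text \<open>\<open>frob_iter_map R p M \<beta> i\<close> is \<open>F\<^sup>i(\<beta>) : F\<^sup>i(M) \<rightarrow> F(F\<^sup>i(M))\<close>; composing it with \<open>frob_code\<close>
  gives the same map with target \<open>F\<^sup>i\<^sup>+\<^sup>1(M) = frob_iter R p M (i+1)\<close>.\<close>

primrec frob_iter_map ::
    "('a, 'r) ring_scheme \<Rightarrow> nat \<Rightarrow> ('a, 'm) module \<Rightarrow> ('m \<Rightarrow> ('a \<times> 'm \<Rightarrow>\<^sub>0 int) set) \<Rightarrow> nat \<Rightarrow>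
     ('a, 'm) frob_term \<Rightarrow> ('a \<times> ('a, 'm) frob_term \<Rightarrow>\<^sub>0 int) set" where
  "frob_iter_map R p M \<beta> 0 =
     (\<lambda>z. frob_map R p (frob_iter R p M 0) FBase (\<beta> (inv_into (carrier M) FBase z)))"
| "frob_iter_map R p M \<beta> (Suc i) =
     (\<lambda>z. frob_map R p (frob_iter R p M (Suc i)) (frob_code \<circ> frob_iter_map R p M \<beta> i)
            (inv_into (carrier (frob R p (frob_iter R p M i))) frob_code z))"


section \<open>Direct limits of sequences of modules\<close>

primrec system_map :: "(nat \<Rightarrow> 'b \<Rightarrow> 'b) \<Rightarrow> nat \<Rightarrow> nat \<Rightarrow> 'b \<Rightarrow> 'b" where
  "system_map f i 0 = id"
| "system_map f i (Suc n) = f (i + n) \<circ> system_map f i n"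

definition limit_rel :: "(nat \<Rightarrow> ('a, 'b) module) \<Rightarrow> (nat \<Rightarrow> 'b \<Rightarrow> 'b) \<Rightarrow> ((nat \<times> 'b) \<times> (nat \<times> 'b)) set" where
  "limit_rel N f = {((i, x), (j, y)). x \<in> carrier (N i) \<and> y \<in> carrier (N j) \<and>
     (\<exists>k. i \<le> k \<and> j \<le> k \<and> system_map f i (k - i) x = system_map f j (k - j) y)}"

text \<open>Two classes always have representatives at a common stage \<open>k\<close>, where they are added.\<close>

definition direct_limit ::
    "(nat \<Rightarrow> ('a, 'b) module) \<Rightarrow> (nat \<Rightarrow> 'b \<Rightarrow> 'b) \<Rightarrow> ('a, (nat \<times> 'b) set) module" where
  "direct_limit N f =
     \<lparr>carrier = (SIGMA i:UNIV. carrier (N i)) // limit_rel N f, monoid.mult = undefined, one = undefined,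
      ring.zero = limit_rel N f `` {(0, \<zero>\<^bsub>N 0\<^esub>)},
      ring.add = (\<lambda>C D. limit_rel N f `` {(k, x \<oplus>\<^bsub>N k\<^esub> y) | k x y. (k, x) \<in> C \<and> (k, y) \<in> D}),
      smult = (\<lambda>r C. limit_rel N f `` {(k, r \<odot>\<^bsub>N k\<^esub> x) | k x. (k, x) \<in> C})\<rparr>"

definition is_direct_limit ::
    "('a, 'r) ring_scheme \<Rightarrow> (nat \<Rightarrow> ('a, 'b) module) \<Rightarrow> (nat \<Rightarrow> 'b \<Rightarrow> 'b) \<Rightarrow>
     ('a, 'c) module \<Rightarrow> (nat \<Rightarrow> 'b \<Rightarrow> 'c) \<Rightarrow> bool" where
  "is_direct_limit R N f L \<psi> \<longleftrightarrow>
     (\<exists>g\<in>mod_iso R (direct_limit N f) L.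
        \<forall>i. \<forall>x\<in>carrier (N i). g (limit_rel N f `` {(i, x)}) = \<psi> i x)"


section \<open>F-finite modules\<close>

definition F_module ::
    "('a, 'r) ring_scheme \<Rightarrow> nat \<Rightarrow> ('a, 'b) module \<Rightarrow> ('b \<Rightarrow> ('a \<times> 'b \<Rightarrow>\<^sub>0 int) set) \<Rightarrow> bool" where
  "F_module R p \<M> \<theta> \<longleftrightarrow> module R \<M> \<and> \<theta> \<in> mod_iso R \<M> (frob R p \<M>)"

text \<open>Here \<open>\<psi> i : F\<^sup>i(M) \<rightarrow> \<M>\<close> are the canonical maps to the limit. The canonical maps
  \<open>F\<^sup>i\<^sup>+\<^sup>1(M) \<rightarrow> F(\<M>)\<close> of the shifted system are \<open>F(\<psi> i)\<close>, so the last conjunct says that \<open>\<theta>\<close> is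
  induced by the maps \<open>F\<^sup>i(\<beta>)\<close>.\<close>

definition generating_morphism ::
    "('a, 'r) ring_scheme \<Rightarrow> nat \<Rightarrow> ('a, 'b) module \<Rightarrow> ('b \<Rightarrow> ('a \<times> 'b \<Rightarrow>\<^sub>0 int) set) \<Rightarrow>
     ('a, 'm) module \<Rightarrow> ('m \<Rightarrow> ('a \<times> 'm \<Rightarrow>\<^sub>0 int) set) \<Rightarrow> bool" where
  "generating_morphism R p \<M> \<theta> M \<beta> \<longleftrightarrow>
     module R M \<and> \<beta> \<in> mod_hom R M (frob R p M) \<and>
     (\<exists>\<psi>. is_direct_limit R (frob_iter R p M) (\<lambda>i. frob_code \<circ> frob_iter_map R p M \<beta> i) \<M> \<psi> \<and>
        (\<forall>i. \<forall>z\<in>carrier (frob_iter R p M i).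
           \<theta> (\<psi> i z) = frob_map R p \<M> (\<psi> i) (frob_iter_map R p M \<beta> i z)))"

definition root_morphism ::
    "('a, 'r) ring_scheme \<Rightarrow> nat \<Rightarrow> ('a, 'b) module \<Rightarrow> ('b \<Rightarrow> ('a \<times> 'b \<Rightarrow>\<^sub>0 int) set) \<Rightarrow>
     ('a, 'm) module \<Rightarrow> ('m \<Rightarrow> ('a \<times> 'm \<Rightarrow>\<^sub>0 int) set) \<Rightarrow> bool" where
  "root_morphism R p \<M> \<theta> M \<beta> \<longleftrightarrow> generating_morphism R p \<M> \<theta> M \<beta> \<and> inj_on \<beta> (carrier M)"

text \<open>The type argument is the type on which a finitely generated root lives; as a hypothesis with
  a free type variable it allows a root on any type.\<close>

definition F_finite ::
    "'m itself \<Rightarrow> ('a, 'r) ring_scheme \<Rightarrow> nat \<Rightarrow> ('a, 'b) module \<Rightarrow>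
     ('b \<Rightarrow> ('a \<times> 'b \<Rightarrow>\<^sub>0 int) set) \<Rightarrow> bool" where
  "F_finite _ R p \<M> \<theta> \<longleftrightarrow> F_module R p \<M> \<theta> \<and>
     (\<exists>(M::('a, 'm) module) \<beta>. finitely_generated R M \<and> root_morphism R p \<M> \<theta> M \<beta>)"


section \<open>Well-definedness of the constructions\<close>

lemma mod_homD:
  assumes "h \<in> mod_hom R M N"
  shows "x \<in> carrier M \<Longrightarrow> h x \<in> carrier N"
    and "x \<in> carrier M \<Longrightarrow> y \<in> carrier M \<Longrightarrow> h (x \<oplus>\<^bsub>M\<^esub> y) = h x \<oplus>\<^bsub>N\<^esub> h y"
    and "r \<in> carrier R \<Longrightarrow> x \<in> carrier M \<Longrightarrow> h (r \<odot>\<^bsub>M\<^esub> x) = r \<odot>\<^bsub>N\<^esub> h x"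
  using assms by (auto simp: mod_hom_def)

definition scalar_module :: "('a, 'r) ring_scheme \<Rightarrow> 'a set \<Rightarrow> ('a, 'a) module" where
  "scalar_module R I = \<lparr>carrier = I, monoid.mult = undefined, one = undefined,
      ring.zero = \<zero>\<^bsub>R\<^esub>, ring.add = ring.add R, smult = monoid.mult R\<rparr>"

lemma scalar_module_module:
  assumes "cring R" "ideal I R"
  shows "module R (scalar_module R I)"
proof -
  interpret cring R by fact
  interpret ideal I R by fact
  show ?thesis
  proof (rule moduleI)
    show "abelian_group (scalar_module R I)"
    proof (rule abelian_groupI)
      show "\<exists>y\<in>carrier (scalar_module R I). y \<oplus>\<^bsub>scalar_module R I\<^esub> x = \<zero>\<^bsub>scalar_module R I\<^esub>"
        if "x \<in> carrier (scalar_module R I)" for x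
        using that by (auto simp: scalar_module_def Icarr l_neg intro!: bexI[of _ "\<ominus>\<^bsub>R\<^esub> x"])
    qed (auto simp: scalar_module_def a_ac Icarr)
  qed (auto simp: scalar_module_def assms I_l_closed l_distr r_distr m_assoc Icarr)
qed

lemma injective_module_extend:
  fixes A :: "('a, 'c) module" and B :: "('a, 'd) module" and E :: "('a, 'e) module"
  assumes inj: "injective_module R E" and A: "module R A" and B: "module R B"
    and j: "j \<in> mod_hom R A B" "inj_on j (carrier A)" and f: "f \<in> mod_hom R A E"
  shows "\<exists>g\<in>mod_hom R B E. \<forall>x\<in>carrier A. g (j x) = f x"
proof -
  interpret A: module R A by fact
  interpret B: module R B by fact
  interpret E: module R E using inj by (simp add: injective_module_def)
  note jD = mod_homD[OF j(1)] and fD = mod_homD[OF f]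
  define S where "S = {G. G \<subseteq> carrier B \<times> carrier E \<and> (\<lambda>x. (j x, f x)) ` carrier A \<subseteq> G \<and>
    (\<forall>b e c d. (b, e) \<in> G \<and> (c, d) \<in> G \<longrightarrow> (b \<oplus>\<^bsub>B\<^esub> c, e \<oplus>\<^bsub>E\<^esub> d) \<in> G) \<and>
    (\<forall>r\<in>carrier R. \<forall>b e. (b, e) \<in> G \<longrightarrow> (r \<odot>\<^bsub>B\<^esub> b, r \<odot>\<^bsub>E\<^esub> e) \<in> G) \<and>
    (\<forall>e. (\<zero>\<^bsub>B\<^esub>, e) \<in> G \<longrightarrow> e = \<zero>\<^bsub>E\<^esub>)}"
  have j0: "j \<zero>\<^bsub>A\<^esub> = \<zero>\<^bsub>B\<^esub>" and f0: "f \<zero>\<^bsub>A\<^esub> = \<zero>\<^bsub>E\<^esub>"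
    using jD(3)[of "\<zero>\<^bsub>R\<^esub>" "\<zero>\<^bsub>A\<^esub>"] fD(3)[of "\<zero>\<^bsub>R\<^esub>" "\<zero>\<^bsub>A\<^esub>"] jD(1) fD(1) by simp_all
  have "f x = \<zero>\<^bsub>E\<^esub>" if "x \<in> carrier A" "j x = \<zero>\<^bsub>B\<^esub>" for x
    using that j(2) j0 f0 by (metis A.zero_closed inj_onD)
  then have base: "(\<lambda>x. (j x, f x)) ` carrier A \<in> S"
    unfolding S_def
    by (auto simp: jD(1) fD(1) image_iff)
       (metis A.a_closed jD(2) fD(2), metis A.smult_closed jD(3) fD(3))
  have "\<exists>G\<in>S. \<forall>Z\<in>S. G \<subseteq> Z \<longrightarrow> Z = G"
  proof (rule subset_Zorn_nonempty)
    show "S \<noteq> {}" using base by blast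
    fix \<C> assume ne: "\<C> \<noteq> {}" and ch: "subset.chain S \<C>"
    then have CS: "\<C> \<subseteq> S" and lin: "\<And>Z Y. Z \<in> \<C> \<Longrightarrow> Y \<in> \<C> \<Longrightarrow> Z \<subseteq> Y \<or> Y \<subseteq> Z"
      by (auto simp: subset_chain_def)
    show "\<Union>\<C> \<in> S"
      unfolding S_def mem_Collect_eq
    proof (intro conjI allI impI ballI)
      show "\<Union>\<C> \<subseteq> carrier B \<times> carrier E" using CS by (auto simp: S_def)
      show "(\<lambda>x. (j x, f x)) ` carrier A \<subseteq> \<Union>\<C>" using CS ne by (fastforce simp: S_def)
    next
      fix b e c d assume "(b, e) \<in> \<Union>\<C> \<and> (c, d) \<in> \<Union>\<C>"
      then obtain Z where "Z \<in> \<C>" "(b, e) \<in> Z" "(c, d) \<in> Z" using lin by blast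
      moreover from this(1) have "Z \<in> S" using CS by blast
      ultimately have "(b \<oplus>\<^bsub>B\<^esub> c, e \<oplus>\<^bsub>E\<^esub> d) \<in> Z" unfolding S_def by blast
      with \<open>Z \<in> \<C>\<close> show "(b \<oplus>\<^bsub>B\<^esub> c, e \<oplus>\<^bsub>E\<^esub> d) \<in> \<Union>\<C>" by blast
    next
      fix r b e assume "r \<in> carrier R" "(b, e) \<in> \<Union>\<C>"
      then show "(r \<odot>\<^bsub>B\<^esub> b, r \<odot>\<^bsub>E\<^esub> e) \<in> \<Union>\<C>" using CS by (fastforce simp: S_def)
    next
      fix e assume "(\<zero>\<^bsub>B\<^esub>, e) \<in> \<Union>\<C>"
      then show "e = \<zero>\<^bsub>E\<^esub>" using CS by (auto simp: S_def)
    qed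
  qed
  then obtain G where GS: "G \<in> S" and Gmax: "\<And>Z. Z \<in> S \<Longrightarrow> G \<subseteq> Z \<Longrightarrow> Z = G" by blast
  from GS have GA: "\<And>x. x \<in> carrier A \<Longrightarrow> (j x, f x) \<in> G" unfolding S_def by blast
  from GS have Gc: "\<And>b e. (b, e) \<in> G \<Longrightarrow> b \<in> carrier B \<and> e \<in> carrier E"
    and Gadd: "\<And>b e c d. (b, e) \<in> G \<Longrightarrow> (c, d) \<in> G \<Longrightarrow> (b \<oplus>\<^bsub>B\<^esub> c, e \<oplus>\<^bsub>E\<^esub> d) \<in> G"
    and Gsm: "\<And>r b e. r \<in> carrier R \<Longrightarrow> (b, e) \<in> G \<Longrightarrow> (r \<odot>\<^bsub>B\<^esub> b, r \<odot>\<^bsub>E\<^esub> e) \<in> G"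
    and G0: "\<And>e. (\<zero>\<^bsub>B\<^esub>, e) \<in> G \<Longrightarrow> e = \<zero>\<^bsub>E\<^esub>"
    unfolding S_def by (auto simp: subset_iff image_iff)
  have Gzero: "(\<zero>\<^bsub>B\<^esub>, \<zero>\<^bsub>E\<^esub>) \<in> G" using GA[of "\<zero>\<^bsub>A\<^esub>"] j0 f0 by simp
  have Bneg: "(\<ominus>\<^bsub>R\<^esub> \<one>\<^bsub>R\<^esub>) \<odot>\<^bsub>B\<^esub> b = \<ominus>\<^bsub>B\<^esub> b" if "b \<in> carrier B" for b
    using that B.smult_l_minus[of "\<one>\<^bsub>R\<^esub>" b] by simp
  have Eneg: "(\<ominus>\<^bsub>R\<^esub> \<one>\<^bsub>R\<^esub>) \<odot>\<^bsub>E\<^esub> b = \<ominus>\<^bsub>E\<^esub> b" if "b \<in> carrier E" for b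
    using that E.smult_l_minus[of "\<one>\<^bsub>R\<^esub>" b] by simp
  have Gneg: "(\<ominus>\<^bsub>B\<^esub> b, \<ominus>\<^bsub>E\<^esub> e) \<in> G" if "(b, e) \<in> G" for b e
    using Gsm[of "\<ominus>\<^bsub>R\<^esub> \<one>\<^bsub>R\<^esub>", OF _ that] Gc[OF that] Bneg Eneg by simp
  have Guniq: "e = d" if "(b, e) \<in> G" "(b, d) \<in> G" for b e d
  proof -
    have c: "b \<in> carrier B" "e \<in> carrier E" "d \<in> carrier E" using Gc that by auto
    have "(b \<oplus>\<^bsub>B\<^esub> \<ominus>\<^bsub>B\<^esub> b, e \<oplus>\<^bsub>E\<^esub> \<ominus>\<^bsub>E\<^esub> d) \<in> G" by (intro Gadd Gneg that)
    then have "e \<oplus>\<^bsub>E\<^esub> \<ominus>\<^bsub>E\<^esub> d = \<zero>\<^bsub>E\<^esub>" using G0 c by (simp add: B.r_neg)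
    then show ?thesis using c by (metis E.minus_equality E.minus_minus E.a_inv_closed)
  qed
  have total: "\<exists>e. (b, e) \<in> G" if b: "b \<in> carrier B" for b
  proof -
    define I where "I = {r \<in> carrier R. \<exists>e. (r \<odot>\<^bsub>B\<^esub> b, e) \<in> G}"
    have I: "ideal I R"
    proof (rule idealI)
      show "ring R" by (rule A.R.ring_axioms)
      show "subgroup I (add_monoid R)"
      proof (rule A.R.add.subgroupI)
        show "I \<subseteq> carrier R" by (auto simp: I_def)
        show "I \<noteq> {}" using Gzero b by (auto simp: I_def intro!: exI[of _ "\<zero>\<^bsub>R\<^esub>"])
        show "\<ominus>\<^bsub>R\<^esub> a \<in> I" if "a \<in> I" for a
          using that b Gneg by (fastforce simp: I_def B.smult_l_minus)
        show "a \<oplus>\<^bsub>R\<^esub> c \<in> I" if "a \<in> I" "c \<in> I" for a c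
          using that b Gadd by (fastforce simp: I_def B.smult_l_distr)
      qed
      show "x \<otimes>\<^bsub>R\<^esub> a \<in> I" if "a \<in> I" "x \<in> carrier R" for a x
        using that b Gsm by (fastforce simp: I_def B.smult_assoc1)
      then show "a \<otimes>\<^bsub>R\<^esub> x \<in> I" if "a \<in> I" "x \<in> carrier R" for a x
        using that by (metis (no_types, lifting) A.R.m_comm I_def mem_Collect_eq)
    qed
    define h where "h r = (THE e. (r \<odot>\<^bsub>B\<^esub> b, e) \<in> G)" for r
    have h: "(r \<odot>\<^bsub>B\<^esub> b, h r) \<in> G" if "r \<in> I" for r
      using that Guniq unfolding I_def h_def by (auto intro: theI2)
    have hI: "h r = e" if "(r \<odot>\<^bsub>B\<^esub> b, e) \<in> G" for r e
      using that Guniq unfolding h_def by blast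
    have Ic: "r \<in> carrier R" if "r \<in> I" for r using that by (simp add: I_def)
    have hh: "h \<in> mod_hom R (scalar_module R I) E"
      unfolding mod_hom_def scalar_module_def
    proof (simp, intro conjI ballI)
      show "h \<in> I \<rightarrow> carrier E" using h Gc by blast
      show "h (x \<oplus>\<^bsub>R\<^esub> y) = h x \<oplus>\<^bsub>E\<^esub> h y" if "x \<in> I" "y \<in> I" for x y
        using Gadd[OF h[OF that(1)] h[OF that(2)]] b Ic that by (intro hI) (simp add: B.smult_l_distr)
      show "h (r \<otimes>\<^bsub>R\<^esub> x) = r \<odot>\<^bsub>E\<^esub> h x" if "r \<in> carrier R" "x \<in> I" for r x
        using Gsm[OF that(1) h[OF that(2)]] b Ic that by (intro hI) (simp add: B.smult_assoc1)
    qed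
    have "(\<lambda>x. x) \<in> mod_hom R (scalar_module R I) (scalar_module R (carrier R))"
      using Ic by (auto simp: mod_hom_def scalar_module_def)
    with hh inj obtain g where g: "g \<in> mod_hom R (scalar_module R (carrier R)) E"
      and gh: "\<And>x. x \<in> I \<Longrightarrow> g x = h x"
      using scalar_module_module[OF A.R.is_cring I] scalar_module_module[OF A.R.is_cring A.R.oneideal]
      unfolding injective_module_def
      by (elim conjE allE[of _ "scalar_module R I"] allE[of _ "scalar_module R (carrier R)"]
          allE[of _ "\<lambda>x. x"] allE[of _ h]) (auto simp: scalar_module_def)
    define e0 where "e0 = g \<one>\<^bsub>R\<^esub>"
    have e0: "e0 \<in> carrier E" using mod_homD(1)[OF g] by (simp add: e0_def scalar_module_def)
    have ge0: "g r = r \<odot>\<^bsub>E\<^esub> e0" if "r \<in> carrier R" for r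
      using mod_homD(3)[OF g, of r "\<one>\<^bsub>R\<^esub>"] that by (simp add: e0_def scalar_module_def)
    define G' where "G' = {(c \<oplus>\<^bsub>B\<^esub> r \<odot>\<^bsub>B\<^esub> b, d \<oplus>\<^bsub>E\<^esub> r \<odot>\<^bsub>E\<^esub> e0) | c d r. (c, d) \<in> G \<and> r \<in> carrier R}"
    have G'I: "(c \<oplus>\<^bsub>B\<^esub> r \<odot>\<^bsub>B\<^esub> b, d \<oplus>\<^bsub>E\<^esub> r \<odot>\<^bsub>E\<^esub> e0) \<in> G'" if "(c, d) \<in> G" "r \<in> carrier R" for c d r
      using that by (auto simp: G'_def)
    have GG': "G \<subseteq> G'"
    proof (clarify)
      fix c d assume cd: "(c, d) \<in> G"
      show "(c, d) \<in> G'" using G'I[OF cd A.R.zero_closed] Gc[OF cd] b e0 by simp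
    qed
    have "G' \<in> S"
      unfolding S_def mem_Collect_eq
    proof (intro conjI allI impI ballI)
      show "G' \<subseteq> carrier B \<times> carrier E" using Gc b e0 by (auto simp: G'_def)
      show "(\<lambda>x. (j x, f x)) ` carrier A \<subseteq> G'" using GA GG' by auto
    next
      fix u v w z assume "(u, v) \<in> G' \<and> (w, z) \<in> G'"
      then obtain c d r c' d' r' where *: "(c, d) \<in> G" "(c', d') \<in> G" "r \<in> carrier R" "r' \<in> carrier R"
        "u = c \<oplus>\<^bsub>B\<^esub> r \<odot>\<^bsub>B\<^esub> b" "v = d \<oplus>\<^bsub>E\<^esub> r \<odot>\<^bsub>E\<^esub> e0" "w = c' \<oplus>\<^bsub>B\<^esub> r' \<odot>\<^bsub>B\<^esub> b" "z = d' \<oplus>\<^bsub>E\<^esub> r' \<odot>\<^bsub>E\<^esub> e0"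
        by (auto simp: G'_def)
      then show "(u \<oplus>\<^bsub>B\<^esub> w, v \<oplus>\<^bsub>E\<^esub> z) \<in> G'"
        using G'I[OF Gadd[OF *(1,2)], of "r \<oplus>\<^bsub>R\<^esub> r'"] Gc[OF *(1)] Gc[OF *(2)] b e0
        by (simp add: B.smult_l_distr E.smult_l_distr B.a_ac E.a_ac)
    next
      fix s u v assume s: "s \<in> carrier R" and "(u, v) \<in> G'"
      then obtain c d r where *: "(c, d) \<in> G" "r \<in> carrier R"
        "u = c \<oplus>\<^bsub>B\<^esub> r \<odot>\<^bsub>B\<^esub> b" "v = d \<oplus>\<^bsub>E\<^esub> r \<odot>\<^bsub>E\<^esub> e0" by (auto simp: G'_def)
      then show "(s \<odot>\<^bsub>B\<^esub> u, s \<odot>\<^bsub>E\<^esub> v) \<in> G'"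
        using G'I[OF Gsm[OF s *(1)], of "s \<otimes>\<^bsub>R\<^esub> r"] Gc[OF *(1)] b e0 s
        by (simp add: B.smult_r_distr E.smult_r_distr B.smult_assoc1 E.smult_assoc1)
    next
      fix e assume "(\<zero>\<^bsub>B\<^esub>, e) \<in> G'"
      then obtain c d r where *: "(c, d) \<in> G" "r \<in> carrier R"
        "\<zero>\<^bsub>B\<^esub> = c \<oplus>\<^bsub>B\<^esub> r \<odot>\<^bsub>B\<^esub> b" "e = d \<oplus>\<^bsub>E\<^esub> r \<odot>\<^bsub>E\<^esub> e0" by (auto simp: G'_def)
      note c = Gc[OF *(1)]
      have "r \<odot>\<^bsub>B\<^esub> b = \<ominus>\<^bsub>B\<^esub> c"
        using *(2,3) c b by (metis B.a_comm B.minus_equality B.smult_closed)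
      then have rb: "(r \<odot>\<^bsub>B\<^esub> b, \<ominus>\<^bsub>E\<^esub> d) \<in> G" using Gneg[OF *(1)] by simp
      then have "r \<in> I" using *(2) by (auto simp: I_def)
      then have "r \<odot>\<^bsub>E\<^esub> e0 = \<ominus>\<^bsub>E\<^esub> d" using gh ge0 hI[OF rb] *(2) by metis
      then show "e = \<zero>\<^bsub>E\<^esub>" using *(4) c by (simp add: E.r_neg)
    qed
    then have "G' = G" using Gmax GG' by blast
    moreover have "(b, e0) \<in> G'" using G'I[OF Gzero A.R.one_closed] b e0 by simp
    ultimately show ?thesis by blast
  qed
  define g where "g b = (THE e. (b, e) \<in> G)" for b
  have gI: "g b = e" if "(b, e) \<in> G" for b e using that Guniq unfolding g_def by blast
  have g: "(b, g b) \<in> G" if "b \<in> carrier B" for b using total[OF that] gI by auto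
  have "g \<in> mod_hom R B E"
    unfolding mod_hom_def using g Gc by (auto intro!: gI Gadd Gsm)
  moreover have "\<forall>x\<in>carrier A. g (j x) = f x" using gI GA by blast
  ultimately show ?thesis by blast
qed

context
  fixes R :: "('a, 'r) ring_scheme" and p :: nat and M :: "('a, 'b) module"
  assumes M: "module R M"
begin

interpretation module R M by (rule M)

lemma frob_rels_subgroup: "subgroup (frob_rels R p M) (frob_free R M)"
  unfolding frob_rels_def
proof (rule group.generate_is_subgroup)
  have "Poly_Mapping.keys (frag_of s - frag_of t) \<subseteq> {s, t}"
    and "Poly_Mapping.keys (frag_of s - frag_of t - frag_of u) \<subseteq> {s, t, u}" for s t u :: "'a \<times> 'b"
    by (auto simp: in_keys_iff lookup_minus split: if_splits)
  then show "{frag_of (a \<oplus>\<^bsub>R\<^esub> b, x) - frag_of (a, x) - frag_of (b, x) | a b x.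
          a \<in> carrier R \<and> b \<in> carrier R \<and> x \<in> carrier M} \<union>
      {frag_of (a, x \<oplus>\<^bsub>M\<^esub> y) - frag_of (a, x) - frag_of (a, y) | a x y.
          a \<in> carrier R \<and> x \<in> carrier M \<and> y \<in> carrier M} \<union>
      {frag_of ((r [^]\<^bsub>R\<^esub> p) \<otimes>\<^bsub>R\<^esub> a, x) - frag_of (a, r \<odot>\<^bsub>M\<^esub> x) | r a x.
          r \<in> carrier R \<and> a \<in> carrier R \<and> x \<in> carrier M} \<subseteq> carrier (frob_free R M)"
    by (fastforce dest: subsetD)
qed simp

lemma frob_rels_add: "u \<in> frob_rels R p M \<Longrightarrow> v \<in> frob_rels R p M \<Longrightarrow> u + v \<in> frob_rels R p M"
  using subgroup.m_closed[OF frob_rels_subgroup] by simp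

lemma frob_rels_keys: "u \<in> frob_rels R p M \<Longrightarrow> Poly_Mapping.keys u \<subseteq> carrier R \<times> carrier M"
  using subgroup.mem_carrier[OF frob_rels_subgroup] by (metis carrier_free_Abelian_group_iff)

lemma frob_rels_minus: "u \<in> frob_rels R p M \<Longrightarrow> - u \<in> frob_rels R p M"
  using subgroup.m_inv_closed[OF frob_rels_subgroup] frob_rels_keys by (metis inv_free_Abelian_group)

lemma frob_rels_diff: "u \<in> frob_rels R p M \<Longrightarrow> v \<in> frob_rels R p M \<Longrightarrow> u - v \<in> frob_rels R p M"
  using frob_rels_add[of u "- v"] frob_rels_minus by simp

lemma frob_rels_zero: "0 \<in> frob_rels R p M"
  using subgroup.one_closed[OF frob_rels_subgroup] by simp

lemma frob_rels_gens:
  shows "a \<in> carrier R \<Longrightarrow> b \<in> carrier R \<Longrightarrow> x \<in> carrier M \<Longrightarrow>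
          frag_of (a \<oplus>\<^bsub>R\<^esub> b, x) - frag_of (a, x) - frag_of (b, x) \<in> frob_rels R p M"
    and "a \<in> carrier R \<Longrightarrow> x \<in> carrier M \<Longrightarrow> y \<in> carrier M \<Longrightarrow>
          frag_of (a, x \<oplus>\<^bsub>M\<^esub> y) - frag_of (a, x) - frag_of (a, y) \<in> frob_rels R p M"
    and "a \<in> carrier R \<Longrightarrow> r \<in> carrier R \<Longrightarrow> x \<in> carrier M \<Longrightarrow>
          frag_of ((r [^]\<^bsub>R\<^esub> p) \<otimes>\<^bsub>R\<^esub> a, x) - frag_of (a, r \<odot>\<^bsub>M\<^esub> x) \<in> frob_rels R p M"
  unfolding frob_rels_def by (rule generate.incl; blast)+

lemma frob_coset: "frob_rels R p M #>\<^bsub>frob_free R M\<^esub> c = {c + k | k. k \<in> frob_rels R p M}"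
  by (auto simp: r_coset_def add.commute)

lemma frob_coset_eq:
  "frob_rels R p M #>\<^bsub>frob_free R M\<^esub> c = frob_rels R p M #>\<^bsub>frob_free R M\<^esub> d \<longleftrightarrow> c - d \<in> frob_rels R p M"
proof
  assume "frob_rels R p M #>\<^bsub>frob_free R M\<^esub> c = frob_rels R p M #>\<^bsub>frob_free R M\<^esub> d"
  moreover have "c \<in> frob_rels R p M #>\<^bsub>frob_free R M\<^esub> c"
    unfolding frob_coset using frob_rels_zero by force
  ultimately show "c - d \<in> frob_rels R p M" unfolding frob_coset by auto
next
  assume *: "c - d \<in> frob_rels R p M"
  have "c + k = d + (c - d + k)" "d + k = c + (k - (c - d))" for k by simp_all
  with * show "frob_rels R p M #>\<^bsub>frob_free R M\<^esub> c = frob_rels R p M #>\<^bsub>frob_free R M\<^esub> d"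
    unfolding frob_coset using frob_rels_add frob_rels_diff by blast
qed

lemma carrier_frob:
  "carrier (frob R p M) =
     {frob_rels R p M #>\<^bsub>frob_free R M\<^esub> c | c. Poly_Mapping.keys c \<subseteq> carrier R \<times> carrier M}"
  by (auto simp: frob_def FactGroup_def RCOSETS_def)

lemma frob_zero: "\<zero>\<^bsub>frob R p M\<^esub> = frob_rels R p M #>\<^bsub>frob_free R M\<^esub> 0"
  by (simp add: frob_def FactGroup_def frob_coset)

lemma frob_add:
  "(frob_rels R p M #>\<^bsub>frob_free R M\<^esub> c) \<oplus>\<^bsub>frob R p M\<^esub> (frob_rels R p M #>\<^bsub>frob_free R M\<^esub> d)
     = frob_rels R p M #>\<^bsub>frob_free R M\<^esub> (c + d)"
proof -
  let ?K = "frob_rels R p M"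
  have "(\<Union>u\<in>{c + k | k. k \<in> ?K}. \<Union>v\<in>{d + k | k. k \<in> ?K}. {u + v}) = {c + d + k | k. k \<in> ?K}"
    (is "?L = ?R")
  proof (intro equalityI subsetI)
    fix z assume "z \<in> ?L"
    then obtain k l where "k \<in> ?K" "l \<in> ?K" "z = c + d + (k + l)" by (auto simp: algebra_simps)
    then show "z \<in> ?R" using frob_rels_add by blast
  next
    fix z assume "z \<in> ?R"
    then obtain k where "k \<in> ?K" "z = (c + k) + (d + 0)" by (auto simp: algebra_simps)
    then show "z \<in> ?L" using frob_rels_zero by blast
  qed
  then show ?thesis
    unfolding frob_coset by (simp add: frob_def FactGroup_def set_mult_def)
qed

lemma frob_inv_tensor:
  assumes "a \<in> carrier R" "x \<in> carrier M"
  shows "frag_of (\<ominus>\<^bsub>R\<^esub> a, x) + frag_of (a, x) \<in> frob_rels R p M"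
proof -
  have 0: "- frag_of (\<zero>\<^bsub>R\<^esub>, x) \<in> frob_rels R p M"
    using frob_rels_gens(1)[of "\<zero>\<^bsub>R\<^esub>" "\<zero>\<^bsub>R\<^esub>" x] assms by simp
  have "frag_of (\<zero>\<^bsub>R\<^esub>, x) - frag_of (\<ominus>\<^bsub>R\<^esub> a, x) - frag_of (a, x) \<in> frob_rels R p M"
    using frob_rels_gens(1)[of "\<ominus>\<^bsub>R\<^esub> a" a x] assms by (simp add: R.l_neg)
  from frob_rels_minus[OF frob_rels_add[OF this 0]] show ?thesis by (simp add: add.commute)
qed

lemma sum_of_tensors:
  assumes "Poly_Mapping.keys c \<subseteq> carrier R \<times> carrier M"
  shows "\<exists>l. set l \<subseteq> carrier R \<times> carrier M \<and> (\<Sum>t\<leftarrow>l. frag_of t) - c \<in> frob_rels R p M"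
  using assms
proof (induction c rule: frag_induction)
  case zero
  then show ?case using frob_rels_zero by (intro exI[of _ "[]"]) simp
next
  case (one t)
  then show ?case using frob_rels_zero by (intro exI[of _ "[t]"]) simp
next
  case (diff c d)
  then obtain l l' where l: "set l \<subseteq> carrier R \<times> carrier M" "(\<Sum>t\<leftarrow>l. frag_of t) - c \<in> frob_rels R p M"
    "set l' \<subseteq> carrier R \<times> carrier M" "(\<Sum>t\<leftarrow>l'. frag_of t) - d \<in> frob_rels R p M" by blast
  let ?n = "\<lambda>(a, x). (\<ominus>\<^bsub>R\<^esub> a, x)"
  have n: "(\<Sum>t\<leftarrow>map ?n l'. frag_of t) + (\<Sum>t\<leftarrow>l'. frag_of t) \<in> frob_rels R p M" using l(3)
  proof (induction l')
    case Nil
    then show ?case using frob_rels_zero by simp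
  next
    case (Cons t l')
    obtain a x where t: "t = (a, x)" by fastforce
    from Cons have "(\<Sum>t\<leftarrow>map ?n l'. frag_of t) + (\<Sum>t\<leftarrow>l'. frag_of t) \<in> frob_rels R p M" by simp
    from frob_rels_add[OF frob_inv_tensor[of a x] this] show ?case
      using Cons.prems by (simp add: t algebra_simps)
  qed
  from frob_rels_diff[OF frob_rels_add[OF l(2) n] l(4)]
  have "(\<Sum>t\<leftarrow>l @ map ?n l'. frag_of t) - (c - d) \<in> frob_rels R p M"
    by (simp add: algebra_simps)
  moreover have "set (l @ map ?n l') \<subseteq> carrier R \<times> carrier M" using l(1,3) by auto
  ultimately show ?case by blast
qed

end

lemma induced_coset:
  fixes M :: "('a, 'b) module" and N :: "('a, 'c) module"
  assumes M: "module R M" and N: "module R N"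
    and rels: "\<And>k. k \<in> frob_rels R p M \<Longrightarrow> frag_extend \<phi> k \<in> frob_rels R p N"
  shows "frob_rels R p N <#>\<^bsub>frob_free R N\<^esub> (frag_extend \<phi> ` (frob_rels R p M #>\<^bsub>frob_free R M\<^esub> c))
     = frob_rels R p N #>\<^bsub>frob_free R N\<^esub> frag_extend \<phi> c"
proof -
  let ?K = "frob_rels R p M" and ?K' = "frob_rels R p N" and ?f = "frag_extend \<phi>"
  have "(\<Union>u\<in>?K'. \<Union>v\<in>?f ` {c + k | k. k \<in> ?K}. {u + v}) = {?f c + k | k. k \<in> ?K'}"
    (is "?L = ?R")
  proof (intro equalityI subsetI)
    fix z assume "z \<in> ?L"
    then obtain u k where "u \<in> ?K'" "k \<in> ?K" "z = ?f c + (u + ?f k)"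
      by (auto simp: frag_extend_add algebra_simps)
    then show "z \<in> ?R" using frob_rels_add[OF N] rels by blast
  next
    fix z assume "z \<in> ?R"
    then obtain u where "u \<in> ?K'" "z = u + ?f (c + 0)" by (auto simp: algebra_simps)
    then show "z \<in> ?L" using frob_rels_zero[OF M] by blast
  qed
  then show ?thesis
    unfolding frob_coset[OF M] frob_coset[OF N] by (simp add: set_mult_def)
qed

lemma induced_rels:
  fixes M :: "('a, 'b) module" and N :: "('a, 'c) module"
  assumes M: "module R M" and N: "module R N"
    and 1: "\<And>a b x. a \<in> carrier R \<Longrightarrow> b \<in> carrier R \<Longrightarrow> x \<in> carrier M \<Longrightarrow>
          \<phi> (a \<oplus>\<^bsub>R\<^esub> b, x) - \<phi> (a, x) - \<phi> (b, x) \<in> frob_rels R p N"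
    and 2: "\<And>a x y. a \<in> carrier R \<Longrightarrow> x \<in> carrier M \<Longrightarrow> y \<in> carrier M \<Longrightarrow>
          \<phi> (a, x \<oplus>\<^bsub>M\<^esub> y) - \<phi> (a, x) - \<phi> (a, y) \<in> frob_rels R p N"
    and 3: "\<And>a r x. a \<in> carrier R \<Longrightarrow> r \<in> carrier R \<Longrightarrow> x \<in> carrier M \<Longrightarrow>
          \<phi> ((r [^]\<^bsub>R\<^esub> p) \<otimes>\<^bsub>R\<^esub> a, x) - \<phi> (a, r \<odot>\<^bsub>M\<^esub> x) \<in> frob_rels R p N"
    and k: "k \<in> frob_rels R p M"
  shows "frag_extend \<phi> k \<in> frob_rels R p N"
proof -
  have gen: "frag_extend \<phi> h \<in> frob_rels R p N" if
    "h \<in> {frag_of (a \<oplus>\<^bsub>R\<^esub> b, x) - frag_of (a, x) - frag_of (b, x) | a b x.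
          a \<in> carrier R \<and> b \<in> carrier R \<and> x \<in> carrier M} \<union>
      {frag_of (a, x \<oplus>\<^bsub>M\<^esub> y) - frag_of (a, x) - frag_of (a, y) | a x y.
          a \<in> carrier R \<and> x \<in> carrier M \<and> y \<in> carrier M} \<union>
      {frag_of ((r [^]\<^bsub>R\<^esub> p) \<otimes>\<^bsub>R\<^esub> a, x) - frag_of (a, r \<odot>\<^bsub>M\<^esub> x) | r a x.
          r \<in> carrier R \<and> a \<in> carrier R \<and> x \<in> carrier M}" for h
    using that by (auto simp: frag_extend_diff 1 2 3)
  from k[unfolded frob_rels_def] show ?thesis
  proof (induction rule: generate.induct)
    case one
    then show ?case using frob_rels_zero[OF N] by simp
  next
    case (incl h)
    then show ?case by (rule gen)
  next
    case (inv h)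
    then have "h \<in> frob_rels R p M" unfolding frob_rels_def by (rule generate.incl)
    then have "inv\<^bsub>frob_free R M\<^esub> h = - h" using frob_rels_keys[OF M] by simp
    then show ?case using frob_rels_minus[OF N gen[OF inv]] by (simp add: frag_extend_minus)
  next
    case (eng h1 h2)
    then show ?case using frob_rels_add[OF N] by (simp add: frag_extend_add)
  qed
qed

context
  fixes R :: "('a, 'r) ring_scheme" and p :: nat and M :: "('a, 'b) module"
  assumes M: "module R M"
begin

interpretation module R M by (rule M)

lemma frob_smult:
  assumes "r \<in> carrier R"
  shows "r \<odot>\<^bsub>frob R p M\<^esub> (frob_rels R p M #>\<^bsub>frob_free R M\<^esub> c)
     = frob_rels R p M #>\<^bsub>frob_free R M\<^esub> frag_extend (\<lambda>(a, x). frag_of (r \<otimes>\<^bsub>R\<^esub> a, x)) c"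
proof -
  have "frag_extend (\<lambda>(a, x). frag_of (r \<otimes>\<^bsub>R\<^esub> a, x)) k \<in> frob_rels R p M" if "k \<in> frob_rels R p M" for k
  proof (rule induced_rels[OF M M _ _ _ that])
    fix a s x assume *: "a \<in> carrier R" "s \<in> carrier R" "x \<in> carrier M"
    have "r \<otimes>\<^bsub>R\<^esub> (s [^]\<^bsub>R\<^esub> p \<otimes>\<^bsub>R\<^esub> a) = s [^]\<^bsub>R\<^esub> p \<otimes>\<^bsub>R\<^esub> (r \<otimes>\<^bsub>R\<^esub> a)"
      using * assms by (simp add: R.m_lcomm)
    then show "(case (s [^]\<^bsub>R\<^esub> p \<otimes>\<^bsub>R\<^esub> a, x) of (a, x) \<Rightarrow> frag_of (r \<otimes>\<^bsub>R\<^esub> a, x)) -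
        (case (a, s \<odot>\<^bsub>M\<^esub> x) of (a, x) \<Rightarrow> frag_of (r \<otimes>\<^bsub>R\<^esub> a, x)) \<in> frob_rels R p M"
      using frob_rels_gens(3)[OF M] * assms by simp
  qed (use assms in \<open>simp_all add: R.r_distr frob_rels_gens[OF M]\<close>)
  then show ?thesis
    by (simp add: frob_def induced_coset[OF M M])
qed

lemma frob_smult_keys:
  assumes "r \<in> carrier R" "Poly_Mapping.keys c \<subseteq> carrier R \<times> carrier M"
  shows "Poly_Mapping.keys (frag_extend (\<lambda>(a, x). frag_of (r \<otimes>\<^bsub>R\<^esub> a, x)) c) \<subseteq> carrier R \<times> carrier M"
proof
  fix t assume "t \<in> Poly_Mapping.keys (frag_extend (\<lambda>(a, x). frag_of (r \<otimes>\<^bsub>R\<^esub> a, x)) c)"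
  then obtain a x where "(a, x) \<in> Poly_Mapping.keys c" "t = (r \<otimes>\<^bsub>R\<^esub> a, x)"
    using keys_frag_extend[of "\<lambda>(a, x). frag_of (r \<otimes>\<^bsub>R\<^esub> a, x)" c] by auto
  then show "t \<in> carrier R \<times> carrier M" using assms by auto
qed

lemma frob_module: "module R (frob R p M)"
proof (rule moduleI)
  let ?\<phi> = "\<lambda>r. frag_extend (\<lambda>(a, x). frag_of (r \<otimes>\<^bsub>R\<^esub> a, x))"
  note simps = frob_zero[OF M] frob_add[OF M] frob_smult frob_coset_eq[OF M]
  note keys = frob_smult_keys
  have cI: "frob_rels R p M #>\<^bsub>frob_free R M\<^esub> c \<in> carrier (frob R p M)"
    if "Poly_Mapping.keys c \<subseteq> carrier R \<times> carrier M" for c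
    using that carrier_frob[OF M] by blast
  have kadd: "Poly_Mapping.keys (c + d) \<subseteq> carrier R \<times> carrier M"
    if "Poly_Mapping.keys c \<subseteq> carrier R \<times> carrier M" "Poly_Mapping.keys d \<subseteq> carrier R \<times> carrier M"
    for c d :: "'a \<times> 'b \<Rightarrow>\<^sub>0 int" using that Poly_Mapping.keys_add[of c d] by blast
  have cE: "\<exists>c. C = frob_rels R p M #>\<^bsub>frob_free R M\<^esub> c \<and> Poly_Mapping.keys c \<subseteq> carrier R \<times> carrier M"
    if "C \<in> carrier (frob R p M)" for C
    using that carrier_frob[OF M] by blast
  show "cring R" by (rule R.is_cring)
  show "abelian_group (frob R p M)"
  proof (rule abelian_groupI)
    show "\<zero>\<^bsub>frob R p M\<^esub> \<in> carrier (frob R p M)" using cI by (simp add: simps)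
    fix C assume "C \<in> carrier (frob R p M)"
    then obtain c where C: "C = frob_rels R p M #>\<^bsub>frob_free R M\<^esub> c"
      and c: "Poly_Mapping.keys c \<subseteq> carrier R \<times> carrier M" using cE by blast
    show "\<zero>\<^bsub>frob R p M\<^esub> \<oplus>\<^bsub>frob R p M\<^esub> C = C" by (simp add: C simps frob_rels_zero[OF M])
    show "\<exists>D\<in>carrier (frob R p M). D \<oplus>\<^bsub>frob R p M\<^esub> C = \<zero>\<^bsub>frob R p M\<^esub>"
      using cI[of "- c"] c
      by (intro bexI[of _ "frob_rels R p M #>\<^bsub>frob_free R M\<^esub> (- c)"])
         (simp_all add: C simps frob_rels_zero[OF M])
    fix D assume "D \<in> carrier (frob R p M)"
    then obtain d where D: "D = frob_rels R p M #>\<^bsub>frob_free R M\<^esub> d"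
      and d: "Poly_Mapping.keys d \<subseteq> carrier R \<times> carrier M" using cE by blast
    show "C \<oplus>\<^bsub>frob R p M\<^esub> D \<in> carrier (frob R p M)" using cI kadd c d by (simp add: C D simps)
    show "C \<oplus>\<^bsub>frob R p M\<^esub> D = D \<oplus>\<^bsub>frob R p M\<^esub> C" by (simp add: C D simps frob_rels_zero[OF M])
    fix B assume "B \<in> carrier (frob R p M)"
    then obtain b where B: "B = frob_rels R p M #>\<^bsub>frob_free R M\<^esub> b" using cE by blast
    show "C \<oplus>\<^bsub>frob R p M\<^esub> D \<oplus>\<^bsub>frob R p M\<^esub> B = C \<oplus>\<^bsub>frob R p M\<^esub> (D \<oplus>\<^bsub>frob R p M\<^esub> B)"
      by (simp add: C D B simps add.assoc)
  qed
  fix C assume "C \<in> carrier (frob R p M)"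
  then obtain c where C: "C = frob_rels R p M #>\<^bsub>frob_free R M\<^esub> c"
    and c: "Poly_Mapping.keys c \<subseteq> carrier R \<times> carrier M" using cE by blast
  show "\<one>\<^bsub>R\<^esub> \<odot>\<^bsub>frob R p M\<^esub> C = C"
  proof -
    have "?\<phi> \<one>\<^bsub>R\<^esub> c = c" using c
      by (induction c rule: frag_induction) (auto simp: frag_extend_diff)
    then show ?thesis by (simp add: C simps frob_rels_zero[OF M])
  qed
  fix r assume r: "r \<in> carrier R"
  show "r \<odot>\<^bsub>frob R p M\<^esub> C \<in> carrier (frob R p M)" using r c keys cI by (simp add: C simps)
  { fix D assume "D \<in> carrier (frob R p M)"
    then obtain d where D: "D = frob_rels R p M #>\<^bsub>frob_free R M\<^esub> d" using cE by blast
    show "r \<odot>\<^bsub>frob R p M\<^esub> (C \<oplus>\<^bsub>frob R p M\<^esub> D) = r \<odot>\<^bsub>frob R p M\<^esub> C \<oplus>\<^bsub>frob R p M\<^esub> r \<odot>\<^bsub>frob R p M\<^esub> D"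
      using r by (simp add: C D simps frag_extend_add frob_rels_zero[OF M]) }
  fix s assume s: "s \<in> carrier R"
  show "(r \<otimes>\<^bsub>R\<^esub> s) \<odot>\<^bsub>frob R p M\<^esub> C = r \<odot>\<^bsub>frob R p M\<^esub> (s \<odot>\<^bsub>frob R p M\<^esub> C)"
  proof -
    have "?\<phi> (r \<otimes>\<^bsub>R\<^esub> s) c = ?\<phi> r (?\<phi> s c)" using c
      by (induction c rule: frag_induction) (auto simp: frag_extend_diff R.m_assoc r s)
    then show ?thesis using r s by (simp add: C simps frob_rels_zero[OF M])
  qed
  show "(r \<oplus>\<^bsub>R\<^esub> s) \<odot>\<^bsub>frob R p M\<^esub> C = r \<odot>\<^bsub>frob R p M\<^esub> C \<oplus>\<^bsub>frob R p M\<^esub> s \<odot>\<^bsub>frob R p M\<^esub> C"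
  proof -
    have "?\<phi> (r \<oplus>\<^bsub>R\<^esub> s) c - (?\<phi> r c + ?\<phi> s c) \<in> frob_rels R p M" using c
    proof (induction c rule: frag_induction)
      case zero
      then show ?case using frob_rels_zero[OF M] by simp
    next
      case (one t)
      then obtain a x where t: "t = (a, x)" "a \<in> carrier R" "x \<in> carrier M" by auto
      then show ?case
        using frob_rels_gens(1)[OF M, of "r \<otimes>\<^bsub>R\<^esub> a" "s \<otimes>\<^bsub>R\<^esub> a" x] r s
        by (simp add: R.l_distr diff_diff_eq)
    next
      case (diff c d)
      from frob_rels_diff[OF M diff] show ?case by (simp add: frag_extend_diff algebra_simps)
    qed
    then show ?thesis using r s by (simp add: C simps)
  qed
qed

end

lemma frob_map_hom:
  assumes M: "module R M" and N: "module R N" and h: "h \<in> mod_hom R M N"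
  shows "frob_map R p N h \<in> mod_hom R (frob R p M) (frob R p N)"
proof -
  interpret M: module R M by fact
  interpret N: module R N by fact
  note hD = mod_homD[OF h]
  let ?h = "frag_extend (\<lambda>(a, x). frag_of (a, h x))"
  have rels: "?h k \<in> frob_rels R p N" if "k \<in> frob_rels R p M" for k
    by (rule induced_rels[OF M N _ _ _ that]) (simp_all add: hD frob_rels_gens[OF N])
  have eq: "frob_map R p N h (frob_rels R p M #>\<^bsub>frob_free R M\<^esub> c)
      = frob_rels R p N #>\<^bsub>frob_free R N\<^esub> ?h c" for c
    unfolding frob_map_def by (rule induced_coset[OF M N rels])
  have keys: "Poly_Mapping.keys (?h c) \<subseteq> carrier R \<times> carrier N"
    if "Poly_Mapping.keys c \<subseteq> carrier R \<times> carrier M" for c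
  proof
    fix t assume "t \<in> Poly_Mapping.keys (?h c)"
    then obtain a x where "(a, x) \<in> Poly_Mapping.keys c" "t = (a, h x)"
      using keys_frag_extend[of "\<lambda>(a, x). frag_of (a, h x)" c] by auto
    then show "t \<in> carrier R \<times> carrier N" using that hD(1) by auto
  qed
  have smult: "?h (frag_extend (\<lambda>(a, x). frag_of (r \<otimes>\<^bsub>R\<^esub> a, x)) c)
      = frag_extend (\<lambda>(a, x). frag_of (r \<otimes>\<^bsub>R\<^esub> a, x)) (?h c)"
    if "Poly_Mapping.keys c \<subseteq> carrier R \<times> carrier M" for r c
    using that by (induction c rule: frag_induction) (auto simp: frag_extend_diff)
  have "frob_map R p N h \<in> carrier (frob R p M) \<rightarrow> carrier (frob R p N)"
  proof
    fix C assume "C \<in> carrier (frob R p M)"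
    then show "frob_map R p N h C \<in> carrier (frob R p N)"
      unfolding carrier_frob[OF M] carrier_frob[OF N] using keys eq by blast
  qed
  then show ?thesis
    unfolding mod_hom_def
    by (auto simp: carrier_frob[OF M] eq frob_add[OF M] frob_add[OF N] frob_smult[OF M]
        frob_smult[OF N] frag_extend_add smult)
qed

lemma frob_code_inj:
  assumes M: "module R M"
  shows "inj_on frob_code (carrier (frob R p M))"
proof (rule inj_onI)
  have ex: "\<exists>l. (\<Sum>t\<leftarrow>l. frag_of t) \<in> frob_rels R p M #>\<^bsub>frob_free R M\<^esub> c"
    if c: "Poly_Mapping.keys c \<subseteq> carrier R \<times> carrier M" for c
  proof -
    obtain l where "(\<Sum>t\<leftarrow>l. frag_of t) - c \<in> frob_rels R p M" using sum_of_tensors[OF M c] by blast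
    moreover have "(\<Sum>t\<leftarrow>l. frag_of t) = c + ((\<Sum>t\<leftarrow>l. frag_of t) - c)" by simp
    ultimately show ?thesis unfolding frob_coset[OF M] by blast
  qed
  fix C D assume C: "C \<in> carrier (frob R p M)" and D: "D \<in> carrier (frob R p M)"
    and eq: "frob_code C = frob_code D"
  obtain c d where c: "C = frob_rels R p M #>\<^bsub>frob_free R M\<^esub> c" "Poly_Mapping.keys c \<subseteq> carrier R \<times> carrier M"
    and d: "D = frob_rels R p M #>\<^bsub>frob_free R M\<^esub> d" "Poly_Mapping.keys d \<subseteq> carrier R \<times> carrier M"
    using C D unfolding carrier_frob[OF M] by blast
  define l where "l = (SOME l. (\<Sum>t\<leftarrow>l. frag_of t) \<in> C)"
  have "(\<Sum>t\<leftarrow>l. frag_of t) \<in> C" unfolding l_def using ex[OF c(2)] c(1) by (metis (no_types, lifting) someI_ex)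
  moreover have "(\<Sum>t\<leftarrow>l. frag_of t) \<in> D"
    using someI_ex[OF ex[OF d(2)]] eq by (simp add: frob_code_def l_def d(1))
  ultimately obtain k k' where "(\<Sum>t\<leftarrow>l. frag_of t) = c + k" "(\<Sum>t\<leftarrow>l. frag_of t) = d + k'"
    "k \<in> frob_rels R p M" "k' \<in> frob_rels R p M"
    unfolding c(1) d(1) frob_coset[OF M] by blast
  then have "c - d = k' - k" "k' - k \<in> frob_rels R p M"
    using frob_rels_diff[OF M] by (auto simp: algebra_simps)
  then show "C = D" using frob_coset_eq[OF M] c(1) d(1) by metis
qed

lemma transport_iso:
  assumes N: "module R N" and f: "inj_on f (carrier N)"
  shows "module R (transport f N)" and "f \<in> mod_iso R N (transport f N)"
proof -
  interpret module R N by fact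
  have [simp]: "inv_into (carrier N) f (f x) = x" if "x \<in> carrier N" for x
    using f that by simp
  show "module R (transport f N)"
  proof (rule moduleI)
    show "abelian_group (transport f N)"
    proof (rule abelian_groupI)
      show "\<exists>y\<in>carrier (transport f N). y \<oplus>\<^bsub>transport f N\<^esub> x = \<zero>\<^bsub>transport f N\<^esub>"
        if x: "x \<in> carrier (transport f N)" for x
      proof -
        obtain z where "z \<in> carrier N" "x = f z" using x by (auto simp: transport_def Let_def)
        then show ?thesis
          by (intro bexI[of _ "f (\<ominus>\<^bsub>N\<^esub> z)"]) (simp_all add: transport_def Let_def M.l_neg)
      qed
    qed (auto simp: transport_def Let_def M.a_ac)
  qed (auto simp: transport_def Let_def smult_l_distr smult_r_distr smult_assoc1 R.is_cring)
  show "f \<in> mod_iso R N (transport f N)"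
    using f by (auto simp: mod_iso_def mod_hom_def bij_betw_def transport_def Let_def)
qed

lemma frob_iter_module:
  assumes "module R M"
  shows "module R (frob_iter R p M i)"
  by (induction i)
     (simp_all add: transport_iso(1) assms inj_on_def frob_module frob_code_inj transport_iso(1)[OF frob_module frob_code_inj])

lemma frob_iter_0_iso:
  assumes "module R M"
  shows "FBase \<in> mod_iso R M (frob_iter R p M 0)"
  using transport_iso(2)[OF assms, of FBase] by (simp add: inj_on_def)

lemma frob_iter_Suc_iso:
  assumes "module R M"
  shows "frob_code \<in> mod_iso R (frob R p (frob_iter R p M i)) (frob_iter R p M (Suc i))"
  using frob_iter_module[OF assms]
  by (simp add: transport_iso(2) frob_module frob_code_inj)

lemma mod_hom_comp: "f \<in> mod_hom R M N \<Longrightarrow> g \<in> mod_hom R N P \<Longrightarrow> g \<circ> f \<in> mod_hom R M P"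
  by (auto simp: mod_hom_def Pi_iff)

lemma mod_iso_inv:
  assumes M: "module R M" and h: "h \<in> mod_iso R M N"
  shows "inv_into (carrier M) h \<in> mod_hom R N M"
proof -
  interpret module R M by fact
  from h have hom: "h \<in> mod_hom R M N" and bij: "bij_betw h (carrier M) (carrier N)"
    by (auto simp: mod_iso_def)
  note hD = mod_homD[OF hom]
  let ?g = "inv_into (carrier M) h"
  have g: "?g y \<in> carrier M" "h (?g y) = y" if "y \<in> carrier N" for y
    using bij that by (auto simp: bij_betw_def inv_into_into f_inv_into_f)
  have gh: "?g (h x) = x" if "x \<in> carrier M" for x using bij that by (simp add: bij_betw_def)
  have "?g (x \<oplus>\<^bsub>N\<^esub> y) = ?g x \<oplus>\<^bsub>M\<^esub> ?g y" if "x \<in> carrier N" "y \<in> carrier N" for x y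
    using gh[of "?g x \<oplus>\<^bsub>M\<^esub> ?g y"] hD(2) g that by simp
  moreover have "?g (r \<odot>\<^bsub>N\<^esub> x) = r \<odot>\<^bsub>M\<^esub> ?g x" if "r \<in> carrier R" "x \<in> carrier N" for r x
    using gh[of "r \<odot>\<^bsub>M\<^esub> ?g x"] hD(3) g that by simp
  ultimately show ?thesis using g by (auto simp: mod_hom_def)
qed

lemma frob_iter_map_hom:
  assumes M: "module R M" and \<beta>: "\<beta> \<in> mod_hom R M (frob R p M)"
  shows "frob_iter_map R p M \<beta> i \<in> mod_hom R (frob_iter R p M i) (frob R p (frob_iter R p M i))"
proof (induction i)
  case 0
  have "frob_map R p (frob_iter R p M 0) FBase \<circ> (\<beta> \<circ> inv_into (carrier M) FBase)
      \<in> mod_hom R (frob_iter R p M 0) (frob R p (frob_iter R p M 0))"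
    using frob_iter_0_iso[OF M, of p]
    by (intro mod_hom_comp[OF mod_hom_comp[OF mod_iso_inv[OF M] \<beta>] frob_map_hom[OF M frob_iter_module[OF M]]])
       (auto simp: mod_iso_def)
  then show ?case by (simp add: comp_def)
next
  case (Suc i)
  let ?N = "frob_iter R p M"
  have N: "module R (?N j)" for j by (rule frob_iter_module[OF M])
  have c: "frob_code \<in> mod_hom R (frob R p (?N i)) (?N (Suc i))"
    using frob_iter_Suc_iso[OF M] by (auto simp: mod_iso_def simp del: frob_iter.simps)
  from mod_hom_comp[OF mod_iso_inv[OF frob_module[OF N] frob_iter_Suc_iso[OF M]]
      frob_map_hom[OF N N mod_hom_comp[OF Suc c]]]
  show ?case by (simp add: comp_def)
qed

context
  fixes R :: "('a, 'r) ring_scheme" and N :: "nat \<Rightarrow> ('a, 'b) module" and f :: "nat \<Rightarrow> 'b \<Rightarrow> 'b"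
  assumes N: "\<And>i. module R (N i)" and f: "\<And>i. f i \<in> mod_hom R (N i) (N (Suc i))"
begin

lemma system_map_hom: "system_map f i n \<in> mod_hom R (N i) (N (i + n))"
proof (induction n)
  case 0
  show ?case by (simp add: mod_hom_def)
next
  case (Suc n)
  from mod_hom_comp[OF this f] show ?case by (simp add: comp_def)
qed

lemma system_map_trans:
  assumes "i \<le> k" "k \<le> l"
  shows "system_map f i (l - i) x = system_map f k (l - k) (system_map f i (k - i) x)"
  using assms(2)
proof (induction l rule: dec_induct)
  case base
  show ?case by simp
next
  case (step l)
  then show ?case using assms(1) by (simp add: Suc_diff_le)
qed

lemma equiv_limit_rel: "equiv (SIGMA i:UNIV. carrier (N i)) (limit_rel N f)"
proof (rule equivI)
  show "limit_rel N f \<subseteq> (SIGMA i:UNIV. carrier (N i)) \<times> (SIGMA i:UNIV. carrier (N i))"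
    by (auto simp: limit_rel_def)
  show "refl_on (SIGMA i:UNIV. carrier (N i)) (limit_rel N f)"
    by (auto simp: limit_rel_def refl_on_def)
  show "sym (limit_rel N f)" by (auto simp: limit_rel_def sym_def)
  show "trans (limit_rel N f)"
  proof (rule transI, clarify)
    fix i x j y l z assume "((i, x), (j, y)) \<in> limit_rel N f" "((j, y), (l, z)) \<in> limit_rel N f"
    then obtain k k' where *: "i \<le> k" "j \<le> k" "system_map f i (k - i) x = system_map f j (k - j) y"
      "j \<le> k'" "l \<le> k'" "system_map f j (k' - j) y = system_map f l (k' - l) z"
      "x \<in> carrier (N i)" "z \<in> carrier (N l)" by (auto simp: limit_rel_def)
    let ?m = "max k k'"
    have "system_map f i (?m - i) x = system_map f l (?m - l) z"
      using system_map_trans[of i k ?m x] system_map_trans[of j k ?m y] system_map_trans[of j k' ?m y]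
        system_map_trans[of l k' ?m z] * by simp
    then show "((i, x), (l, z)) \<in> limit_rel N f" using * unfolding limit_rel_def by (auto intro!: exI[of _ ?m])
  qed
qed

lemma limit_class_add:
  assumes x: "x \<in> carrier (N i)" and y: "y \<in> carrier (N i)"
  shows "limit_rel N f `` {(i, x)} \<oplus>\<^bsub>direct_limit N f\<^esub> limit_rel N f `` {(i, y)}
       = limit_rel N f `` {(i, x \<oplus>\<^bsub>N i\<^esub> y)}"
proof -
  let ?r = "limit_rel N f"
  let ?S = "{(k, u \<oplus>\<^bsub>N k\<^esub> v) | k u v. (k, u) \<in> ?r `` {(i, x)} \<and> (k, v) \<in> ?r `` {(i, y)}}"
  have 1: "(i, x \<oplus>\<^bsub>N i\<^esub> y) \<in> ?S"
    using x y equiv_limit_rel by (fastforce simp: equiv_def refl_on_def)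
  have 2: "((i, x \<oplus>\<^bsub>N i\<^esub> y), s) \<in> ?r" if "s \<in> ?S" for s
  proof -
    from that obtain k u v where s: "s = (k, u \<oplus>\<^bsub>N k\<^esub> v)"
      and uv: "((i, x), (k, u)) \<in> ?r" "((i, y), (k, v)) \<in> ?r" by blast
    then obtain m n where *: "i \<le> m" "k \<le> m" "system_map f i (m - i) x = system_map f k (m - k) u"
      "i \<le> n" "k \<le> n" "system_map f i (n - i) y = system_map f k (n - k) v"
      and c: "u \<in> carrier (N k)" "v \<in> carrier (N k)" by (auto simp: limit_rel_def)
    let ?l = "max m n"
    have "system_map f i (?l - i) x = system_map f k (?l - k) u"
      "system_map f i (?l - i) y = system_map f k (?l - k) v"
      using system_map_trans[of i m ?l x] system_map_trans[of k m ?l u]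
        system_map_trans[of i n ?l y] system_map_trans[of k n ?l v] * by simp_all
    then have "system_map f i (?l - i) (x \<oplus>\<^bsub>N i\<^esub> y) = system_map f k (?l - k) (u \<oplus>\<^bsub>N k\<^esub> v)"
      using mod_homD(2)[OF system_map_hom] x y c * by simp
    moreover have "x \<oplus>\<^bsub>N i\<^esub> y \<in> carrier (N i)" "u \<oplus>\<^bsub>N k\<^esub> v \<in> carrier (N k)"
      using N x y c by (auto intro: abelian_groupE(1) simp: module_def)
    ultimately show ?thesis using * s by (auto simp: limit_rel_def intro!: exI[of _ ?l])
  qed
  have "?r `` ?S = ?r `` {(i, x \<oplus>\<^bsub>N i\<^esub> y)}"
  proof (intro equalityI subsetI)
    fix t assume "t \<in> ?r `` ?S"
    then obtain s where "s \<in> ?S" "(s, t) \<in> ?r" by blast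
    then show "t \<in> ?r `` {(i, x \<oplus>\<^bsub>N i\<^esub> y)}"
      using 2 equiv_limit_rel unfolding equiv_def by (blast dest: transD)
  next
    fix t assume "t \<in> ?r `` {(i, x \<oplus>\<^bsub>N i\<^esub> y)}"
    then show "t \<in> ?r `` ?S" using 1 by blast
  qed
  then show ?thesis by (simp add: direct_limit_def)
qed

end

end

theory Submission
  imports Defs "HOL-Computational_Algebra.Primes"
begin

text \<open>The image of the root in \<open>\<M>\<close> is finitely generated and torsion, so it is killed by some
  \<open>c \<noteq> 0\<close>, and the image \<open>N\<^sub>i\<close> of \<open>F\<^sup>i(M)\<close> in \<open>\<M>\<close> is killed by \<open>c\<^sup>q\<close> with \<open>q = p\<^sup>i\<close>. On the other hand, a functional
  \<open>g : \<M> \<rightarrow> E\<close> sending \<open>x \<noteq> 0\<close> to the socle generator \<open>e\<^sub>0\<close> of \<open>E\<close>, followed by a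
  \<open>q\<close>-linear map \<open>\<Phi> : E \<rightarrow> E\<close>, induces through \<open>\<M> \<cong> F\<^sup>j(\<M>)\<close> a functional \<open>\<M> \<rightarrow> E\<close> whose
  value at \<open>1 \<otimes> x\<close> is \<open>\<Phi>(e\<^sub>0)\<close>. Because \<open>R\<close> is regular, \<open>\<Phi>\<close> can be chosen such that
  \<open>\<Phi>(e\<^sub>0)\<close> is killed by \<open>s\<^sup>q\<close> for all regular parameters \<open>s\<close> but not by their monomial
  \<open>\<Prod>s\<^sup>q\<^sup>-\<^sup>1\<close>, so that its annihilator is as deep as desired. Multiplied by an
  element that kills \<open>N\<^sub>i\<close>, such a functional \<open>\<psi>\<close> can be added to a given \<open>\<phi>\<close> without
  changing it on \<open>N\<^sub>i\<close>. If \<open>r\<close> kills \<open>\<phi>\<close> and \<open>r'\<close> kills \<open>\<phi> + \<psi>\<close> then \<open>r r'\<close> kills \<open>\<psi>\<close>, so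
  \<open>\<phi>\<close> or \<open>\<phi> + \<psi>\<close> has a deep annihilator. The limit of these choices is a functional with
  annihilator \<open>0\<close>.\<close>

section \<open>Noetherian rings\<close>

text \<open>The dual of \<open>\<M>\<close> is the inverse limit of the duals of the
  \<open>N\<^sub>i\<close>, and each of those is killed by a nonzero element, so no finite stage can
  carry the functional. Annihilators have to be pushed down in countably many rounds. This asks for
  a level of the nonzero elements of \<open>R\<close> that is always finite, so that countably many
  rounds suffice, and subadditive on products, so that a product of possible killers stays within a
  known bound. Each round has its witnesses inside one \<open>N\<^sub>j\<close>, and later
  corrections vanish there. The Frobenius structure supplies the depth. If \<open>x\<close> has
  annihilator \<open>\<mm>\<close>, every linear functional has its value at \<open>x\<close> in the
  socle; only the isomorphism with \<open>F\<^sup>j(\<M>)\<close>, which turns a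
  \<open>q\<close>-linear map into a linear functional, leads to deeper values. Regularity is used
  in one form: any subset of a minimal generating set of \<open>\<mm>\<close> generates a prime that
  contains no further generator. Powers of the generators are then a regular sequence in every
  order, which yields both the monomial outside the ideal of powers and the Koszul relations behind
  \<open>\<Phi>\<close>.\<close>

context cring
begin

lemma cring_idealI:
  assumes "I \<subseteq> carrier R" "\<zero> \<in> I" "\<And>a b. a \<in> I \<Longrightarrow> b \<in> I \<Longrightarrow> a \<oplus> b \<in> I"
    and mult: "\<And>a r. a \<in> I \<Longrightarrow> r \<in> carrier R \<Longrightarrow> r \<otimes> a \<in> I"
  shows "ideal I R"
proof (rule idealI)
  show "subgroup I (add_monoid R)"
  proof (rule add.subgroupI)
    show "\<ominus> a \<in> I" if "a \<in> I" for a
      using mult[OF that, of "\<ominus> \<one>"] that assms(1) l_minus[of \<one> a] by auto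
  qed (use assms in auto)
  show "a \<otimes> r \<in> I" if "a \<in> I" "r \<in> carrier R" for a r
    using mult[OF that] that assms(1) m_comm by (metis subsetD)
qed (use assms in \<open>auto simp: ring_axioms\<close>)

lemma ideal_closed:
  assumes "ideal I R"
  shows "\<zero> \<in> I" "a \<in> I \<Longrightarrow> a \<in> carrier R" "a \<in> I \<Longrightarrow> b \<in> I \<Longrightarrow> a \<oplus> b \<in> I"
    "a \<in> I \<Longrightarrow> b \<in> I \<Longrightarrow> a \<ominus> b \<in> I" "a \<in> I \<Longrightarrow> r \<in> carrier R \<Longrightarrow> r \<otimes> a \<in> I"
    "a \<in> I \<Longrightarrow> r \<in> carrier R \<Longrightarrow> a \<otimes> r \<in> I"
proof -
  interpret I: ideal I R by fact
  show "\<zero> \<in> I" "a \<in> I \<Longrightarrow> a \<in> carrier R" "a \<in> I \<Longrightarrow> b \<in> I \<Longrightarrow> a \<oplus> b \<in> I"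
    "a \<in> I \<Longrightarrow> b \<in> I \<Longrightarrow> a \<ominus> b \<in> I" "a \<in> I \<Longrightarrow> r \<in> carrier R \<Longrightarrow> r \<otimes> a \<in> I"
    "a \<in> I \<Longrightarrow> r \<in> carrier R \<Longrightarrow> a \<otimes> r \<in> I"
    by (auto simp: I.I_l_closed I.I_r_closed I.Icarr a_minus_def)
qed

lemma ideal_diff_imp:
  assumes "ideal I R" "a \<in> carrier R" "b \<in> I" "a \<ominus> b \<in> I"
  shows "a \<in> I"
proof -
  have "a = (a \<ominus> b) \<oplus> b" using assms ideal_closed(2)[OF assms(1,3)] by algebra
  then show ?thesis using ideal_closed(3)[OF assms(1,4,3)] by simp
qed

lemma primeD:
  assumes "primeideal P R"
  shows "ideal P R" "\<one> \<notin> P" "a \<in> carrier R \<Longrightarrow> b \<in> carrier R \<Longrightarrow> a \<otimes> b \<in> P \<Longrightarrow> a \<notin> P \<Longrightarrow> b \<in> P"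
proof -
  interpret P: primeideal P R by fact
  show "ideal P R" by (rule P.is_ideal)
  show "\<one> \<notin> P" using P.I_notcarr P.one_imp_carrier by blast
  show "a \<in> carrier R \<Longrightarrow> b \<in> carrier R \<Longrightarrow> a \<otimes> b \<in> P \<Longrightarrow> a \<notin> P \<Longrightarrow> b \<in> P"
    using P.I_prime by blast
qed

lemma primeideal_cringI:
  assumes "ideal P R" "\<one> \<notin> P"
    and "\<And>a b. a \<in> carrier R \<Longrightarrow> b \<in> carrier R \<Longrightarrow> a \<otimes> b \<in> P \<Longrightarrow> a \<in> P \<or> b \<in> P"
  shows "primeideal P R"
  using assms by (intro primeidealI) (auto simp: is_cring)

definition adjoin :: "'a set \<Rightarrow> 'a \<Rightarrow> 'a set" where
  "adjoin I b = {i \<oplus> r \<otimes> b | i r. i \<in> I \<and> r \<in> carrier R}"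

lemma adjoinI: "i \<in> I \<Longrightarrow> r \<in> carrier R \<Longrightarrow> i \<oplus> r \<otimes> b \<in> adjoin I b"
  by (auto simp: adjoin_def)

lemma adjoin_ideal:
  assumes I: "ideal I R" and b: "b \<in> carrier R"
  shows "ideal (adjoin I b) R"
proof (rule cring_idealI)
  note c = ideal_closed[OF I]
  show "adjoin I b \<subseteq> carrier R" using c(2) b by (auto simp: adjoin_def)
  show "\<zero> \<in> adjoin I b" using adjoinI[OF c(1), of \<zero> b] b by simp
  fix u assume "u \<in> adjoin I b"
  then obtain i r where u: "u = i \<oplus> r \<otimes> b" "i \<in> I" "r \<in> carrier R" by (auto simp: adjoin_def)
  note ic = c(2)[OF u(2)]
  { fix v assume "v \<in> adjoin I b"
    then obtain j s where v: "v = j \<oplus> s \<otimes> b" "j \<in> I" "s \<in> carrier R" by (auto simp: adjoin_def)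
    have "u \<oplus> v = (i \<oplus> j) \<oplus> (r \<oplus> s) \<otimes> b"
      unfolding u(1) v(1) using ic c(2)[OF v(2)] u(3) v(3) b by algebra
    then show "u \<oplus> v \<in> adjoin I b" using adjoinI c(3) u v by simp }
  fix s assume s: "s \<in> carrier R"
  have "s \<otimes> u = (s \<otimes> i) \<oplus> (s \<otimes> r) \<otimes> b"
    unfolding u(1) using ic u(3) s b by algebra
  then show "s \<otimes> u \<in> adjoin I b" using adjoinI c(5) u s by simp
qed

lemma adjoin_supset:
  assumes I: "ideal I R" and b: "b \<in> carrier R"
  shows "I \<subseteq> adjoin I b" "b \<in> adjoin I b"
proof -
  note c = ideal_closed[OF I]
  show "I \<subseteq> adjoin I b" using adjoinI[of _ I \<zero> b] c(2) b by auto
  show "b \<in> adjoin I b" using adjoinI[OF c(1), of \<one> b] b by simp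
qed

lemma adjoin_least:
  assumes "ideal J R" "I \<subseteq> J" "b \<in> J"
  shows "adjoin I b \<subseteq> J"
  using assms ideal_closed[OF assms(1)] by (auto simp: adjoin_def)

text \<open>The contraction of the extension of \<open>I\<close> to the localization at \<open>P\<close>.\<close>

definition saturate :: "'a set \<Rightarrow> 'a set \<Rightarrow> 'a set" where
  "saturate P I = {a \<in> carrier R. \<exists>s\<in>carrier R - P. s \<otimes> a \<in> I}"

definition saturated :: "'a set \<Rightarrow> 'a set \<Rightarrow> bool" where
  "saturated P I \<longleftrightarrow> (\<forall>s\<in>carrier R - P. \<forall>a\<in>carrier R. s \<otimes> a \<in> I \<longrightarrow> a \<in> I)"

lemma saturatedD: "saturated P I \<Longrightarrow> s \<in> carrier R \<Longrightarrow> s \<notin> P \<Longrightarrow> a \<in> carrier R \<Longrightarrow> s \<otimes> a \<in> I \<Longrightarrow> a \<in> I"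
  by (auto simp: saturated_def)

lemma prime_mult_notin:
  assumes "primeideal P R" "s \<in> carrier R" "s \<notin> P" "t \<in> carrier R" "t \<notin> P"
  shows "s \<otimes> t \<notin> P"
  using primeD(3)[OF assms(1)] assms by blast

lemma saturate_ideal:
  assumes P: "primeideal P R" and I: "ideal I R"
  shows "ideal (saturate P I) R"
proof (rule cring_idealI)
  note c = ideal_closed[OF I]
  show "saturate P I \<subseteq> carrier R" by (auto simp: saturate_def)
  show "\<zero> \<in> saturate P I" unfolding saturate_def using c(1) primeD(2)[OF P] by auto
  fix a assume "a \<in> saturate P I"
  then obtain s where s: "s \<in> carrier R" "s \<notin> P" "s \<otimes> a \<in> I" and a: "a \<in> carrier R"
    by (auto simp: saturate_def)
  { fix b assume "b \<in> saturate P I"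
    then obtain t where t: "t \<in> carrier R" "t \<notin> P" "t \<otimes> b \<in> I" and b: "b \<in> carrier R"
      by (auto simp: saturate_def)
    have "(s \<otimes> t) \<otimes> (a \<oplus> b) = t \<otimes> (s \<otimes> a) \<oplus> s \<otimes> (t \<otimes> b)"
      using s(1) t(1) a b by algebra
    then have "(s \<otimes> t) \<otimes> (a \<oplus> b) \<in> I" using c(3,5) s t by simp
    then show "a \<oplus> b \<in> saturate P I"
      unfolding saturate_def using prime_mult_notin[OF P s(1,2) t(1,2)] a b s t by auto }
  fix r assume r: "r \<in> carrier R"
  have "s \<otimes> (r \<otimes> a) = r \<otimes> (s \<otimes> a)" using s(1) a r by algebra
  then show "r \<otimes> a \<in> saturate P I"
    unfolding saturate_def using ideal_closed(5)[OF I s(3) r] a r s by (auto intro!: bexI[of _ s])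
qed

lemma saturate_saturated:
  assumes P: "primeideal P R"
  shows "saturated P (saturate P I)"
  unfolding saturated_def
proof (intro ballI impI)
  fix s a assume *: "s \<in> carrier R - P" "a \<in> carrier R" "s \<otimes> a \<in> saturate P I"
  then obtain t where t: "t \<in> carrier R" "t \<notin> P" "t \<otimes> (s \<otimes> a) \<in> I" by (auto simp: saturate_def)
  then have "(t \<otimes> s) \<otimes> a \<in> I" using * by (simp add: m_assoc)
  then show "a \<in> saturate P I" unfolding saturate_def using prime_mult_notin[OF P t(1,2)] * t by auto
qed

lemma saturate_supset:
  assumes "primeideal P R" "ideal I R"
  shows "I \<subseteq> saturate P I"
  unfolding saturate_def using primeD(2)[OF assms(1)] ideal_closed[OF assms(2)] by (auto intro!: bexI[of _ \<one>])

lemma saturate_mono: "I \<subseteq> J \<Longrightarrow> saturate P I \<subseteq> saturate P J"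
  by (auto simp: saturate_def)

end

lemma (in module) submodule_colon_ideal:
  assumes L: "submodule L R M" and b: "b \<in> carrier M"
  shows "ideal {r \<in> carrier R. r \<odot>\<^bsub>M\<^esub> b \<in> L} R"
proof -
  note c = submoduleE[OF L]
  show ?thesis
  proof (rule R.cring_idealI)
    show "\<zero>\<^bsub>R\<^esub> \<in> {r \<in> carrier R. r \<odot>\<^bsub>M\<^esub> b \<in> L}"
      using subgroup.one_closed[OF submodule.axioms(1)[OF L]] b by simp
  qed (use b c in \<open>auto simp: smult_l_distr smult_assoc1\<close>)
qed

section \<open>Noetherian induction, associated primes and Nakayama's lemma\<close>

locale noetherian_cring = noetherian_ring R + cring R for R (structure)
begin

lemma maximal_ideal_in:
  assumes ne: "S \<noteq> {}" and S: "\<And>I. I \<in> S \<Longrightarrow> ideal I R"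
  obtains L where "L \<in> S" "\<And>J. J \<in> S \<Longrightarrow> L \<subseteq> J \<Longrightarrow> J = L"
proof -
  have "\<exists>L\<in>S. \<forall>J\<in>S. L \<subseteq> J \<longrightarrow> J = L"
  proof (rule subset_Zorn_nonempty[OF ne])
    fix C assume "C \<noteq> {}" "subset.chain S C"
    then have "\<Union>C \<in> C" using ideal_chain_is_trivial[of C] S by (auto simp: subset_chain_def)
    then show "\<Union>C \<in> S" using \<open>subset.chain S C\<close> by (auto simp: subset_chain_def)
  qed
  then show ?thesis using that by blast
qed

lemma ascending_stabilises:
  assumes I: "\<And>n. ideal (I n) R" and mono: "\<And>n::nat. I n \<subseteq> I (Suc n)"
  obtains n where "\<And>m. n \<le> m \<Longrightarrow> I m = I n"
proof -
  obtain L where "L \<in> range I" "\<And>J. J \<in> range I \<Longrightarrow> L \<subseteq> J \<Longrightarrow> J = L"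
    using maximal_ideal_in[of "range I"] I by blast
  then show ?thesis using that lift_Suc_mono_le[of I] mono by (metis rangeE rangeI)
qed

text \<open>Among the ideals \<open>{r. r b \<in> L}\<close> with \<open>b\<close> outside
  \<open>L\<close> a maximal one is prime: \<open>v b\<close> outside \<open>L\<close> has at least
  as large an ideal, hence the same one. The chain condition is that of \<open>R\<close>, so
  \<open>M\<close> can be \<open>E\<close> as well as \<open>R\<close>.\<close>

lemma associated_prime_exists:
  assumes M: "module R M" and L: "submodule L R M" and ne: "b0 \<in> carrier M" "b0 \<notin> L"
  obtains b where "b \<in> carrier M" "b \<notin> L" "primeideal {r \<in> carrier R. r \<odot>\<^bsub>M\<^esub> b \<in> L} R"
proof -
  interpret M: module R M by fact
  let ?c = "\<lambda>b. {r \<in> carrier R. r \<odot>\<^bsub>M\<^esub> b \<in> L}"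
  obtain K where K: "K \<in> ?c ` (carrier M - L)"
    and max: "\<And>J. J \<in> ?c ` (carrier M - L) \<Longrightarrow> K \<subseteq> J \<Longrightarrow> J = K"
    using maximal_ideal_in[of "?c ` (carrier M - L)"] ne M.submodule_colon_ideal[OF L] by blast
  then obtain b where b: "b \<in> carrier M" "b \<notin> L" "K = ?c b" by blast
  have "primeideal (?c b) R"
  proof (rule primeideal_cringI)
    show "ideal (?c b) R" using M.submodule_colon_ideal[OF L b(1)] .
    show "\<one> \<notin> ?c b" using b by simp
    fix u v assume u: "u \<in> carrier R" and v: "v \<in> carrier R" and uv: "u \<otimes> v \<in> ?c b"
    show "u \<in> ?c b \<or> v \<in> ?c b"
    proof (rule ccontr)
      assume *: "\<not> ?thesis"
      have "?c b \<subseteq> ?c (v \<odot>\<^bsub>M\<^esub> b)"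
      proof
        fix r assume r: "r \<in> ?c b"
        have "r \<odot>\<^bsub>M\<^esub> (v \<odot>\<^bsub>M\<^esub> b) = v \<odot>\<^bsub>M\<^esub> (r \<odot>\<^bsub>M\<^esub> b)"
          using r v b m_comm by (simp flip: M.smult_assoc1)
        then show "r \<in> ?c (v \<odot>\<^bsub>M\<^esub> b)" using r v M.submoduleE(4)[OF L] by simp
      qed
      then have "?c (v \<odot>\<^bsub>M\<^esub> b) = ?c b" using max[of "?c (v \<odot>\<^bsub>M\<^esub> b)"] * b v by blast
      moreover have "u \<in> ?c (v \<odot>\<^bsub>M\<^esub> b)" using uv u v b by (simp add: M.smult_assoc1)
      ultimately show False using * by blast
    qed
  qed
  then show ?thesis using that b by blast
qed

text \<open>Nakayama's lemma over the localization at \<open>P\<close>, with denominators written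
  out; \<open>hyp\<close> says that \<open>I\<close> lies locally in \<open>N + I x\<close>. Instead
  of a determinant over generators of \<open>I\<close>, one takes \<open>L\<close> maximal among the
  saturated ideals over \<open>N\<close> that do not contain \<open>I\<close>. Adjoining any
  \<open>a \<in> I\<close> outside \<open>L\<close> then captures all of \<open>I\<close>, so a
  single generator remains.\<close>

lemma nakayama_at_prime:
  assumes P: "primeideal P R" and N: "ideal N R" "saturated P N" and I: "ideal I R" and x: "x \<in> P"
    and hyp: "\<And>a. a \<in> I \<Longrightarrow> \<exists>s\<in>carrier R - P. \<exists>c\<in>N. \<exists>r\<in>I. s \<otimes> a = c \<oplus> r \<otimes> x"
  shows "I \<subseteq> N"
proof (rule ccontr)
  assume not: "\<not> I \<subseteq> N"
  let ?S = "{L. ideal L R \<and> saturated P L \<and> N \<subseteq> L \<and> \<not> I \<subseteq> L}"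
  obtain L where L: "L \<in> ?S" and max: "\<And>J. J \<in> ?S \<Longrightarrow> L \<subseteq> J \<Longrightarrow> J = L"
    using maximal_ideal_in[of ?S] N not by blast
  note Pc = ideal_closed[OF primeD(1)[OF P]]
  have Li: "ideal L R" using L by blast
  note Lc = ideal_closed[OF Li]
  obtain a where a: "a \<in> I" "a \<notin> L" using L by blast
  have ac: "a \<in> carrier R" using ideal_closed(2)[OF I a(1)] .
  have xc: "x \<in> carrier R" using Pc(2)[OF x] .
  let ?L = "saturate P (adjoin L a)"
  have adj: "ideal (adjoin L a) R" using adjoin_ideal Li ac by blast
  have sup: "adjoin L a \<subseteq> ?L" using saturate_supset[OF P adj] .
  have "L \<subseteq> ?L" "a \<in> ?L" using adjoin_supset[OF Li ac] sup by auto
  then have "I \<subseteq> ?L"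
    using max[of ?L] saturate_ideal[OF P adj] saturate_saturated[OF P] L a(2) by blast
  obtain s c r where s: "s \<in> carrier R" "s \<notin> P" and c: "c \<in> N" and r: "r \<in> I" and eq: "s \<otimes> a = c \<oplus> r \<otimes> x"
    using hyp[OF a(1)] by blast
  then obtain s' l t where s': "s' \<in> carrier R" "s' \<notin> P" and l: "l \<in> L" and t: "t \<in> carrier R"
    and eq': "s' \<otimes> r = l \<oplus> t \<otimes> a"
    using \<open>I \<subseteq> ?L\<close> by (fastforce simp: saturate_def adjoin_def)
  have cc: "c \<in> carrier R" "l \<in> carrier R" "r \<in> carrier R"
    using ideal_closed(2) N(1) c Li l I r by blast+
  \<comment> \<open>The 1-by-1 determinant: eliminating \<open>r\<close> between \<open>eq\<close>
    and \<open>eq'\<close> gives a multiplier of \<open>a\<close> that is outside \<open>P\<close>,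
    because \<open>x \<in> P\<close>.\<close>
  have "(s' \<otimes> s \<ominus> t \<otimes> x) \<otimes> a = s' \<otimes> (s \<otimes> a) \<ominus> t \<otimes> x \<otimes> a"
    using s s' t xc ac by algebra
  also have "\<dots> = s' \<otimes> c \<oplus> (s' \<otimes> r) \<otimes> x \<ominus> t \<otimes> x \<otimes> a"
    unfolding eq using s' cc xc t ac by algebra
  also have "\<dots> = s' \<otimes> c \<oplus> x \<otimes> l" unfolding eq' using s' cc xc t ac by algebra
  finally have "(s' \<otimes> s \<ominus> t \<otimes> x) \<otimes> a \<in> L" using Lc L c l s' xc by auto
  moreover have "s' \<otimes> s \<ominus> t \<otimes> x \<notin> P"
    using ideal_diff_imp[OF primeD(1)[OF P], of "s' \<otimes> s" "t \<otimes> x"] prime_mult_notin[OF P] s s' x t Pc(5)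
    by auto
  ultimately show False
    using saturatedD[of P L "s' \<otimes> s \<ominus> t \<otimes> x" a] L a ac s s' t xc by auto
qed

end

section \<open>Krull's principal ideal theorem in terms of contracted ideals\<close>

context noetherian_cring
begin

lemma ideal_scalar_submodule:
  assumes I: "ideal I R"
  shows "submodule I R (scalar_module R (carrier R))"
proof -
  let ?M = "scalar_module R (carrier R)"
  interpret M: module R ?M using scalar_module_module[OF is_cring oneideal] .
  note c = ideal_closed[OF I]
  show ?thesis
  proof (rule M.submoduleI)
    show "\<ominus>\<^bsub>?M\<^esub> a \<in> I" if "a \<in> I" for a
    proof -
      have "a \<in> carrier ?M" using c(2)[OF that] by (simp add: scalar_module_def)
      then have "\<ominus>\<^bsub>?M\<^esub> a = (\<ominus> \<one>) \<odot>\<^bsub>?M\<^esub> a" using M.smult_l_minus[of \<one> a] by simp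
      also have "\<dots> = (\<ominus> \<one>) \<otimes> a" by (simp add: scalar_module_def)
      finally show ?thesis using c(5)[OF that, of "\<ominus> \<one>"] by simp
    qed
  qed (use c in \<open>auto simp: scalar_module_def\<close>)
qed

text \<open>The quotients \<open>R\<^sub>P/(x)\<close> need only be compared with ideals containing \<open>x\<close>, where by minimality
  of \<open>P\<close> every associated prime is \<open>P\<close>; extending by \<open>b\<close> with \<open>P b \<subseteq> L\<close> adds a simple factor.\<close>

lemma descending_stabilises_over_minimal_prime:
  assumes P: "primeideal P R" and B: "\<And>n::nat. ideal (B n) R" "\<And>n. saturated P (B n)"
    and dec: "\<And>n. B (Suc n) \<subseteq> B n" and I: "ideal I R" "I \<subseteq> P" "\<And>n. I \<subseteq> B n"
    and minimal: "\<And>P'. primeideal P' R \<Longrightarrow> I \<subseteq> P' \<Longrightarrow> P' \<subseteq> P \<Longrightarrow> P' = P"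
  obtains n where "\<And>m. n \<le> m \<Longrightarrow> B m = B n"
proof -
  have decm: "B m \<subseteq> B n" if "n \<le> m" for m n
    using lift_Suc_antimono_le[of B, OF dec that] .
  \<comment> \<open>Noetherian induction over the ideals whose intersection with the chain is
    stationary. The ideal \<open>saturate P I\<close> is one of them, as it lies in every
    \<open>B m\<close>; a maximal one turns out to be all of \<open>R\<close>.\<close>
  define S where "S = {L. ideal L R \<and> saturated P L \<and> I \<subseteq> L \<and> (\<exists>n. \<forall>m\<ge>n. B n \<inter> L \<subseteq> B m)}"
  have "saturate P I \<subseteq> B m" for m
    using B(2)[of m] I(3)[of m] unfolding saturate_def saturated_def by blast
  then have "\<forall>m\<ge>0. B 0 \<inter> saturate P I \<subseteq> B m" by auto
  then have "saturate P I \<in> S"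
    unfolding S_def
    using saturate_ideal[OF P I(1)] saturate_saturated[OF P, of I] saturate_supset[OF P I(1)]
    by (intro CollectI conjI exI[of _ 0]) auto
  moreover have "ideal L R" if "L \<in> S" for L using that by (simp add: S_def)
  ultimately obtain L where LS: "L \<in> S" and max: "\<And>J. J \<in> S \<Longrightarrow> L \<subseteq> J \<Longrightarrow> J = L"
    using maximal_ideal_in[of S] by (metis empty_iff)
  from LS obtain n0 where L: "ideal L R" "saturated P L" "I \<subseteq> L" and n0: "\<And>m. n0 \<le> m \<Longrightarrow> B n0 \<inter> L \<subseteq> B m"
    unfolding S_def by blast
  note Lc = ideal_closed[OF L(1)]
  have "L = carrier R"
  proof (rule ccontr)
    assume "L \<noteq> carrier R"
    then obtain b0 where b0: "b0 \<in> carrier R" "b0 \<notin> L" using Lc(2) by blast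
    let ?M = "scalar_module R (carrier R)"
    have M: "module R ?M" using scalar_module_module[OF is_cring oneideal] .
    interpret M: module R ?M by (rule M)
    have "submodule L R ?M" using ideal_scalar_submodule[OF L(1)] .
    then obtain b where b: "b \<in> carrier R" "b \<notin> L" and pr: "primeideal {r \<in> carrier R. r \<otimes> b \<in> L} R"
      using associated_prime_exists[OF M, of L b0] b0 by (auto simp: scalar_module_def)
    have "{r \<in> carrier R. r \<otimes> b \<in> L} = P"
    proof (rule minimal[OF pr])
      show "I \<subseteq> {r \<in> carrier R. r \<otimes> b \<in> L}" using L(3) Lc b ideal_closed[OF I(1)] by auto
      show "{r \<in> carrier R. r \<otimes> b \<in> L} \<subseteq> P" using saturatedD[OF L(2)] b by blast
    qed
    then have Pb: "r \<otimes> b \<in> L" if "r \<in> P" for r using that by blast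
    let ?L = "saturate P (adjoin L b)"
    have adj: "ideal (adjoin L b) R" using adjoin_ideal L(1) b by blast
    have sub: "L \<subseteq> ?L" "b \<in> ?L"
      using adjoin_supset[OF L(1) b(1)] saturate_supset[OF P adj] by auto
    have "\<exists>n. \<forall>m\<ge>n. B n \<inter> ?L \<subseteq> B m"
    \<comment> \<open>After localization \<open>?L / L\<close> is simple, because
      \<open>P b \<subseteq> L\<close>. The trace of the chain on it either becomes zero or is
      always everything; in the latter case each \<open>B m\<close> contains some \<open>v\<close>
      that generates \<open>?L\<close> modulo \<open>L\<close> locally.\<close>
    proof (cases "\<exists>n. B n \<inter> ?L \<subseteq> L")
      case True
      then obtain n where n: "B n \<inter> ?L \<subseteq> L" by blast
      have "B (max n n0) \<inter> ?L \<subseteq> B m" if "m \<ge> max n n0" for m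
        using that n n0[of m] decm[of n "max n n0"] decm[of n0 "max n n0"] by auto
      then show ?thesis by blast
    next
      case False
      have "B n0 \<inter> ?L \<subseteq> B m" if m: "m \<ge> n0" for m
      proof
        fix z assume z: "z \<in> B n0 \<inter> ?L"
        obtain v where v: "v \<in> B m" "v \<in> ?L" "v \<notin> L" using False by blast
        have zc: "z \<in> carrier R" and vc: "v \<in> carrier R" using z v ideal_closed(2)[OF B(1)] by blast+
        obtain s1 l1 r1 where 1: "s1 \<in> carrier R" "s1 \<notin> P" "l1 \<in> L" "r1 \<in> carrier R" "s1 \<otimes> v = l1 \<oplus> r1 \<otimes> b"
          using v(2) by (fastforce simp: saturate_def adjoin_def)
        obtain s2 l2 r2 where 2: "s2 \<in> carrier R" "s2 \<notin> P" "l2 \<in> L" "r2 \<in> carrier R" "s2 \<otimes> z = l2 \<oplus> r2 \<otimes> b"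
          using z by (fastforce simp: saturate_def adjoin_def)
        have r1: "r1 \<notin> P"
        proof
          assume "r1 \<in> P"
          then have "s1 \<otimes> v \<in> L" using 1 Pb Lc(3) by simp
          then show False using saturatedD[OF L(2)] 1 vc v(3) by blast
        qed
        \<comment> \<open>Cross multiplication cancels the \<open>b\<close>-components of
          \<open>z\<close> and \<open>v\<close>; the difference lies in \<open>L\<close>, where the
          chain is already constant.\<close>
        let ?u = "(r1 \<otimes> s2) \<otimes> z" and ?w = "(r2 \<otimes> s1) \<otimes> v"
        have l: "l1 \<in> carrier R" "l2 \<in> carrier R" using 1 2 Lc by auto
        have "?u \<ominus> ?w = r1 \<otimes> (s2 \<otimes> z) \<ominus> r2 \<otimes> (s1 \<otimes> v)" using 1 2 zc vc by algebra
        also have "\<dots> = r1 \<otimes> l2 \<ominus> r2 \<otimes> l1" unfolding 1(5) 2(5) using 1(4) 2(4) l b by algebra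
        also have "\<dots> \<in> L" using 1 2 Lc by simp
        finally have uL: "?u \<ominus> ?w \<in> L" .
        have w: "?w \<in> B m" "?w \<in> B n0"
          using ideal_closed(5)[OF B(1) v(1)] decm[OF m] 1 2 by auto
        have "?u \<in> B n0" using ideal_closed(5)[OF B(1), of z n0] z 1 2 by auto
        from ideal_closed(4)[OF B(1) this w(2)] have "?u \<ominus> ?w \<in> B m" using n0[OF m] uL by blast
        moreover have "?u \<in> carrier R" using 1(4) 2(1) zc by simp
        ultimately have "?u \<in> B m" using ideal_diff_imp[OF B(1) _ w(1), of ?u] by blast
        then show "z \<in> B m"
          using saturatedD[OF B(2), of "r1 \<otimes> s2" z m] prime_mult_notin[OF P] 1 2 r1 zc by simp
      qed
      then show ?thesis by blast
    qed
    then have "?L \<in> S"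
      unfolding S_def
      using saturate_ideal[OF P adj] saturate_saturated[OF P, of "adjoin L b"] sub(1) L(3)
      by (intro CollectI conjI) auto
    then have "?L = L" using max sub(1) by blast
    then show False using sub(2) b by blast
  qed
  then have "B n0 \<subseteq> B m" if "n0 \<le> m" for m using n0[OF that] ideal_closed(2)[OF B(1)] by blast
  then show ?thesis using that[of n0] decm by blast
qed

text \<open>A form of Krull's principal ideal theorem. If \<open>P\<close> were minimal over \<open>P\<^sub>0 + (x)\<close>, the
  contractions \<open>c n\<close> of the ideals \<open>(y\<^sup>n) + P\<^sub>0\<close> of \<open>R\<^sub>Q\<close> would be stationary modulo \<open>x\<close>, hence
  stationary by Nakayama's lemma, for \<open>y \<in> Q - P\<^sub>0\<close>.\<close>

lemma prime_between:
  assumes P0: "primeideal P0 R" and Q: "primeideal Q R" and P: "primeideal P R"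
    and sub: "P0 \<subset> Q" "Q \<subset> P" and x: "x \<in> P"
  obtains P' where "primeideal P' R" "P0 \<subset> P'" "P' \<subset> P" "x \<in> P'"
proof (cases "x \<in> Q")
  case True
  then show ?thesis using that[of Q] Q sub by blast
next
  case xQ: False
  note between = that
  show ?thesis
  proof (rule ccontr)
    assume contra: "\<not> thesis"
    note Pi = primeD(1)[OF P] and Qi = primeD(1)[OF Q] and P0i = primeD(1)[OF P0]
    have xc: "x \<in> carrier R" using ideal_closed(2)[OF Pi x] .
    obtain y where y: "y \<in> Q" "y \<notin> P0" using sub by blast
    have yc: "y \<in> carrier R" using ideal_closed(2)[OF Qi y(1)] .
    define A where "A n = adjoin P0 (y [^] n)" for n :: nat
    define c where "c n = saturate Q (A n)" for n
    define B where "B n = saturate P (adjoin (c n) x)" for n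
    have A: "ideal (A n) R" for n unfolding A_def using adjoin_ideal[OF P0i] yc by simp
    have c: "ideal (c n) R" for n unfolding c_def using saturate_ideal[OF Q A] .
    have csat: "saturated Q (c n)" for n unfolding c_def using saturate_saturated[OF Q] .
    have csatP: "saturated P (c n)" for n using csat[of n] sub(2) unfolding saturated_def by blast
    have Bi: "ideal (B n) R" for n unfolding B_def using saturate_ideal[OF P adjoin_ideal[OF c xc]] .
    have P0A: "P0 \<subseteq> A n" for n unfolding A_def using adjoin_supset(1)[OF P0i] yc by simp
    have Ac: "A n \<subseteq> c n" for n unfolding c_def using saturate_supset[OF Q A] .
    have cdec: "c (Suc n) \<subseteq> c n" for n
    proof -
      have "y [^] Suc n \<in> A n"
        using adjoin_supset(2)[OF P0i, of "y [^] n"] ideal_closed(6)[OF A, of "y [^] n" n y] yc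
        by (simp add: A_def)
      then have "A (Suc n) \<subseteq> A n" using adjoin_least[OF A P0A] by (simp add: A_def)
      then show ?thesis unfolding c_def by (rule saturate_mono)
    qed
    have Bdec: "B (Suc n) \<subseteq> B n" for n
      unfolding B_def using cdec[of n] by (intro saturate_mono) (auto simp: adjoin_def)
    have sub2: "adjoin P0 x \<subseteq> B n" for n
    proof -
      have "adjoin P0 x \<subseteq> adjoin (c n) x" using P0A[of n] Ac[of n] by (auto simp: adjoin_def)
      then show ?thesis unfolding B_def using saturate_supset[OF P adjoin_ideal[OF c xc]] by blast
    qed
    obtain n where n: "\<And>m. n \<le> m \<Longrightarrow> B m = B n"
    proof (rule descending_stabilises_over_minimal_prime[where B = B and I = "adjoin P0 x", OF P Bi _ Bdec _ _ sub2])
      show "saturated P (B n)" for n unfolding B_def by (rule saturate_saturated[OF P])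
      show "ideal (adjoin P0 x) R" using adjoin_ideal[OF P0i xc] .
      show "adjoin P0 x \<subseteq> P" using adjoin_least[OF Pi _ x] sub by blast
      fix P' assume P': "primeideal P' R" "adjoin P0 x \<subseteq> P'" "P' \<subseteq> P"
      then have "P0 \<subseteq> P'" "x \<in> P'" using adjoin_supset[OF P0i xc] by blast+
      moreover have "x \<notin> P0" using xQ sub by blast
      ultimately show "P' = P" using contra between[of P'] P' by blast
    qed blast
    \<comment> \<open>In \<open>s a = d + r x\<close> the cofactor \<open>r\<close> belongs to
      \<open>c n\<close> again: \<open>r x\<close> does, \<open>x\<close> is outside
      \<open>Q\<close>, and \<open>c n\<close> is saturated at \<open>Q\<close>. So
      \<open>c n\<close> lies in \<open>c (Suc n) + x c n\<close> locally at
      \<open>P\<close>.\<close>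
    have "c n \<subseteq> c (Suc n)"
    proof (rule nakayama_at_prime[OF P c csatP c x])
      fix a assume a: "a \<in> c n"
      then have ac: "a \<in> carrier R" using ideal_closed(2)[OF c] by blast
      have "c n \<subseteq> B n"
        unfolding B_def using saturate_supset[OF P adjoin_ideal[OF c xc]] adjoin_supset(1)[OF c xc] by blast
      then have "a \<in> B (Suc n)" using n[of "Suc n"] a by auto
      then obtain s d r where s: "s \<in> carrier R - P" and d: "d \<in> c (Suc n)" and r: "r \<in> carrier R"
        and eq: "s \<otimes> a = d \<oplus> r \<otimes> x"
        by (auto simp: B_def saturate_def adjoin_def)
      have dc: "d \<in> carrier R" using ideal_closed(2)[OF c d] .
      have "x \<otimes> r = s \<otimes> a \<ominus> d"
        unfolding eq using dc r xc by algebra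
      moreover have "s \<otimes> a \<ominus> d \<in> c n"
        using ideal_closed(4)[OF c ideal_closed(5)[OF c a]] s d cdec by blast
      ultimately have "r \<in> c n" using saturatedD[OF csat, of x r n] xc xQ r by simp
      then show "\<exists>s\<in>carrier R - P. \<exists>d\<in>c (Suc n). \<exists>r\<in>c n. s \<otimes> a = d \<oplus> r \<otimes> x"
        using s d eq by blast
    qed
    moreover have "y [^] n \<in> c n" using Ac adjoin_supset(2)[OF P0i, of "y [^] n"] yc by (auto simp: A_def)
    ultimately have "y [^] n \<in> c (Suc n)" by blast
    then obtain s z r where s: "s \<in> carrier R" "s \<notin> Q" and z: "z \<in> P0" and r: "r \<in> carrier R"
      and eq: "s \<otimes> y [^] n = z \<oplus> r \<otimes> y [^] Suc n"
      by (auto simp: c_def saturate_def A_def adjoin_def)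
    have zc: "z \<in> carrier R" using ideal_closed(2)[OF P0i z] .
    have yn: "y [^] n \<in> carrier R" using yc by simp
    \<comment> \<open>Modulo the prime \<open>P0\<close> the factor \<open>y [^] n\<close> cancels.
      What remains says that \<open>s\<close> is a multiple of \<open>y\<close> modulo
      \<open>P0\<close>, so \<open>s \<in> Q\<close>, against its choice as a denominator.\<close>
    have "y [^] n \<otimes> (s \<ominus> r \<otimes> y) = s \<otimes> y [^] n \<ominus> r \<otimes> (y [^] n \<otimes> y)"
      using s(1) r yc yn by algebra
    also have "\<dots> = z" using zc r yc yn by (simp add: eq a_minus_def a_assoc r_neg)
    finally have "y [^] n \<otimes> (s \<ominus> r \<otimes> y) \<in> P0" using z by simp
    moreover have "y [^] k \<notin> P0" for k :: nat
      using primeD(2)[OF P0] prime_mult_notin[OF P0 _ _ yc y(2)] yc by (induction k) auto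
    ultimately have "s \<ominus> r \<otimes> y \<in> P0" using primeD(3)[OF P0 yn] s r yc by simp
    then have "s \<ominus> r \<otimes> y \<in> Q" using sub by blast
    then have "s \<in> Q" using ideal_diff_imp[OF Qi s(1)] ideal_closed(5)[OF Qi y(1) r] by blast
    then show False using s(2) by blast
  qed
qed

end

section \<open>Regular systems of parameters\<close>

text \<open>A chain of \<open>n\<close> strict inclusions is described by its top \<open>P\<close>
  and by a condition \<open>B\<close> on its bottom prime alone. Cutting by an element and
  lengthening downwards then both become changes of \<open>B\<close>.\<close>

primrec prime_chain :: "('a, 'r) ring_scheme \<Rightarrow> ('a set \<Rightarrow> bool) \<Rightarrow> nat \<Rightarrow> 'a set \<Rightarrow> bool" where
  "prime_chain R B 0 P \<longleftrightarrow> primeideal P R \<and> B P"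
| "prime_chain R B (Suc n) P \<longleftrightarrow> primeideal P R \<and> (\<exists>Q. prime_chain R B n Q \<and> Q \<subset> P)"

lemma prime_chain_mono:
  assumes "prime_chain R B n P" "\<And>Q. primeideal Q R \<Longrightarrow> B Q \<Longrightarrow> B' Q"
  shows "prime_chain R B' n P"
  using assms(1) by (induction n arbitrary: P) (use assms(2) in auto)

lemma prime_chain_prime: "prime_chain R B n P \<Longrightarrow> primeideal P R"
  by (cases n) auto

lemma prime_chain_top:
  assumes "prime_chain R B n P" "primeideal P' R" "P \<subset> P'"
  shows "prime_chain R B (Suc n) P'"
  using assms by auto

lemma prime_chain_extend_bottom:
  assumes "prime_chain R (\<lambda>Q. \<exists>P0. primeideal P0 R \<and> B P0 \<and> P0 \<subset> Q) n P"
  shows "prime_chain R B (Suc n) P"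
  using assms
proof (induction n arbitrary: P)
  case (Suc n)
  then obtain Q where "primeideal P R" "prime_chain R B (Suc n) Q" "Q \<subset> P" by fastforce
  then show ?case using prime_chain_top by blast
qed auto

lemma (in ring) Idl_insert_subset:
  assumes "insert u T \<subseteq> carrier R"
  shows "Idl T \<subseteq> Idl (insert u T)" "u \<in> Idl (insert u T)"
  using assms genideal_self[of "insert u T"] subset_Idl_subset[of "insert u T" T] by auto

lemma (in cring) Idl_insert:
  assumes "insert u T \<subseteq> carrier R"
  shows "Idl (insert u T) = adjoin (Idl T) u"
proof -
  have T: "ideal (Idl T) R" using assms by (intro genideal_ideal) auto
  have u: "u \<in> carrier R" using assms by auto
  show ?thesis
  proof
    show "Idl (insert u T) \<subseteq> adjoin (Idl T) u"
      using adjoin_supset[OF T u] genideal_self[of T] assms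
      by (intro genideal_minimal adjoin_ideal T u) auto
    show "adjoin (Idl T) u \<subseteq> Idl (insert u T)"
      using Idl_insert_subset[OF assms] assms by (intro adjoin_least genideal_ideal) auto
  qed
qed

context noetherian_cring
begin

text \<open>Working down from the top, \<open>prime_between\<close> replaces each prime above the
  bottom by one that contains \<open>x\<close>. The bottom prime cannot be moved; it is dropped, and
  remembered as the prime \<open>P0\<close> strictly below the new bottom.\<close>

lemma prime_chain_cut:
  assumes "prime_chain R B (Suc n) P" "x \<in> P"
  shows "prime_chain R (\<lambda>Q. x \<in> Q \<and> (\<exists>P0. primeideal P0 R \<and> B P0 \<and> P0 \<subset> Q)) n P"
  using assms
proof (induction n arbitrary: P)
  case 0
  then show ?case by auto
next
  case (Suc n)
  then obtain Q1 Q0 where *: "primeideal P R" "prime_chain R B n Q0" "primeideal Q1 R" "Q0 \<subset> Q1" "Q1 \<subset> P"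
    by auto
  obtain P' where P': "primeideal P' R" "Q0 \<subset> P'" "P' \<subset> P" "x \<in> P'"
    using prime_between[OF prime_chain_prime[OF *(2)] *(3,1,4,5) Suc.prems(2)] .
  have "prime_chain R B (Suc n) P'" using prime_chain_top[OF *(2) P'(1,2)] .
  from Suc.IH[OF this P'(4)] show ?case using prime_chain_top * P' by blast
qed

end

section \<open>Dimension of the quotients R/(T) of a local ring\<close>

locale noetherian_local = noetherian_cring R for R (structure) +
  fixes \<mm> :: "'a set"
  assumes maximal_prime: "primeideal \<mm> R"
    and unit: "a \<in> carrier R \<Longrightarrow> a \<notin> \<mm> \<Longrightarrow> \<exists>b\<in>carrier R. b \<otimes> a = \<one>"
begin

lemma maximal_ideal: "ideal \<mm> R"
  using primeD(1)[OF maximal_prime] .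

lemma saturated_at_maximal: "ideal I R \<Longrightarrow> saturated \<mm> I"
  unfolding saturated_def
proof (intro ballI impI)
  fix s a assume I: "ideal I R" and s: "s \<in> carrier R - \<mm>" and a: "a \<in> carrier R" "s \<otimes> a \<in> I"
  obtain b where b: "b \<in> carrier R" "b \<otimes> s = \<one>" using unit s by blast
  have "b \<otimes> (s \<otimes> a) = a" using a b s by (metis DiffD1 l_one m_assoc)
  then show "a \<in> I" using ideal_closed(5)[OF I a(2) b(1)] by simp
qed

text \<open>Krull's height theorem for \<open>R/(T)\<close>: moving a generator from
  \<open>U\<close> to \<open>T\<close> costs the chain one link, and once \<open>T\<close> generates
  \<open>\<mm>\<close> no prime over \<open>T\<close> lies strictly below
  \<open>\<mm>\<close>.\<close>

lemma prime_chain_le: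
  assumes "finite U" "T \<union> U \<subseteq> carrier R" "Idl (T \<union> U) = \<mm>" "prime_chain R (\<lambda>Q. T \<subseteq> Q) n \<mm>"
  shows "n \<le> card U"
  using assms
proof (induction U arbitrary: T n rule: finite_induct)
  case empty
  show ?case
  proof (cases n)
    case (Suc k)
    then obtain Q where Q: "prime_chain R (\<lambda>Q. T \<subseteq> Q) k Q" "Q \<subset> \<mm>" using empty by auto
    have "T \<subseteq> Q \<Longrightarrow> prime_chain R (\<lambda>Q. T \<subseteq> Q) k Q \<Longrightarrow> False" if "Q \<subset> \<mm>" for Q
      using genideal_minimal[of Q T] primeD(1)[OF prime_chain_prime] that empty by auto
    moreover have "T \<subseteq> Q" if "prime_chain R (\<lambda>Q. T \<subseteq> Q) k Q" for Q using that
      by (induction k arbitrary: Q) auto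
    ultimately show ?thesis using Q by blast
  qed simp
next
  case (insert u U)
  show ?case
  proof (cases n)
    case (Suc k)
    have "u \<in> \<mm>" using insert genideal_self[of "T \<union> insert u U"] by auto
    from prime_chain_cut[OF insert.prems(3)[unfolded Suc] this]
    have "prime_chain R (\<lambda>Q. insert u T \<subseteq> Q) k \<mm>" by (rule prime_chain_mono) auto
    then have "k \<le> card U" using insert.IH[of "insert u T"] insert.prems by simp
    then show ?thesis using insert.hyps Suc by simp
  qed simp
qed

text \<open>The argument that a regular local ring is a domain, carried out for \<open>R/(T)\<close>
  when its dimension equals the number of remaining generators. By induction \<open>(T, u)\<close>
  is prime; a prime \<open>P0\<close> over \<open>T\<close> strictly below it satisfies
  \<open>P0 = (T) + u P0\<close>, and Nakayama's lemma gives \<open>P0 = (T)\<close>.\<close>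

lemma prime_of_long_chain:
  assumes "finite U" "T \<union> U \<subseteq> carrier R" "Idl (T \<union> U) = \<mm>" "prime_chain R (\<lambda>Q. T \<subseteq> Q) (card U) \<mm>"
  shows "primeideal (Idl T) R"
  using assms
proof (induction U arbitrary: T rule: finite_induct)
  case empty
  then show ?case using maximal_prime by simp
next
  case (insert u U)
  let ?T = "insert u T"
  have sub: "?T \<subseteq> carrier R" "?T \<union> U \<subseteq> carrier R" using insert by auto
  have gen: "Idl (?T \<union> U) = \<mm>" using insert by simp
  have um: "u \<in> \<mm>" using insert genideal_self[of "T \<union> insert u U"] by auto
  have cut: "prime_chain R (\<lambda>Q. u \<in> Q \<and> (\<exists>P0. primeideal P0 R \<and> T \<subseteq> P0 \<and> P0 \<subset> Q)) (card U) \<mm>"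
    using prime_chain_cut[OF _ um] insert by simp
  then have "prime_chain R (\<lambda>Q. ?T \<subseteq> Q) (card U) \<mm>" by (rule prime_chain_mono) auto
  then have pr: "primeideal (Idl ?T) R" using insert.IH[OF sub(2) gen] by simp
  have "\<exists>P0. primeideal P0 R \<and> T \<subseteq> P0 \<and> P0 \<subset> Idl ?T"
  proof (rule ccontr)
    assume *: "\<not> ?thesis"
    \<comment> \<open>Without such a \<open>P0\<close> the prime \<open>Idl ?T\<close> lies strictly
      below the bottom of the chain and lengthens it by one, beyond the bound of
      \<open>prime_chain_le\<close>.\<close>
    have "prime_chain R (\<lambda>Q. \<exists>P0. primeideal P0 R \<and> ?T \<subseteq> P0 \<and> P0 \<subset> Q) (card U) \<mm>"
    proof (rule prime_chain_mono[OF cut])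
      fix Q assume Q: "primeideal Q R" "u \<in> Q \<and> (\<exists>P0. primeideal P0 R \<and> T \<subseteq> P0 \<and> P0 \<subset> Q)"
      then have "?T \<subseteq> Q" by auto
      then have "Idl ?T \<subseteq> Q" using genideal_minimal[OF primeD(1)[OF Q(1)]] by blast
      moreover have "Idl ?T \<noteq> Q" using * Q by blast
      ultimately show "\<exists>P0. primeideal P0 R \<and> ?T \<subseteq> P0 \<and> P0 \<subset> Q"
        using pr genideal_self[OF sub(1)] by blast
    qed
    then have "Suc (card U) \<le> card U"
      using prime_chain_le[OF insert.hyps(1) sub(2) gen] prime_chain_extend_bottom by blast
    then show False by simp
  qed
  then obtain P0 where P0: "primeideal P0 R" "T \<subseteq> P0" "P0 \<subset> Idl ?T" by blast
  note P0i = primeD(1)[OF P0(1)]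
  have TP: "Idl T \<subseteq> P0" using genideal_minimal[OF P0i P0(2)] .
  have Ti: "ideal (Idl T) R" using genideal_ideal sub by auto
  have u: "u \<in> carrier R" "u \<notin> P0" using sub genideal_minimal[OF P0i, of ?T] P0 by auto
  have "P0 \<subseteq> Idl T"
  proof (rule nakayama_at_prime[OF maximal_prime Ti saturated_at_maximal[OF Ti] P0i um])
    fix a assume a: "a \<in> P0"
    then obtain i r where ir: "i \<in> Idl T" "r \<in> carrier R" "a = i \<oplus> r \<otimes> u"
      using P0(3) unfolding Idl_insert[OF sub(1)] adjoin_def by blast
    have c: "a \<in> carrier R" "i \<in> carrier R" using ideal_closed(2) P0i a Ti ir(1) by blast+
    have "u \<otimes> r = a \<ominus> i" unfolding ir(3) using c ir(2) u by algebra
    moreover have "a \<ominus> i \<in> P0" using ideal_closed(4)[OF P0i a] TP ir(1) by blast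
    ultimately have "r \<in> P0" using primeD(3)[OF P0(1) u(1) ir(2)] u(2) by simp
    moreover have "\<one> \<otimes> a = i \<oplus> r \<otimes> u" using ir(3) c by simp
    ultimately show "\<exists>s\<in>carrier R - \<mm>. \<exists>c\<in>Idl T. \<exists>r\<in>P0. s \<otimes> a = c \<oplus> r \<otimes> u"
      using ir(1) primeD(2)[OF maximal_prime] by blast
  qed
  then have "P0 = Idl T" using TP by blast
  then show ?case using P0(1) by simp
qed

end

text \<open>All that follows uses regularity in this form. \<open>T = {}\<close> makes
  \<open>R\<close> a domain; for larger \<open>T\<close> the powers of a further member stay outside
  the prime \<open>Idl T\<close>, which makes powers of the members a regular sequence in every
  order.\<close>

locale regular_system = noetherian_local R \<mm> for R (structure) and \<mm> +
  fixes S :: "'a set"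
  assumes finite_S: "finite S" and S_carrier: "S \<subseteq> carrier R" and S_gen: "Idl S = \<mm>"
    and prime_subset: "T \<subseteq> S \<Longrightarrow> primeideal (Idl T) R"
    and notin_subset: "T \<subseteq> S \<Longrightarrow> u \<in> S - T \<Longrightarrow> u \<notin> Idl T"

text \<open>Cutting the chain by the members of \<open>T\<close> leaves dimension at least
  \<open>card (S - T)\<close> for \<open>R/(T)\<close>. This is the number of remaining generators,
  so \<open>prime_of_long_chain\<close> applies; a \<open>u\<close> in \<open>Idl T\<close> would
  make one of them redundant and violate \<open>prime_chain_le\<close>.\<close>

lemma (in noetherian_local) regular_systemI:
  assumes S: "finite S" "S \<subseteq> carrier R" "Idl S = \<mm>"
    and chain: "prime_chain R (\<lambda>Q. True) (card S) \<mm>"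
  shows "regular_system R \<mm> S"
proof -
  have cut: "prime_chain R (\<lambda>Q. T \<subseteq> Q) (card (S - T)) \<mm>" if "T \<subseteq> S" for T
  proof -
    have "finite T" using that S finite_subset by blast
    then show ?thesis using that
    proof (induction T rule: finite_induct)
      case empty
      then show ?case using chain by simp
    next
      case (insert u T)
      have "card (S - T) = Suc (card (S - insert u T))"
        using insert card_Suc_Diff1[of "S - T" u] S(1) by (simp add: Diff_insert[of S u T])
      moreover have "u \<in> \<mm>" using insert S genideal_self[of S] by auto
      ultimately have "prime_chain R (\<lambda>Q. u \<in> Q \<and> (\<exists>P0. primeideal P0 R \<and> T \<subseteq> P0 \<and> P0 \<subset> Q)) (card (S - insert u T)) \<mm>"
        using prime_chain_cut insert by simp
      then show ?case by (rule prime_chain_mono) auto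
    qed
  qed
  show ?thesis
  proof (intro regular_system.intro noetherian_local_axioms regular_system_axioms.intro)
    fix T assume T: "T \<subseteq> S"
    show "primeideal (Idl T) R"
      using prime_of_long_chain[of "S - T" T] cut[OF T] T S by (simp add: Un_absorb1)
  next
    fix T u assume T: "T \<subseteq> S" and u: "u \<in> S - T"
    show "u \<notin> Idl T"
    proof
      assume uT: "u \<in> Idl T"
      let ?U = "S - T - {u}"
      have sub: "T \<union> ?U \<subseteq> S" using T by auto
      then have subc: "T \<union> ?U \<subseteq> carrier R" using S(2) by blast
      have "Idl (T \<union> ?U) = \<mm>"
      proof
        show "Idl (T \<union> ?U) \<subseteq> \<mm>" using subset_Idl_subset[OF S(2) sub] S(3) by simp
        have i: "ideal (Idl (T \<union> ?U)) R" using genideal_ideal[OF subc] .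
        have "u \<in> Idl (T \<union> ?U)" using uT subset_Idl_subset[OF subc, of T] by auto
        then have "S \<subseteq> Idl (T \<union> ?U)" using genideal_self[OF subc] by auto
        then show "\<mm> \<subseteq> Idl (T \<union> ?U)" using genideal_minimal[OF i] S(3) by blast
      qed
      then have "card (S - T) \<le> card ?U"
        using prime_chain_le[of ?U T "card (S - T)"] cut[OF T] subc \<open>Idl (T \<union> ?U) = \<mm>\<close> S(1) by simp
      moreover have "card (S - T) = Suc (card ?U)" using u S(1) by (metis card_Suc_Diff1 finite_Diff)
      ultimately show False by simp
    qed
  qed (use S in auto)
qed

lemma regular_local_ring_system:
  fixes R (structure)
  assumes "regular_local_ring R \<mm>"
  obtains S where "regular_system R \<mm> S"
proof -
  from assms have noeth: "noetherian_ring R" and loc: "local_ring R \<mm>"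
    and dim: "min_generators R \<mm> = krull_dim R" by (auto simp: regular_local_ring_def)
  from loc have cr: "cring R" and mx: "maximalideal \<mm> R" and uniq: "\<And>J. maximalideal J R \<Longrightarrow> J = \<mm>"
    by (auto simp: local_ring_def)
  interpret noetherian_cring R using noeth cr by (simp add: noetherian_cring_def)
  have mpr: "primeideal \<mm> R" using maximalideal_prime[OF mx] .
  have proper: "I \<subseteq> \<mm>" if I: "ideal I R" "I \<noteq> carrier R" for I
  proof -
    let ?S = "{J. ideal J R \<and> J \<noteq> carrier R \<and> I \<subseteq> J}"
    obtain L where L: "L \<in> ?S" and max: "\<And>J. J \<in> ?S \<Longrightarrow> L \<subseteq> J \<Longrightarrow> J = L"
      using maximal_ideal_in[of ?S] I by blast
    have "maximalideal L R" using L max by (intro maximalidealI) auto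
    then show ?thesis using uniq L by blast
  qed
  interpret noetherian_local R \<mm>
  proof (intro noetherian_local.intro noetherian_local_axioms.intro noetherian_cring_axioms)
    fix a assume a: "a \<in> carrier R" "a \<notin> \<mm>"
    then have "PIdl a = carrier R" using proper[OF cgenideal_ideal[OF a(1)]] cgenideal_self by blast
    then have "\<one> \<in> PIdl a" by simp
    then obtain b where "b \<in> carrier R" "\<one> = b \<otimes> a" unfolding cgenideal_def by blast
    then show "\<exists>b\<in>carrier R. b \<otimes> a = \<one>" by auto
  qed (rule mpr)
  let ?A = "{enat (card S) |S. finite S \<and> S \<subseteq> carrier R \<and> Idl S = \<mm>}"
  have "?A \<noteq> {}" using finetely_gen[OF primeD(1)[OF mpr]] by auto
  then have "Inf ?A \<in> ?A" unfolding Inf_enat_def by (auto intro: LeastI)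
  then obtain S where S: "finite S" "S \<subseteq> carrier R" "Idl S = \<mm>" and card: "min_generators R \<mm> = enat (card S)"
    unfolding min_generators_def by force
  let ?C = "{enat n | n. \<exists>P. (\<forall>i\<le>n. primeideal (P i) R) \<and> (\<forall>i<n. P i \<subset> P (Suc i))}"
  have sup: "Sup ?C = enat (card S)" using dim card by (simp add: krull_dim_def)
  have chain: "prime_chain R (\<lambda>Q. True) n (P n)"
    if "\<forall>i\<le>n. primeideal (P i) R" "\<forall>i<n. P i \<subset> P (Suc i)" for n P
    using that
  proof (induction n)
    case (Suc n)
    then have "prime_chain R (\<lambda>Q. True) n (P n)" "P n \<subset> P (Suc n)" "primeideal (P (Suc n)) R" by auto
    then show ?case by auto
  qed auto
  have "prime_chain R (\<lambda>Q. True) (card S) \<mm>"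
  proof (cases "card S")
    case 0
    then show ?thesis using mpr by simp
  next
    case (Suc k)
    \<comment> \<open>Going one below the supremum yields a chain longer than \<open>k\<close>
      without asking that the supremum be attained. Its first \<open>k + 1\<close> primes lie
      strictly below \<open>\<mm>\<close>, which can then serve as the top.\<close>
    have "enat k < Sup ?C" using sup Suc by simp
    then obtain n P where n: "k < n" and P: "\<forall>i\<le>n. primeideal (P i) R" "\<forall>i<n. P i \<subset> P (Suc i)"
      unfolding less_Sup_iff by auto
    have "P k \<subset> P (Suc k)" using P n by simp
    moreover have "P (Suc k) \<subseteq> \<mm>"
      using proper[of "P (Suc k)"] P(1) n primeD(1,2) by (metis Suc_leI one_closed)
    ultimately have "P k \<subset> \<mm>" by blast
    moreover have "prime_chain R (\<lambda>Q. True) k (P k)" using chain[of k P] P n by simp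
    ultimately show ?thesis using prime_chain_top mpr Suc by metis
  qed
  then show ?thesis using that regular_systemI[OF S] by blast
qed

section \<open>Monomial ideals in a regular system\<close>

definition (in ring) power_ideal :: "('a \<Rightarrow> nat) \<Rightarrow> 'a set \<Rightarrow> 'a set" where
  "power_ideal a T = Idl ((\<lambda>s. s [^] a s) ` T)"

lemma (in cring) power_ideal_ideal: "T \<subseteq> carrier R \<Longrightarrow> ideal (power_ideal a T) R"
  unfolding power_ideal_def by (intro genideal_ideal) auto

lemma (in cring) power_ideal_insert:
  assumes "insert u T \<subseteq> carrier R"
  shows "power_ideal a (insert u T) = adjoin (power_ideal a T) (u [^] a u)"
  unfolding power_ideal_def image_insert using assms by (intro Idl_insert) auto

lemma (in ring) power_ideal_cong: "(\<And>s. s \<in> T \<Longrightarrow> a s = b s) \<Longrightarrow> power_ideal a T = power_ideal b T"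
  unfolding power_ideal_def by (simp cong: image_cong)

lemma (in cring) power_ideal_one:
  assumes "T \<subseteq> carrier R"
  shows "power_ideal (\<lambda>_. 1) T = Idl T"
proof -
  have "s [^] (1::nat) = s" if "s \<in> T" for s using that assms by auto
  then have "(\<lambda>s. s [^] (1::nat)) ` T = T" by force
  then show ?thesis by (simp add: power_ideal_def)
qed

lemma (in cring) pow_notin_prime:
  assumes "primeideal P R" "x \<in> carrier R" "x \<notin> P"
  shows "x [^] (n::nat) \<notin> P"
  using primeD(2)[OF assms(1)] prime_mult_notin[OF assms(1) _ _ assms(2,3)] assms(2) by (induction n) auto

text \<open>The graph of the map \<open>\<Sum>r\<^sub>s s\<^sup>q \<mapsto> \<Sum>r\<^sub>s v\<^sub>s\<close> on the ideal generated by the \<open>s\<^sup>q\<close>,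
  \<open>s \<in> T\<close>.\<close>

inductive_set combination_graph ::
    "('a, 'r) ring_scheme \<Rightarrow> ('a, 'b, 'c) module_scheme \<Rightarrow> nat \<Rightarrow> ('a \<Rightarrow> 'b) \<Rightarrow> 'a set \<Rightarrow> ('a \<times> 'b) set"
  for R M q v T where
  zero: "(\<zero>\<^bsub>R\<^esub>, \<zero>\<^bsub>M\<^esub>) \<in> combination_graph R M q v T"
| gen: "s \<in> T \<Longrightarrow> (s [^]\<^bsub>R\<^esub> q, v s) \<in> combination_graph R M q v T"
| add: "(y, e) \<in> combination_graph R M q v T \<Longrightarrow> (z, f) \<in> combination_graph R M q v T \<Longrightarrow>
    (y \<oplus>\<^bsub>R\<^esub> z, e \<oplus>\<^bsub>M\<^esub> f) \<in> combination_graph R M q v T"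
| smult: "(y, e) \<in> combination_graph R M q v T \<Longrightarrow> r \<in> carrier R \<Longrightarrow>
    (r \<otimes>\<^bsub>R\<^esub> y, r \<odot>\<^bsub>M\<^esub> e) \<in> combination_graph R M q v T"

context module
begin

lemma combination_graph_carrier:
  assumes "(y, e) \<in> combination_graph R M q v T" "T \<subseteq> carrier R" "v ` T \<subseteq> carrier M"
  shows "y \<in> carrier R" "e \<in> carrier M"
  using assms by (induction rule: combination_graph.induct) auto

lemma combination_graph_insert:
  assumes "(y, e) \<in> combination_graph R M q v (insert u T)" "insert u T \<subseteq> carrier R" "v ` insert u T \<subseteq> carrier M"
  obtains z f r where "(z, f) \<in> combination_graph R M q v T" "r \<in> carrier R"
    "y = z \<oplus>\<^bsub>R\<^esub> r \<otimes>\<^bsub>R\<^esub> u [^]\<^bsub>R\<^esub> q" "e = f \<oplus>\<^bsub>M\<^esub> r \<odot>\<^bsub>M\<^esub> v u"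
proof -
  have T: "T \<subseteq> carrier R" "v ` T \<subseteq> carrier M" and u: "u \<in> carrier R" "v u \<in> carrier M" using assms by auto
  note c = combination_graph_carrier[OF _ T]
  have "\<exists>z f r. (z, f) \<in> combination_graph R M q v T \<and> r \<in> carrier R \<and>
    y = z \<oplus>\<^bsub>R\<^esub> r \<otimes>\<^bsub>R\<^esub> u [^]\<^bsub>R\<^esub> q \<and> e = f \<oplus>\<^bsub>M\<^esub> r \<odot>\<^bsub>M\<^esub> v u"
    using assms(1)
  proof (induction rule: combination_graph.induct)
    case zero
    show ?case using combination_graph.zero[of R M q v T] u
      by (intro exI[of _ "\<zero>\<^bsub>R\<^esub>"] exI[of _ "\<zero>\<^bsub>M\<^esub>"]) simp
  next
    case (gen s)
    show ?case
    proof (cases "s = u")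
      case True
      then show ?thesis using combination_graph.zero[of R M q v T] u
        by (intro exI[of _ "\<zero>\<^bsub>R\<^esub>"] exI[of _ "\<zero>\<^bsub>M\<^esub>"] exI[of _ "\<one>\<^bsub>R\<^esub>"]) simp
    next
      case False
      then have "(s [^]\<^bsub>R\<^esub> q, v s) \<in> combination_graph R M q v T" using gen combination_graph.gen by auto
      moreover note c[OF this]
      ultimately show ?thesis using u
        by (intro exI[of _ "s [^]\<^bsub>R\<^esub> q"] exI[of _ "v s"] exI[of _ "\<zero>\<^bsub>R\<^esub>"]) simp
    qed
  next
    case (add y e y' e')
    then obtain z f r z' f' r' where 1: "(z, f) \<in> combination_graph R M q v T" "r \<in> carrier R"
      "y = z \<oplus>\<^bsub>R\<^esub> r \<otimes>\<^bsub>R\<^esub> u [^]\<^bsub>R\<^esub> q" "e = f \<oplus>\<^bsub>M\<^esub> r \<odot>\<^bsub>M\<^esub> v u"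
      and 2: "(z', f') \<in> combination_graph R M q v T" "r' \<in> carrier R"
      "y' = z' \<oplus>\<^bsub>R\<^esub> r' \<otimes>\<^bsub>R\<^esub> u [^]\<^bsub>R\<^esub> q" "e' = f' \<oplus>\<^bsub>M\<^esub> r' \<odot>\<^bsub>M\<^esub> v u"
      by blast
    show ?case using combination_graph.add[OF 1(1) 2(1)] 1(2-) 2(2-) c[OF 1(1)] c[OF 2(1)] u
      by (intro exI[of _ "z \<oplus>\<^bsub>R\<^esub> z'"] exI[of _ "f \<oplus>\<^bsub>M\<^esub> f'"] exI[of _ "r \<oplus>\<^bsub>R\<^esub> r'"])
        (simp add: R.l_distr smult_l_distr R.a_ac M.a_ac)
  next
    case (smult y e s)
    then obtain z f r where 1: "(z, f) \<in> combination_graph R M q v T" "r \<in> carrier R"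
      "y = z \<oplus>\<^bsub>R\<^esub> r \<otimes>\<^bsub>R\<^esub> u [^]\<^bsub>R\<^esub> q" "e = f \<oplus>\<^bsub>M\<^esub> r \<odot>\<^bsub>M\<^esub> v u"
      by blast
    show ?case using combination_graph.smult[OF 1(1) smult(2)] smult(2) 1(2-) c[OF 1(1)] u
      by (intro exI[of _ "s \<otimes>\<^bsub>R\<^esub> z"] exI[of _ "s \<odot>\<^bsub>M\<^esub> f"] exI[of _ "s \<otimes>\<^bsub>R\<^esub> r"])
        (simp add: R.r_distr smult_r_distr R.m_assoc smult_assoc1)
  qed
  then show ?thesis using that by blast
qed

lemma combination_graph_Domain:
  assumes T: "T \<subseteq> carrier R" "v ` T \<subseteq> carrier M"
  shows "R.power_ideal (\<lambda>_. q) T = Domain (combination_graph R M q v T)"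
proof
  have "ideal (Domain (combination_graph R M q v T)) R"
  proof (rule R.cring_idealI)
    show "Domain (combination_graph R M q v T) \<subseteq> carrier R"
      using combination_graph_carrier[OF _ T] by auto
    show "\<zero>\<^bsub>R\<^esub> \<in> Domain (combination_graph R M q v T)" using combination_graph.zero by fast
    show "a \<oplus>\<^bsub>R\<^esub> b \<in> Domain (combination_graph R M q v T)"
      if "a \<in> Domain (combination_graph R M q v T)" "b \<in> Domain (combination_graph R M q v T)" for a b
      using that combination_graph.add by fast
    show "r \<otimes>\<^bsub>R\<^esub> a \<in> Domain (combination_graph R M q v T)"
      if "a \<in> Domain (combination_graph R M q v T)" "r \<in> carrier R" for a r
      using that combination_graph.smult by fast
  qed
  moreover have "(\<lambda>s. s [^]\<^bsub>R\<^esub> q) ` T \<subseteq> Domain (combination_graph R M q v T)"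
    using combination_graph.gen by fast
  ultimately show "R.power_ideal (\<lambda>_. q) T \<subseteq> Domain (combination_graph R M q v T)"
    unfolding R.power_ideal_def by (rule R.genideal_minimal)
  have i: "ideal (R.power_ideal (\<lambda>_. q) T) R" using R.power_ideal_ideal[OF T(1)] .
  have sub: "(\<lambda>s. s [^]\<^bsub>R\<^esub> q) ` T \<subseteq> R.power_ideal (\<lambda>_. q) T"
    unfolding R.power_ideal_def using T(1) by (intro R.genideal_self) auto
  have "y \<in> R.power_ideal (\<lambda>_. q) T" if "(y, e) \<in> combination_graph R M q v T" for y e
    using that by (induction rule: combination_graph.induct) (use R.ideal_closed[OF i] sub in auto)
  then show "Domain (combination_graph R M q v T) \<subseteq> R.power_ideal (\<lambda>_. q) T" by auto
qed

text \<open>Spreads Koszul identities from the generators \<open>s [^] q\<close> to all their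
  combinations. It is applied with \<open>u\<close> the power of a new generator and
  \<open>w\<close> the value prescribed there.\<close>

lemma combination_graph_commute:
  assumes "(y, e) \<in> combination_graph R M q v T" "T \<subseteq> carrier R" "v ` T \<subseteq> carrier M"
    and u: "u \<in> carrier R" "w \<in> carrier M" "\<And>s. s \<in> T \<Longrightarrow> u \<odot>\<^bsub>M\<^esub> v s = s [^]\<^bsub>R\<^esub> q \<odot>\<^bsub>M\<^esub> w"
  shows "u \<odot>\<^bsub>M\<^esub> e = y \<odot>\<^bsub>M\<^esub> w"
  using assms(1)
proof (induction rule: combination_graph.induct)
  case zero
  then show ?case using u by simp
next
  case (gen s)
  then show ?case using u by simp
next
  case (add y e z f)
  then show ?case using u combination_graph_carrier[OF _ assms(2,3)] by (simp add: smult_r_distr smult_l_distr)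
next
  case (smult y e r)
  note c = combination_graph_carrier[OF smult(1) assms(2,3)]
  have "u \<odot>\<^bsub>M\<^esub> (r \<odot>\<^bsub>M\<^esub> e) = r \<odot>\<^bsub>M\<^esub> (u \<odot>\<^bsub>M\<^esub> e)"
    using u smult(2) c by (simp flip: smult_assoc1 add: R.m_comm)
  then show ?case using smult c u by (simp add: smult_assoc1)
qed

end

context regular_system
begin

lemma S_maximal: "s \<in> S \<Longrightarrow> s \<in> \<mm>"
  using genideal_self[OF S_carrier] S_gen by auto

text \<open>With \<open>J\<close> generated by the powers of the members other than
  \<open>u\<close>, multiplication by \<open>u\<^sup>n\<close> gives a short exact sequence with
  terms \<open>R/(J, u)\<close>, \<open>R/(J, u\<^sup>n\<^sup>+\<^sup>1)\<close> and
  \<open>R/(J, u\<^sup>n)\<close>, and an element regular on both ends is regular in the middle.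
  Injectivity of the first map is the same statement for fewer members. All three are smaller for
  the sum of the exponents.\<close>

lemma notin_prime_imp_regular:
  assumes "T \<subseteq> S" "\<And>s. s \<in> T \<Longrightarrow> 0 < a s" "r \<in> carrier R" "r \<notin> Idl T" "b \<in> carrier R" "r \<otimes> b \<in> power_ideal a T"
  shows "b \<in> power_ideal a T"
  using assms
proof (induction "sum a T" arbitrary: a T r b rule: less_induct)
  case less
  have fin: "finite T" using finite_subset[OF less.prems(1) finite_S] .
  have Tc: "T \<subseteq> carrier R" using less.prems(1) S_carrier by blast
  show ?case
  proof (cases "\<forall>s\<in>T. a s = 1")
    case True
    then have "power_ideal a T = Idl T" using power_ideal_cong[of T a "\<lambda>_. 1"] power_ideal_one[OF Tc] by simp
    then show ?thesis using primeD(3)[OF prime_subset[OF less.prems(1)] less.prems(3,5) _ less.prems(4)] less.prems(6) by simp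
  next
    case False
    then obtain u where u: "u \<in> T" "a u \<noteq> 1" by blast
    then obtain n where n: "a u = Suc n" "0 < n" using less.prems(2)[OF u(1)] by (cases "a u") auto
    define T' where "T' = T - {u}"
    have T: "T = insert u T'" "u \<notin> T'" and sub: "insert u T' \<subseteq> carrier R" "T' \<subseteq> S" and uc: "u \<in> carrier R"
      using u Tc less.prems(1) by (auto simp: T'_def)
    have fin': "finite T'" using fin by (simp add: T'_def)
    let ?J = "power_ideal a T'"
    have J: "ideal ?J R" using power_ideal_ideal sub by auto
    note Jc = ideal_closed[OF J]
    have pw: "power_ideal (a(u := k)) T = adjoin ?J (u [^] k)" for k
    proof -
      have "power_ideal (a(u := k)) T' = ?J" using T(2) by (intro power_ideal_cong) auto
      then show ?thesis using power_ideal_insert[OF sub(1), of "a(u := k)"] T(1) by simp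
    qed
    have pwa: "power_ideal a T = adjoin ?J (u [^] Suc n)" using pw[of "a u", unfolded fun_upd_triv] by (simp only: n(1))
    have sum: "sum (a(u := k)) T = k + sum a T'" for k
    proof -
      have "sum (a(u := k)) T' = sum a T'" using T(2) by (intro sum.cong) auto
      then show ?thesis using T fin' by simp
    qed
    have suma: "sum a T = Suc n + sum a T'" using sum[of "a u", unfolded fun_upd_triv] by (simp only: n(1))
    obtain c2 v where c2: "c2 \<in> ?J" "v \<in> carrier R" "r \<otimes> b = c2 \<oplus> v \<otimes> u [^] Suc n"
      using less.prems(6) unfolding pwa adjoin_def by blast
    have "r \<otimes> b = c2 \<oplus> (v \<otimes> u) \<otimes> u [^] n"
      unfolding c2(3) using uc c2(2) Jc(2)[OF c2(1)] by (simp add: m_ac)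
    then have "r \<otimes> b \<in> power_ideal (a(u := n)) T"
      unfolding pw using adjoinI[OF c2(1), of "v \<otimes> u"] c2(2) uc by simp
    then have "b \<in> power_ideal (a(u := n)) T"
      using less.hyps[of "a(u := n)" T r b] less.prems sum suma n(2) by simp
    then obtain c1 t where c1: "c1 \<in> ?J" "t \<in> carrier R" "b = c1 \<oplus> t \<otimes> u [^] n"
      unfolding pw adjoin_def by blast
    note cc = Jc(2)[OF c1(1)] Jc(2)[OF c2(1)] c1(2) c2(2) uc less.prems(3) nat_pow_closed[OF uc, of n]
    \<comment> \<open>Comparing two expressions of \<open>r b\<close>, one from \<open>b\<close>
      modulo \<open>u [^] n\<close> and one modulo \<open>u [^] Suc n\<close>, and cancelling
      \<open>u [^] n\<close> modulo \<open>?J\<close> shows that \<open>r t\<close> lies in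
      \<open>?J + (u)\<close>.\<close>
    have "u [^] n \<otimes> (r \<otimes> t \<ominus> v \<otimes> u) = r \<otimes> b \<ominus> v \<otimes> (u [^] n \<otimes> u) \<ominus> r \<otimes> c1"
      unfolding c1(3) using cc by algebra
    also have "\<dots> = c2 \<ominus> r \<otimes> c1"
      unfolding c2(3) nat_pow_Suc using cc by algebra
    finally have "u [^] n \<otimes> (r \<otimes> t \<ominus> v \<otimes> u) \<in> ?J"
      using Jc(4)[OF c2(1) Jc(5)[OF c1(1) less.prems(3)]] by simp
    moreover have "u [^] n \<notin> Idl T'"
      using pow_notin_prime[OF prime_subset[OF sub(2)] uc] notin_subset[OF sub(2), of u] u(1) less.prems(1) T(2) by blast
    ultimately have "r \<otimes> t \<ominus> v \<otimes> u \<in> ?J"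
      using less.hyps[of a T' "u [^] n" "r \<otimes> t \<ominus> v \<otimes> u"] suma less.prems(2) T sub cc by simp
    from adjoinI[OF this c2(2), of u] have "r \<otimes> t \<ominus> v \<otimes> u \<oplus> v \<otimes> u \<in> adjoin ?J u" .
    moreover have "r \<otimes> t \<ominus> v \<otimes> u \<oplus> v \<otimes> u = r \<otimes> t" using cc by algebra
    ultimately have "r \<otimes> t \<in> power_ideal (a(u := 1)) T" using pw[of 1] uc by simp
    then have "t \<in> power_ideal (a(u := 1)) T"
      using less.hyps[of "a(u := 1)" T r t] less.prems sum suma n(2) cc by simp
    then obtain c3 w where c3: "c3 \<in> ?J" "w \<in> carrier R" "t = c3 \<oplus> w \<otimes> u"
      using pw[of 1] uc unfolding adjoin_def by auto
    have "b = (c1 \<oplus> u [^] n \<otimes> c3) \<oplus> w \<otimes> (u [^] n \<otimes> u)"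
      unfolding c1(3) c3(3) using cc c3(2) Jc(2)[OF c3(1)] by algebra
    then show ?thesis
      unfolding pwa using adjoinI[OF Jc(3)[OF c1(1) Jc(5)[OF c3(1) cc(7)]] c3(2), of "u [^] Suc n"] by simp
  qed
qed

text \<open>\<open>U\<close> holds the members whose exponent is still \<open>Suc n\<close>.
  Cancelling \<open>u [^] n\<close>, which is regular modulo the powers of the other members, lowers
  the exponent of \<open>u\<close> to 1 and removes its factor from the monomial.\<close>

lemma monomial_colon:
  assumes "T \<subseteq> S" "U \<subseteq> T" "t \<in> carrier R"
    and "t \<otimes> (\<Otimes>u\<in>U. u [^] n) \<in> power_ideal (\<lambda>s. if s \<in> U then Suc n else 1) T"
  shows "t \<in> Idl T"
proof -
  have "finite U" using finite_subset[of U S] assms(1,2) finite_S by auto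
  then show ?thesis using assms(2-)
  proof (induction U arbitrary: t rule: finite_induct)
    case empty
    have "T \<subseteq> carrier R" using assms(1) S_carrier by blast
    from power_ideal_one[OF this] show ?case using empty by simp
  next
    case (insert u U)
    define T' where "T' = T - {u}"
    have T: "T = insert u T'" "u \<notin> T'" and sub: "insert u T' \<subseteq> carrier R" "T' \<subseteq> S" and uc: "u \<in> carrier R"
      and uS: "u \<in> S" and Uc: "U \<subseteq> carrier R"
      using insert.prems(1) assms(1) S_carrier by (auto simp: T'_def)
    let ?a = "\<lambda>s. if s \<in> insert u U then Suc n else 1"
    let ?b = "\<lambda>s. if s \<in> U then Suc n else 1"
    let ?J = "power_ideal ?b T'"
    have J: "ideal ?J R" using power_ideal_ideal sub by auto
    note Jc = ideal_closed[OF J]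
    have "power_ideal ?a T' = ?J" using T(2) by (intro power_ideal_cong) auto
    then have pa: "power_ideal ?a T = adjoin ?J (u [^] Suc n)"
      using power_ideal_insert[OF sub(1), of ?a] T by simp
    have pb: "power_ideal ?b T = adjoin ?J u"
      using power_ideal_insert[OF sub(1), of ?b] T insert.hyps(2) uc by simp
    define \<pi> where "\<pi> = (\<Otimes>u\<in>U. u [^] n)"
    have pc: "\<pi> \<in> carrier R" unfolding \<pi>_def using Uc by (intro finprod_closed) auto
    have "(\<Otimes>u\<in>insert u U. u [^] n) = u [^] n \<otimes> \<pi>"
      unfolding \<pi>_def using insert.hyps Uc uc by (subst finprod_insert) auto
    then obtain c w where c: "c \<in> ?J" "w \<in> carrier R" "t \<otimes> (u [^] n \<otimes> \<pi>) = c \<oplus> w \<otimes> u [^] Suc n"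
      using insert.prems(3) unfolding pa adjoin_def by force
    note cc = Jc(2)[OF c(1)] c(2) uc nat_pow_closed[OF uc, of n] pc insert.prems(2)
    have "u [^] n \<otimes> (t \<otimes> \<pi> \<ominus> w \<otimes> u) = t \<otimes> (u [^] n \<otimes> \<pi>) \<ominus> w \<otimes> (u [^] n \<otimes> u)"
      using cc by algebra
    also have "\<dots> = c" unfolding c(3) nat_pow_Suc using cc by algebra
    finally have "u [^] n \<otimes> (t \<otimes> \<pi> \<ominus> w \<otimes> u) \<in> ?J" using c(1) by simp
    moreover have "u [^] n \<notin> Idl T'"
      using pow_notin_prime[OF prime_subset[OF sub(2)] uc] notin_subset[OF sub(2), of u] uS T(2) by blast
    ultimately have "t \<otimes> \<pi> \<ominus> w \<otimes> u \<in> ?J"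
      using notin_prime_imp_regular[OF sub(2), of ?b "u [^] n" "t \<otimes> \<pi> \<ominus> w \<otimes> u"] cc by simp
    from adjoinI[OF this c(2), of u] have "t \<otimes> \<pi> \<ominus> w \<otimes> u \<oplus> w \<otimes> u \<in> power_ideal ?b T" unfolding pb .
    moreover have "t \<otimes> \<pi> \<ominus> w \<otimes> u \<oplus> w \<otimes> u = t \<otimes> \<pi>" using cc by algebra
    ultimately show ?case using insert.IH[of t] insert.prems unfolding \<pi>_def by simp
  qed
qed

lemma monomial_notin: "(\<Otimes>u\<in>S. u [^] n) \<notin> power_ideal (\<lambda>_. Suc n) S"
proof
  assume *: "(\<Otimes>u\<in>S. u [^] n) \<in> power_ideal (\<lambda>_. Suc n) S"
  have "(\<Otimes>u\<in>S. u [^] n) \<in> carrier R" using S_carrier by (intro finprod_closed) auto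
  then have "\<one> \<in> Idl S"
    using * power_ideal_cong[of S "\<lambda>s. if s \<in> S then Suc n else 1" "\<lambda>_. Suc n"]
    by (intro monomial_colon[of S S \<one> n]) auto
  then show False using S_gen primeD(2)[OF maximal_prime] by simp
qed

text \<open>As the powers form a regular sequence, all relations between them follow from the Koszul
  relations, and \<open>comm\<close> says that \<open>v\<close> respects those. In a relation
  \<open>z + r u\<^sup>q = 0\<close> the coefficient \<open>r\<close> is itself a combination of the
  powers of \<open>T\<close>, so the last term can be traded for one over \<open>T\<close>.\<close>

lemma combination_graph_single_valued:
  assumes M: "module R M" and "T \<subseteq> S" "0 < q" "v ` T \<subseteq> carrier M"
    and comm: "\<And>s t. s \<in> T \<Longrightarrow> t \<in> T \<Longrightarrow> t [^] q \<odot>\<^bsub>M\<^esub> v s = s [^] q \<odot>\<^bsub>M\<^esub> v t"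
    and "(\<zero>, e) \<in> combination_graph R M q v T"
  shows "e = \<zero>\<^bsub>M\<^esub>"
proof -
  interpret M: module R M by fact
  have "finite T" using finite_subset[OF assms(2) finite_S] .
  then show ?thesis using assms(2,4-)
  proof (induction T arbitrary: e rule: finite_induct)
    case empty
    have "y = \<zero> \<and> e = \<zero>\<^bsub>M\<^esub>" if "(y, e) \<in> combination_graph R M q v {}" for y e
      using that by (induction rule: combination_graph.induct) auto
    then show ?case using empty by blast
  next
    case (insert u T)
    have sub: "insert u T \<subseteq> carrier R" "T \<subseteq> carrier R" "T \<subseteq> S" "u \<in> carrier R" "v ` T \<subseteq> carrier M" "v u \<in> carrier M"
      using insert.prems S_carrier by auto
    note dom = M.combination_graph_Domain[OF sub(2,5), of q]
    note gc = M.combination_graph_carrier[OF _ sub(2,5)]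
    obtain z f r where z: "(z, f) \<in> combination_graph R M q v T" "r \<in> carrier R"
      "\<zero> = z \<oplus> r \<otimes> u [^] q" "e = f \<oplus>\<^bsub>M\<^esub> r \<odot>\<^bsub>M\<^esub> v u"
      using M.combination_graph_insert[OF insert.prems(4) sub(1) insert.prems(2)] by metis
    have J: "ideal (power_ideal (\<lambda>_. q) T) R" using power_ideal_ideal[OF sub(2)] .
    have zJ: "z \<in> power_ideal (\<lambda>_. q) T" using z(1) dom by blast
    have uq: "u [^] q \<in> carrier R" using sub by simp
    have "u [^] q \<otimes> r = \<zero> \<ominus> z" unfolding z(3) using gc[OF z(1)] z(2) uq by algebra
    also have "\<dots> \<in> power_ideal (\<lambda>_. q) T" using ideal_closed[OF J] zJ by blast
    finally have "u [^] q \<otimes> r \<in> power_ideal (\<lambda>_. q) T" .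
    moreover have "u [^] q \<notin> Idl T"
      using pow_notin_prime[OF prime_subset[OF sub(3)] sub(4)] notin_subset[OF sub(3), of u] insert by blast
    ultimately have "r \<in> power_ideal (\<lambda>_. q) T"
      using notin_prime_imp_regular[OF sub(3), of "\<lambda>_. q" "u [^] q" r] assms(3) uq z(2) by simp
    then obtain g where g: "(r, g) \<in> combination_graph R M q v T" using dom by blast
    have "z \<oplus> u [^] q \<otimes> r = \<zero>" using z(2,3) gc[OF z(1)] uq m_comm by simp
    then have "(\<zero>, f \<oplus>\<^bsub>M\<^esub> u [^] q \<odot>\<^bsub>M\<^esub> g) \<in> combination_graph R M q v T"
      using combination_graph.add[OF z(1) combination_graph.smult[OF g uq]] by simp
    then have "f \<oplus>\<^bsub>M\<^esub> u [^] q \<odot>\<^bsub>M\<^esub> g = \<zero>\<^bsub>M\<^esub>" using insert.IH insert.prems by auto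
    moreover have "u [^] q \<odot>\<^bsub>M\<^esub> g = r \<odot>\<^bsub>M\<^esub> v u"
      using M.combination_graph_commute[OF g sub(2,5) uq sub(6)] insert.prems(3) by auto
    ultimately show ?case using z(4) by simp
  qed
qed

end

section \<open>Lexicographic orders and the Frobenius endomorphism\<close>

context cring
begin

text \<open>Write \<open>r = x\<^sup>a s\<close> modulo \<open>I\<close> with \<open>s\<close> outside \<open>I + (x)\<close>, continue with \<open>s\<close> modulo
  \<open>I + (x)\<close>, and so on: the exponents form a lexicographic valuation. It replaces the order with respect to
  the powers of \<open>\<mm>\<close>, whose additivity would need the associated graded ring.\<close>

primrec lex_bounded :: "'a set \<Rightarrow> 'a list \<Rightarrow> nat \<Rightarrow> 'a \<Rightarrow> bool" where
  "lex_bounded I [] k r \<longleftrightarrow> r \<in> carrier R \<and> r \<notin> I"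
| "lex_bounded I (x # xs) k r \<longleftrightarrow> r \<in> carrier R \<and>
     (\<exists>a\<le>k. \<exists>s. lex_bounded (adjoin I x) xs k s \<and> r \<ominus> x [^] a \<otimes> s \<in> I)"

lemma lex_bounded_carrier: "lex_bounded I xs k r \<Longrightarrow> r \<in> carrier R"
  by (cases xs) auto

lemma lex_bounded_mono: "lex_bounded I xs k r \<Longrightarrow> k \<le> l \<Longrightarrow> lex_bounded I xs l r"
proof (induction xs arbitrary: I r)
  case (Cons x xs)
  then show ?case using le_trans by fastforce
qed auto

text \<open>Two expansions multiply term by term, so exponents add. The predicate asks for some
  expansion with exponents at most \<open>k\<close>, hence no uniqueness is involved; primality of
  the ideal at the end of the list keeps the product of the last cofactors outside.\<close>

lemma lex_bounded_mult:
  assumes "ideal I R" "set xs \<subseteq> carrier R" "primeideal (foldl adjoin I xs) R"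
    "lex_bounded I xs k r" "lex_bounded I xs l s"
  shows "lex_bounded I xs (k + l) (r \<otimes> s)"
  using assms
proof (induction xs arbitrary: I r s)
  case Nil
  then show ?case using prime_mult_notin[of I r s] by simp
next
  case (Cons x xs)
  have x: "x \<in> carrier R" "set xs \<subseteq> carrier R" using Cons.prems by auto
  note c = ideal_closed[OF Cons.prems(1)]
  obtain a u where a: "a \<le> k" "lex_bounded (adjoin I x) xs k u" "r \<ominus> x [^] a \<otimes> u \<in> I" "r \<in> carrier R"
    using Cons.prems(4) by auto
  obtain b v where b: "b \<le> l" "lex_bounded (adjoin I x) xs l v" "s \<ominus> x [^] b \<otimes> v \<in> I" "s \<in> carrier R"
    using Cons.prems(5) by auto
  have uv: "u \<in> carrier R" "v \<in> carrier R" using lex_bounded_carrier a(2) b(2) by blast+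
  have "lex_bounded (adjoin I x) xs (k + l) (u \<otimes> v)"
    using Cons.IH[OF adjoin_ideal[OF Cons.prems(1) x(1)] x(2) _ a(2) b(2)] Cons.prems(3) by simp
  moreover have "r \<otimes> s \<ominus> x [^] (a + b) \<otimes> (u \<otimes> v) \<in> I"
  proof -
    define y z where "y = x [^] a" and "z = x [^] b"
    have yz: "y \<in> carrier R" "z \<in> carrier R" "x [^] (a + b) = y \<otimes> z"
      using x by (auto simp: y_def z_def nat_pow_mult)
    have "r \<otimes> s \<ominus> (y \<otimes> z) \<otimes> (u \<otimes> v) = s \<otimes> (r \<ominus> y \<otimes> u) \<oplus> (y \<otimes> u) \<otimes> (s \<ominus> z \<otimes> v)"
      using yz(1,2) uv a(4) b(4) by algebra
    also have "\<dots> \<in> I" using c(3,5) a(3,4) b(3,4) yz uv unfolding y_def z_def by simp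
    finally show ?thesis unfolding yz(3) .
  qed
  ultimately show ?case using a(4) b(4) add_mono[OF a(1) b(1)]
    by (simp, intro exI[of _ "a + b"] conjI exI[of _ "u \<otimes> v"]) auto
qed

text \<open>Each exponent \<open>a\<close> is filled up to \<open>n\<close> by a factor
  \<open>x [^] (n - a)\<close>, and the final cofactor is a unit, so a multiple of \<open>r\<close>
  becomes the full monomial. \<open>Y\<close> collects the powers \<open>x [^] n\<close> already
  dealt with; it multiplies \<open>I\<close> into \<open>J\<close>, so that congruences modulo
  \<open>I\<close> turn into congruences modulo \<open>J\<close>.\<close>

lemma lex_bounded_deep:
  assumes "ideal I R" "set xs \<subseteq> carrier R" "ideal J R" "Y \<in> carrier R"
    and YI: "\<And>i. i \<in> I \<Longrightarrow> Y \<otimes> i \<in> J" and xJ: "\<And>x. x \<in> set xs \<Longrightarrow> x [^] Suc n \<in> J"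
    and unit: "\<And>s. s \<in> carrier R \<Longrightarrow> s \<notin> foldl adjoin I xs \<Longrightarrow> \<exists>t\<in>carrier R. t \<otimes> s = \<one>"
    and "lex_bounded I xs n r"
  shows "\<exists>t\<in>carrier R. t \<otimes> (Y \<otimes> r) \<ominus> Y \<otimes> foldr (\<lambda>x. (\<otimes>) (x [^] n)) xs \<one> \<in> J"
  using assms
proof (induction xs arbitrary: I Y r)
  case Nil
  then have r: "r \<in> carrier R" "r \<notin> I" by auto
  then obtain t where t: "t \<in> carrier R" "t \<otimes> r = \<one>" using Nil.prems(7) by auto
  have "t \<otimes> (Y \<otimes> r) = Y \<otimes> (t \<otimes> r)" using t(1) r Nil.prems(4) by (simp add: m_ac)
  then have "t \<otimes> (Y \<otimes> r) \<ominus> Y \<otimes> \<one> = \<zero>" using t Nil.prems(4) by (simp add: a_minus_def r_neg)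
  then show ?case using t(1) ideal_closed(1)[OF Nil.prems(3)] by (intro bexI[of _ t]) simp_all
next
  case (Cons x xs)
  note Jc = ideal_closed[OF Cons.prems(3)] and Ic = ideal_closed[OF Cons.prems(1)]
  have x: "x \<in> carrier R" "set xs \<subseteq> carrier R" using Cons.prems by auto
  have Y: "Y \<in> carrier R" by fact
  obtain a s where a: "a \<le> n" "lex_bounded (adjoin I x) xs n s" "r \<ominus> x [^] a \<otimes> s \<in> I" and r: "r \<in> carrier R"
    using Cons.prems(8) by auto
  have s: "s \<in> carrier R" using lex_bounded_carrier[OF a(2)] .
  define \<pi> where "\<pi> = foldr (\<lambda>x. (\<otimes>) (x [^] n)) xs \<one>"
  have \<pi>: "\<pi> \<in> carrier R" unfolding \<pi>_def using x(2) by (induction xs) auto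
  define y where "y = x [^] n"
  have y: "y \<in> carrier R" using x by (simp add: y_def)
  \<comment> \<open>Passing from \<open>I\<close> to \<open>I + (x)\<close> keeps the invariant:
    \<open>Y x\<^sup>n\<close> sends the new generator to
    \<open>Y x\<^sup>n\<^sup>+\<^sup>1\<close>, which is in \<open>J\<close>.\<close>
  have yY: "(Y \<otimes> y) \<otimes> i \<in> J" if i: "i \<in> adjoin I x" for i
  proof -
    obtain j t where j: "j \<in> I" "t \<in> carrier R" "i = j \<oplus> t \<otimes> x"
      using i unfolding adjoin_def by blast
    have jc: "j \<in> carrier R" using Ic(2)[OF j(1)] .
    have "(Y \<otimes> y) \<otimes> i = y \<otimes> (Y \<otimes> j) \<oplus> (t \<otimes> Y) \<otimes> (y \<otimes> x)"
      unfolding j(3) using x Y y j(2) jc by algebra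
    moreover have "y \<otimes> x \<in> J" using Cons.prems(6)[of x] by (simp add: y_def)
    ultimately show ?thesis using Jc(3,5) Cons.prems(5)[OF j(1)] y Y j(2) by simp
  qed
  have "\<exists>t\<in>carrier R. t \<otimes> ((Y \<otimes> y) \<otimes> s) \<ominus> (Y \<otimes> y) \<otimes> \<pi> \<in> J"
    unfolding \<pi>_def using Cons.prems Y y yY a(2)
    by (intro Cons.IH[of "adjoin I x"]) (auto simp: adjoin_ideal)
  then obtain t where t: "t \<in> carrier R" "t \<otimes> ((Y \<otimes> y) \<otimes> s) \<ominus> (Y \<otimes> y) \<otimes> \<pi> \<in> J" by blast
  define z w where "z = x [^] (n - a)" and "w = x [^] a"
  have zw: "z \<in> carrier R" "w \<in> carrier R" "y = z \<otimes> w"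
    using x a(1) by (auto simp: z_def w_def y_def nat_pow_mult)
  have "(t \<otimes> z) \<otimes> (Y \<otimes> r) \<ominus> Y \<otimes> ((z \<otimes> w) \<otimes> \<pi>) =
      (t \<otimes> z) \<otimes> (Y \<otimes> (r \<ominus> w \<otimes> s)) \<oplus> (t \<otimes> ((Y \<otimes> (z \<otimes> w)) \<otimes> s) \<ominus> (Y \<otimes> (z \<otimes> w)) \<otimes> \<pi>)"
    using t(1) zw(1,2) Y r s \<pi> by algebra
  also have "\<dots> \<in> J"
    using Jc(3,5) Cons.prems(5)[OF a(3)] t zw(1,2) unfolding w_def[symmetric] zw(3) by simp
  finally have "(t \<otimes> z) \<otimes> (Y \<otimes> r) \<ominus> Y \<otimes> (y \<otimes> \<pi>) \<in> J" unfolding zw(3) .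
  then show ?case unfolding y_def \<pi>_def using t(1) zw(1) by (intro bexI[of _ "t \<otimes> z"]) auto
qed

section \<open>Additivity of the Frobenius endomorphism\<close>

lemma binomial_expansion:
  assumes a: "a \<in> carrier R" and b: "b \<in> carrier R"
  shows "(a \<oplus> b) [^] n = (\<Oplus>k\<in>{..n}. add_pow R (n choose k) (a [^] k \<otimes> b [^] (n - k)))"
proof (induction n)
  case 0
  show ?case by simp
next
  case (Suc n)
  let ?f = "\<lambda>k. add_pow R (n choose k) (a [^] k \<otimes> b [^] (n - k))"
  let ?g = "\<lambda>k. add_pow R (n choose k) (a [^] k \<otimes> b [^] (Suc n - k))"
  let ?h = "\<lambda>k. add_pow R (n choose k) (a [^] Suc k \<otimes> b [^] (n - k))"
  let ?t = "\<lambda>k. add_pow R (Suc n choose k) (a [^] k \<otimes> b [^] (Suc n - k))"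
  have fc: "?f \<in> {..n} \<rightarrow> carrier R" using a b by auto
  have "(a \<oplus> b) [^] Suc n = (\<Oplus>k\<in>{..n}. ?f k) \<otimes> a \<oplus> (\<Oplus>k\<in>{..n}. ?f k) \<otimes> b"
    using a b Suc by (simp add: r_distr finsum_closed[OF fc])
  also have "(\<Oplus>k\<in>{..n}. ?f k) \<otimes> a = (\<Oplus>k\<in>{..n}. ?h k)"
    using a b unfolding finsum_ldistr[OF finite_atMost a fc]
    by (intro finsum_cong') (auto simp: add_pow_ldistr add_pow_rdistr m_ac)
  also have "(\<Oplus>k\<in>{..n}. ?f k) \<otimes> b = (\<Oplus>k\<in>{..n}. ?g k)"
    using a b unfolding finsum_ldistr[OF finite_atMost b fc]
    by (intro finsum_cong') (auto simp: add_pow_ldistr add_pow_rdistr m_ac Suc_diff_le)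
  also have "\<dots> = (\<Oplus>k\<in>{..Suc n}. ?g k)"
    using a b by (simp add: finsum_Suc binomial_eq_0)
  also have "\<dots> = (\<Oplus>k\<in>{..n}. ?g (Suc k)) \<oplus> ?g 0"
    using a b by (subst finsum_Suc2) auto
  also have "(\<Oplus>k\<in>{..n}. ?h k) \<oplus> ((\<Oplus>k\<in>{..n}. ?g (Suc k)) \<oplus> ?g 0) = (\<Oplus>k\<in>{..n}. ?h k \<oplus> ?g (Suc k)) \<oplus> ?g 0"
    using a b by (subst finsum_addf) (auto simp: a_assoc)
  also have "\<dots> = (\<Oplus>k\<in>{..n}. ?t (Suc k)) \<oplus> ?t 0"
    using a b by (intro arg_cong2[of _ _ _ _ "(\<oplus>)"] finsum_cong') (auto simp: add.nat_pow_mult)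
  also have "\<dots> = (\<Oplus>k\<in>{..Suc n}. ?t k)"
    using a b by (subst finsum_Suc2) auto
  finally show ?case .
qed

lemma frobenius_add:
  assumes p: "Factorial_Ring.prime (p::nat)" "add_pow R p \<one> = \<zero>" and a: "a \<in> carrier R" and b: "b \<in> carrier R"
  shows "(a \<oplus> b) [^] (p ^ j) = a [^] (p ^ j) \<oplus> b [^] (p ^ j)"
proof (induction j)
  case (Suc j)
  have pz: "add_pow R (p * m) x = \<zero>" if "x \<in> carrier R" for m x
  proof -
    have "add_pow R (p * m) x = add_pow R p \<one> \<otimes> add_pow R m x"
      using that by (simp add: add_pow_ldistr add_pow_rdistr add.nat_pow_pow mult.commute)
    then show ?thesis using p that by simp
  qed
  have *: "(a \<oplus> b) [^] p = a [^] p \<oplus> b [^] p" if a: "a \<in> carrier R" and b: "b \<in> carrier R" for a b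
  proof -
    let ?f = "\<lambda>k. add_pow R (p choose k) (a [^] k \<otimes> b [^] (p - k))"
    obtain m where m: "p = Suc (Suc m)" using prime_ge_2_nat[OF p(1)] by (metis Suc_le_D numeral_2_eq_2 Suc_le_mono)
    have fz: "?f k = \<zero>" if "0 < k" "k < p" for k
    proof -
      have "p dvd (p choose k)" using dvd_choose_prime[of k p] that p(1) by simp
      then show ?thesis using pz a b by (auto elim!: dvdE)
    qed
    have z: "?f (Suc k) = \<zero>" if "k \<le> m" for k by (rule fz) (use that m in auto)
    have split: "(\<Oplus>k\<in>{..Suc (Suc m)}. F k) = F (Suc (Suc m)) \<oplus> ((\<Oplus>k\<in>{..m}. F (Suc k)) \<oplus> F 0)"
      if F: "F \<in> UNIV \<rightarrow> carrier R" for F :: "nat \<Rightarrow> 'a"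
    proof -
      have "F \<in> {..n} \<rightarrow> carrier R" for n using F by auto
      then show ?thesis using finsum_Suc[of F "Suc m"] finsum_Suc2[of F m] by (simp only:)
    qed
    have "(a \<oplus> b) [^] p = (\<Oplus>k\<in>{..Suc (Suc m)}. ?f k)"
      using binomial_expansion[OF a b, of p] m by simp
    also have "\<dots> = ?f (Suc (Suc m)) \<oplus> ((\<Oplus>k\<in>{..m}. ?f (Suc k)) \<oplus> ?f 0)"
      using split[of ?f] a b by auto
    also have "(\<Oplus>k\<in>{..m}. ?f (Suc k)) = \<zero>"
      by (rule add.finprod_one_eqI) (use z in blast)
    finally show ?thesis using a b m by simp
  qed
  have "x [^] (p ^ Suc j) = (x [^] (p ^ j)) [^] p" if "x \<in> carrier R" for x
    using that by (simp add: nat_pow_pow mult.commute)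
  then show ?case using Suc * a b by simp
qed (use a b in simp)

end

section \<open>Finite levels of the nonzero elements\<close>

context regular_system
begin

lemma Idl_empty: "Idl {} = {\<zero>}"
  using genideal_minimal[OF zeroideal, of "{}"] ideal_closed(1)[OF genideal_ideal[of "{}"]] by auto

lemma zero_prime: "primeideal {\<zero>} R"
  using prime_subset[of "{}"] Idl_empty by simp

lemma no_zero_divisors: "a \<in> carrier R \<Longrightarrow> b \<in> carrier R \<Longrightarrow> a \<otimes> b = \<zero> \<Longrightarrow> a = \<zero> \<or> b = \<zero>"
  using primeD(3)[OF zero_prime, of a b] by auto

lemma foldl_adjoin: "T \<subseteq> carrier R \<Longrightarrow> set xs \<subseteq> carrier R \<Longrightarrow> foldl adjoin (Idl T) xs = Idl (T \<union> set xs)"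
proof (induction xs arbitrary: T)
  case (Cons x xs)
  then show ?case using Idl_insert[of x T] Cons.IH[of "insert x T"] by simp
qed simp

text \<open>Krull's intersection theorem in \<open>R/(T)\<close> bounds the exponent of \<open>x\<close>.\<close>

lemma split_power:
  assumes T: "T \<subseteq> S" and x: "x \<in> S" "x \<notin> T" and r: "r \<in> carrier R" "r \<notin> Idl T"
  obtains a s where "s \<in> carrier R" "s \<notin> Idl (insert x T)" "r \<ominus> x [^] (a::nat) \<otimes> s \<in> Idl T"
proof (rule ccontr)
  note exists = that
  assume contra: "\<not> thesis"
  let ?I = "Idl T"
  have all: "s \<in> Idl (insert x T)" if "s \<in> carrier R" "r \<ominus> x [^] (a::nat) \<otimes> s \<in> ?I" for a s
    using contra that exists by blast
  have sub: "insert x T \<subseteq> carrier R" and xc: "x \<in> carrier R" using T x S_carrier by auto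
  have P: "primeideal ?I R" using prime_subset[OF T] .
  note I = primeD(1)[OF P]
  note c = ideal_closed[OF I]
  have step: "\<exists>s'. (s' \<in> carrier R \<and> r \<ominus> x [^] Suc n \<otimes> s' \<in> ?I) \<and> s \<ominus> x \<otimes> s' \<in> ?I"
    if s: "s \<in> carrier R \<and> r \<ominus> x [^] n \<otimes> s \<in> ?I" for s n
  proof -
    have "s \<in> adjoin ?I x" using all[of s n] s Idl_insert[OF sub] by simp
    then obtain i t where t: "i \<in> ?I" "t \<in> carrier R" "s = i \<oplus> t \<otimes> x" by (auto simp: adjoin_def)
    define y where "y = x [^] n"
    have y: "y \<in> carrier R" "x [^] Suc n = y \<otimes> x" using xc by (auto simp: y_def)
    have ic: "i \<in> carrier R" using c(2)[OF t(1)] .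
    have "s \<ominus> x \<otimes> t = i" unfolding t(3) using t(2) ic xc by algebra
    moreover have "r \<ominus> (y \<otimes> x) \<otimes> t = (r \<ominus> y \<otimes> s) \<oplus> y \<otimes> i"
      unfolding t(3) using t(2) ic xc y(1) r(1) by algebra
    ultimately show ?thesis using t c(3)[OF _ c(5)[OF t(1) y(1)]] s y unfolding y_def by auto
  qed
  \<comment> \<open>By \<open>contra\<close> every cofactor of a power of \<open>x\<close> is
    divisible by \<open>x\<close> modulo \<open>?I\<close>, so factors \<open>x\<close> can be split
    off for ever; \<open>f n\<close> is what is left after \<open>n\<close> of them.\<close>
  obtain f where f: "\<And>n. f n \<in> carrier R \<and> r \<ominus> x [^] n \<otimes> f n \<in> ?I" "\<And>n. f n \<ominus> x \<otimes> f (Suc n) \<in> ?I"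
  proof -
    have "\<exists>f. \<forall>n. (f n \<in> carrier R \<and> r \<ominus> x [^] n \<otimes> f n \<in> ?I) \<and> f n \<ominus> x \<otimes> f (Suc n) \<in> ?I"
    proof (rule dependent_nat_choice)
      show "\<exists>s. s \<in> carrier R \<and> r \<ominus> x [^] (0::nat) \<otimes> s \<in> ?I"
        using r c(1) by (intro exI[of _ r]) (simp add: a_minus_def r_neg)
    qed (use step in blast)
    then show ?thesis using that by blast
  qed
  have fc: "f n \<in> carrier R" for n using f(1) by blast
  have fs: "f n \<in> adjoin ?I (f (Suc n))" for n
  proof -
    have "f n = (f n \<ominus> x \<otimes> f (Suc n)) \<oplus> x \<otimes> f (Suc n)" using fc[of n] fc[of "Suc n"] xc by algebra
    then show ?thesis using adjoinI[OF f(2)[of n] xc, of "f (Suc n)"] by simp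
  qed
  obtain n where stable: "\<And>m. n \<le> m \<Longrightarrow> adjoin ?I (f m) = adjoin ?I (f n)"
  proof (rule ascending_stabilises[of "\<lambda>n. adjoin ?I (f n)"])
    show "adjoin ?I (f n) \<subseteq> adjoin ?I (f (Suc n))" for n
      using adjoin_least[OF adjoin_ideal[OF I fc]] adjoin_supset(1)[OF I fc] fs by blast
  qed (use adjoin_ideal[OF I fc] in blast)+
  \<comment> \<open>Modulo \<open>?I\<close> the element \<open>f n\<close> is \<open>x\<close>
    times \<open>f (Suc n)\<close>, so the ideals ascend. Once they are stationary,
    \<open>f (Suc n)\<close> is a multiple of \<open>x\<close> times itself modulo
    \<open>?I\<close>; as \<open>\<one> - t x\<close> is a unit, \<open>f (Suc n)\<close> and with
    it \<open>r\<close> lie in \<open>?I\<close>.\<close>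
  have "f (Suc n) \<in> adjoin ?I (f n)"
    using adjoin_supset(2)[OF I fc[of "Suc n"]] stable[OF le_SucI[OF order_refl]] by blast
  then obtain i t where t: "i \<in> ?I" "t \<in> carrier R" "f (Suc n) = i \<oplus> t \<otimes> f n" by (auto simp: adjoin_def)
  define j where "j = f n \<ominus> x \<otimes> f (Suc n)"
  have j: "j \<in> ?I" using f(2) by (simp add: j_def)
  note cc = c(2)[OF t(1)] c(2)[OF j] t(2) xc fc[of n] fc[of "Suc n"]
  have "f n = j \<oplus> x \<otimes> f (Suc n)" unfolding j_def using cc by algebra
  then have "f (Suc n) = i \<oplus> t \<otimes> (j \<oplus> x \<otimes> f (Suc n))" using t(3) by simp
  then have "(\<one> \<ominus> t \<otimes> x) \<otimes> f (Suc n) = (i \<oplus> t \<otimes> (j \<oplus> x \<otimes> f (Suc n))) \<ominus> t \<otimes> x \<otimes> f (Suc n)"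
    using cc by (simp add: l_distr minus_eq l_minus)
  also have "\<dots> = i \<oplus> t \<otimes> j" using cc by algebra
  also have "\<dots> \<in> ?I" using c(3)[OF t(1) c(5)[OF j t(2)]] .
  finally have *: "(\<one> \<ominus> t \<otimes> x) \<otimes> f (Suc n) \<in> ?I" .
  have "\<one> \<ominus> t \<otimes> x \<notin> \<mm>"
    using ideal_diff_imp[OF maximal_ideal one_closed ideal_closed(5)[OF maximal_ideal S_maximal[OF x(1)] t(2)]]
      primeD(2)[OF maximal_prime] by blast
  then have "f (Suc n) \<in> ?I"
    using saturatedD[OF saturated_at_maximal[OF I], of "\<one> \<ominus> t \<otimes> x"] * cc by simp
  then have "x [^] Suc n \<otimes> f (Suc n) \<in> ?I" using c(5)[OF _ nat_pow_closed[OF xc]] by blast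
  then show False using ideal_diff_imp[OF I r(1), of "x [^] Suc n \<otimes> f (Suc n)"] f(1)[of "Suc n"] r(2) by simp
qed

lemma lex_bounded_exists:
  assumes "T \<union> set xs \<subseteq> S" "T \<inter> set xs = {}" "distinct xs" "r \<in> carrier R" "r \<notin> Idl T"
  shows "\<exists>k. lex_bounded (Idl T) xs k r"
  using assms
proof (induction xs arbitrary: T r)
  case (Cons x xs)
  have x: "T \<subseteq> S" "x \<in> S" "x \<notin> T" using Cons.prems by auto
  obtain a s where s: "s \<in> carrier R" "s \<notin> Idl (insert x T)" "r \<ominus> x [^] (a::nat) \<otimes> s \<in> Idl T"
    using split_power[OF x Cons.prems(4,5)] .
  obtain k where "lex_bounded (Idl (insert x T)) xs k s" using Cons.IH[of "insert x T" s] Cons.prems s by auto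
  moreover have "Idl (insert x T) = adjoin (Idl T) x" using Idl_insert[of x T] x S_carrier by blast
  ultimately have "lex_bounded (adjoin (Idl T) x) xs (max a k) s"
    using lex_bounded_mono[of "adjoin (Idl T) x" xs k s "max a k"] by simp
  then show ?case using s Cons.prems by (intro exI[of _ "max a k"]) auto
qed auto

lemma foldr_finprod:
  "distinct xs \<Longrightarrow> set xs \<subseteq> carrier R \<Longrightarrow> foldr (\<lambda>x. (\<otimes>) (x [^] (n::nat))) xs \<one> = (\<Otimes>x\<in>set xs. x [^] n)"
proof (induction xs)
  case (Cons x xs)
  then show ?case by (subst list.set(2), subst finprod_insert) auto
qed simp

end

section \<open>The injective hull of the residue field\<close>

text \<open>A single-valued linear graph is a homomorphism on the ideal \<open>Domain G\<close>. It
  extends to \<open>R\<close>, where it is determined by the image \<open>w\<close> of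
  \<open>\<one>\<close>. Systems of linear equations in \<open>E\<close> are solved in this
  form.\<close>

lemma injective_module_graph:
  assumes inj: "injective_module R E"
    and car: "\<And>y e. (y, e) \<in> G \<Longrightarrow> y \<in> carrier R \<and> e \<in> carrier E"
    and zero: "(\<zero>\<^bsub>R\<^esub>, \<zero>\<^bsub>E\<^esub>) \<in> G"
    and add: "\<And>y e z f. (y, e) \<in> G \<Longrightarrow> (z, f) \<in> G \<Longrightarrow> (y \<oplus>\<^bsub>R\<^esub> z, e \<oplus>\<^bsub>E\<^esub> f) \<in> G"
    and smult: "\<And>y e r. (y, e) \<in> G \<Longrightarrow> r \<in> carrier R \<Longrightarrow> (r \<otimes>\<^bsub>R\<^esub> y, r \<odot>\<^bsub>E\<^esub> e) \<in> G"
    and single: "\<And>e. (\<zero>\<^bsub>R\<^esub>, e) \<in> G \<Longrightarrow> e = \<zero>\<^bsub>E\<^esub>"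
  obtains w where "w \<in> carrier E" "\<And>y e. (y, e) \<in> G \<Longrightarrow> e = y \<odot>\<^bsub>E\<^esub> w"
proof -
  interpret E: module R E using inj by (simp add: injective_module_def)
  let ?I = "Domain G"
  have I: "ideal ?I R"
  proof (rule E.R.cring_idealI)
    show "?I \<subseteq> carrier R" using car by auto
    show "\<zero>\<^bsub>R\<^esub> \<in> ?I" using zero by auto
    show "a \<oplus>\<^bsub>R\<^esub> b \<in> ?I" if "a \<in> ?I" "b \<in> ?I" for a b using that add by fast
    show "r \<otimes>\<^bsub>R\<^esub> a \<in> ?I" if "a \<in> ?I" "r \<in> carrier R" for a r using that smult by fast
  qed
  have uniq: "e = f" if e: "(y, e) \<in> G" and f: "(y, f) \<in> G" for y e f
  proof -
    have c: "y \<in> carrier R" "e \<in> carrier E" "f \<in> carrier E" using car[OF e] car[OF f] by auto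
    have m: "(\<ominus>\<^bsub>R\<^esub> \<one>\<^bsub>R\<^esub>) \<otimes>\<^bsub>R\<^esub> y = \<ominus>\<^bsub>R\<^esub> y" "(\<ominus>\<^bsub>R\<^esub> \<one>\<^bsub>R\<^esub>) \<odot>\<^bsub>E\<^esub> f = \<ominus>\<^bsub>E\<^esub> f"
      using c E.R.l_minus[of "\<one>\<^bsub>R\<^esub>" y] E.smult_l_minus[of "\<one>\<^bsub>R\<^esub>" f] by simp_all
    have "(y \<oplus>\<^bsub>R\<^esub> \<ominus>\<^bsub>R\<^esub> y, e \<oplus>\<^bsub>E\<^esub> \<ominus>\<^bsub>E\<^esub> f) \<in> G"
      using add[OF e smult[OF f, of "\<ominus>\<^bsub>R\<^esub> \<one>\<^bsub>R\<^esub>"]] m by simp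
    then have "e \<oplus>\<^bsub>E\<^esub> \<ominus>\<^bsub>E\<^esub> f = \<zero>\<^bsub>E\<^esub>" using single c by (simp add: E.R.r_neg)
    then show ?thesis using c by (metis E.minus_equality E.minus_minus E.a_inv_closed)
  qed
  define h where "h y = (THE e. (y, e) \<in> G)" for y
  have hI: "h y = e" if "(y, e) \<in> G" for y e unfolding h_def using that uniq by blast
  have h: "(y, h y) \<in> G" if "y \<in> ?I" for y using that hI by auto
  have Ic: "y \<in> carrier R" if "y \<in> ?I" for y using that car by auto
  have "h \<in> mod_hom R (scalar_module R ?I) E"
    unfolding mod_hom_def scalar_module_def
    by (auto intro!: hI simp: Pi_iff) (use h car in auto, (intro add smult h; auto)+)
  moreover have "(\<lambda>y. y) \<in> mod_hom R (scalar_module R ?I) (scalar_module R (carrier R))"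
    using Ic by (auto simp: mod_hom_def scalar_module_def)
  ultimately obtain g where g: "g \<in> mod_hom R (scalar_module R (carrier R)) E"
    and gh: "\<And>y. y \<in> ?I \<Longrightarrow> g y = h y"
    using injective_module_extend[OF inj scalar_module_module[OF E.R.is_cring I]
        scalar_module_module[OF E.R.is_cring E.R.oneideal]]
    by (fastforce simp: scalar_module_def)
  have "g y = y \<odot>\<^bsub>E\<^esub> g \<one>\<^bsub>R\<^esub>" if "y \<in> carrier R" for y
    using mod_homD(3)[OF g that, of "\<one>\<^bsub>R\<^esub>"] that by (simp add: scalar_module_def)
  moreover have "g \<one>\<^bsub>R\<^esub> \<in> carrier E" using mod_homD(1)[OF g] by (simp add: scalar_module_def)
  ultimately show ?thesis using that[of "g \<one>\<^bsub>R\<^esub>"] gh hI Ic by (metis Domain.DomainI)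
qed

lemma injective_module_hom_at:
  assumes inj: "injective_module R E" and B: "module R B" and x: "x \<in> carrier B" and e: "e \<in> carrier E"
    and ann: "\<And>r. r \<in> carrier R \<Longrightarrow> r \<odot>\<^bsub>B\<^esub> x = \<zero>\<^bsub>B\<^esub> \<Longrightarrow> r \<odot>\<^bsub>E\<^esub> e = \<zero>\<^bsub>E\<^esub>"
  obtains g where "g \<in> mod_hom R B E" "g x = e"
proof -
  interpret E: module R E using inj by (simp add: injective_module_def)
  interpret B: module R B by fact
  let ?H = "(\<lambda>r. r \<odot>\<^bsub>B\<^esub> x) ` carrier R"
  let ?A = "B\<lparr>carrier := ?H\<rparr>"
  have "submodule ?H R B"
  proof (rule B.submoduleI)
    show "?H \<subseteq> carrier B" using x by auto
    show "\<zero>\<^bsub>B\<^esub> \<in> ?H" using x by (intro image_eqI[of _ _ "\<zero>\<^bsub>R\<^esub>"]) auto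
    show "\<ominus>\<^bsub>B\<^esub> a \<in> ?H" if "a \<in> ?H" for a
      using that x by (auto simp flip: B.smult_l_minus)
    show "a \<oplus>\<^bsub>B\<^esub> b \<in> ?H" if "a \<in> ?H" "b \<in> ?H" for a b
      using that x by (auto simp flip: B.smult_l_distr)
    show "r \<odot>\<^bsub>B\<^esub> a \<in> ?H" if "r \<in> carrier R" "a \<in> ?H" for r a
      using that x by (auto simp flip: B.smult_assoc1)
  qed
  then have A: "module R ?A" using submodule.submodule_is_module[OF _ B] by blast
  have eq: "r \<odot>\<^bsub>E\<^esub> e = s \<odot>\<^bsub>E\<^esub> e" if "r \<in> carrier R" "s \<in> carrier R" "r \<odot>\<^bsub>B\<^esub> x = s \<odot>\<^bsub>B\<^esub> x" for r s
  proof -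
    have "(r \<ominus>\<^bsub>R\<^esub> s) \<odot>\<^bsub>B\<^esub> x = \<zero>\<^bsub>B\<^esub>"
      using that x by (simp add: E.R.minus_eq B.smult_l_distr B.smult_l_minus B.r_neg)
    then have "(r \<ominus>\<^bsub>R\<^esub> s) \<odot>\<^bsub>E\<^esub> e = \<zero>\<^bsub>E\<^esub>" using ann that by simp
    then have "r \<odot>\<^bsub>E\<^esub> e \<oplus>\<^bsub>E\<^esub> \<ominus>\<^bsub>E\<^esub> (s \<odot>\<^bsub>E\<^esub> e) = \<zero>\<^bsub>E\<^esub>"
      using that e by (simp add: E.R.minus_eq E.smult_l_distr E.smult_l_minus)
    then show ?thesis using that e by (metis E.minus_equality E.minus_minus E.a_inv_closed E.smult_closed)
  qed
  define f where "f y = (SOME r. r \<in> carrier R \<and> y = r \<odot>\<^bsub>B\<^esub> x) \<odot>\<^bsub>E\<^esub> e" for y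
  have f: "f (r \<odot>\<^bsub>B\<^esub> x) = r \<odot>\<^bsub>E\<^esub> e" if "r \<in> carrier R" for r
    unfolding f_def
    using someI[of "\<lambda>s. s \<in> carrier R \<and> r \<odot>\<^bsub>B\<^esub> x = s \<odot>\<^bsub>B\<^esub> x" r] that by (intro eq) auto
  have "f \<in> mod_hom R ?A E"
    unfolding mod_hom_def
    using x e by (auto simp: f E.smult_assoc1 E.smult_l_distr simp flip: B.smult_l_distr B.smult_assoc1)
  moreover have "(\<lambda>y. y) \<in> mod_hom R ?A B" using x by (auto simp: mod_hom_def)
  ultimately obtain g where g: "g \<in> mod_hom R B E" "\<forall>y\<in>?H. g y = f y"
    using injective_module_extend[OF inj A B, of "\<lambda>y. y" f] by auto
  have "g (\<one>\<^bsub>R\<^esub> \<odot>\<^bsub>B\<^esub> x) = f (\<one>\<^bsub>R\<^esub> \<odot>\<^bsub>B\<^esub> x)" using g(2) E.R.one_closed by blast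
  then have "g x = e" using x e f[OF E.R.one_closed] by simp
  then show ?thesis using that g by blast
qed

text \<open>The embedding of \<open>R/\<mm>\<close> into \<open>E\<close> is recorded by the image \<open>e0\<close> of \<open>1\<close>.\<close>

locale residue_hull = regular_system R \<mm> S for R :: "('a, 'r) ring_scheme" (structure) and \<mm> S +
  fixes E :: "('a, 'e) module" and e0 :: 'e and p :: nat
  assumes injective: "injective_module R E"
    and e0: "e0 \<in> carrier E"
    and e0_annihilator: "r \<in> carrier R \<Longrightarrow> r \<odot>\<^bsub>E\<^esub> e0 = \<zero>\<^bsub>E\<^esub> \<longleftrightarrow> r \<in> \<mm>"
    and essential: "f \<in> carrier E \<Longrightarrow> f \<noteq> \<zero>\<^bsub>E\<^esub> \<Longrightarrow>
      \<exists>r\<in>carrier R. r \<odot>\<^bsub>E\<^esub> f \<noteq> \<zero>\<^bsub>E\<^esub> \<and> (\<forall>y\<in>\<mm>. y \<odot>\<^bsub>E\<^esub> (r \<odot>\<^bsub>E\<^esub> f) = \<zero>\<^bsub>E\<^esub>)"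
    and prime_p: "Factorial_Ring.prime p" and char_p: "add_pow R p \<one> = \<zero>"

sublocale residue_hull \<subseteq> E: module R E
  using injective by (simp add: injective_module_def)

section \<open>Elements of E of prescribed depth\<close>

context residue_hull
begin

lemma maximal_carrier: "y \<in> \<mm> \<Longrightarrow> y \<in> carrier R"
  using ideal_closed(2)[OF maximal_ideal] .

text \<open>The annihilators of the elements \<open>y\<^sup>n e\<close> become stationary. A nonzero
  \<open>y\<^sup>n e\<close> would have a nonzero multiple by some \<open>r\<close> that
  \<open>y\<close> kills; this \<open>r\<close> lies in the next annihilator but not in the present
  one.\<close>

lemma maximal_torsion:
  assumes e: "e \<in> carrier E" and y: "y \<in> \<mm>"
  shows "\<exists>n::nat. y [^] n \<odot>\<^bsub>E\<^esub> e = \<zero>\<^bsub>E\<^esub>"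
proof -
  have yc: "y \<in> carrier R" using maximal_carrier[OF y] .
  let ?I = "\<lambda>n::nat. {r \<in> carrier R. r \<odot>\<^bsub>E\<^esub> (y [^] n \<odot>\<^bsub>E\<^esub> e) \<in> {\<zero>\<^bsub>E\<^esub>}}"
  have zs: "submodule {\<zero>\<^bsub>E\<^esub>} R E" by (intro E.submoduleI) auto
  have shift: "y [^] Suc n \<odot>\<^bsub>E\<^esub> e = y \<odot>\<^bsub>E\<^esub> (y [^] n \<odot>\<^bsub>E\<^esub> e)" for n
    using yc e by (simp add: m_comm E.smult_assoc1)
  obtain n where n: "\<And>m. n \<le> m \<Longrightarrow> ?I m = ?I n"
  proof (rule ascending_stabilises[of ?I])
    show "ideal (?I n) R" for n using E.submodule_colon_ideal[OF zs] yc e by simp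
    show "?I n \<subseteq> ?I (Suc n)" for n
    proof
      fix r assume r: "r \<in> ?I n"
      then have rc: "r \<in> carrier R" by simp
      have "r \<odot>\<^bsub>E\<^esub> (y [^] Suc n \<odot>\<^bsub>E\<^esub> e) = y \<odot>\<^bsub>E\<^esub> (r \<odot>\<^bsub>E\<^esub> (y [^] n \<odot>\<^bsub>E\<^esub> e))"
        unfolding shift using rc yc e by (simp add: m_ac flip: E.smult_assoc1)
      also have "\<dots> = \<zero>\<^bsub>E\<^esub>" using r yc by simp
      finally show "r \<in> ?I (Suc n)" using r by (intro CollectI conjI singletonI) auto
    qed
  qed blast
  let ?f = "y [^] n \<odot>\<^bsub>E\<^esub> e"
  have "?f = \<zero>\<^bsub>E\<^esub>"
  proof (rule ccontr)
    assume "?f \<noteq> \<zero>\<^bsub>E\<^esub>"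
    then obtain r where r: "r \<in> carrier R" "r \<odot>\<^bsub>E\<^esub> ?f \<noteq> \<zero>\<^bsub>E\<^esub>" "y \<odot>\<^bsub>E\<^esub> (r \<odot>\<^bsub>E\<^esub> ?f) = \<zero>\<^bsub>E\<^esub>"
      using essential[of ?f] yc e y by auto
    have "r \<odot>\<^bsub>E\<^esub> (y [^] Suc n \<odot>\<^bsub>E\<^esub> e) = y \<odot>\<^bsub>E\<^esub> (r \<odot>\<^bsub>E\<^esub> ?f)"
      unfolding shift using r(1) yc e by (simp add: m_ac flip: E.smult_assoc1)
    also have "\<dots> = \<zero>\<^bsub>E\<^esub>" by (rule r(3))
    finally have "r \<in> ?I (Suc n)" using r(1) by blast
    then have "r \<in> ?I n" using n[OF le_SucI[OF order_refl]] by blast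
    then show False using r(2) by simp
  qed
  then show ?thesis by blast
qed

text \<open>\<open>w\<close> solves \<open>J w = 0\<close> and \<open>\<pi> w = e0\<close>, where
  \<open>J\<close> is generated by the \<open>s [^] Suc n\<close> and \<open>\<pi>\<close> is the
  monomial. The system is consistent because \<open>r \<pi> \<in> J\<close> forces
  \<open>r \<in> \<mm>\<close>. By \<open>lex_bounded_deep\<close> an \<open>r\<close> of level at
  most \<open>n\<close> has a multiple congruent to \<open>\<pi>\<close> modulo \<open>J\<close>,
  and this multiple takes \<open>w\<close> to \<open>e0\<close>.\<close>

lemma deep_element:
  assumes xs: "distinct xs" "set xs = S"
  obtains w where "w \<in> carrier E" "\<And>s. s \<in> S \<Longrightarrow> s [^] Suc n \<odot>\<^bsub>E\<^esub> w = \<zero>\<^bsub>E\<^esub>"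
    "\<And>r. lex_bounded {\<zero>} xs n r \<Longrightarrow> r \<odot>\<^bsub>E\<^esub> w \<noteq> \<zero>\<^bsub>E\<^esub>"
proof -
  define J where "J = power_ideal (\<lambda>_. Suc n) S"
  define \<pi> where "\<pi> = (\<Otimes>u\<in>S. u [^] n)"
  have J: "ideal J R" unfolding J_def using power_ideal_ideal[OF S_carrier] .
  note Jc = ideal_closed[OF J]
  have \<pi>: "\<pi> \<in> carrier R" unfolding \<pi>_def using S_carrier by (intro finprod_closed) auto
  have XJ: "\<pi> \<notin> J" unfolding \<pi>_def J_def by (rule monomial_notin)
  define G where "G = {(j \<oplus> r \<otimes> \<pi>, r \<odot>\<^bsub>E\<^esub> e0) | j r. j \<in> J \<and> r \<in> carrier R}"
  have GI: "(j \<oplus> r \<otimes> \<pi>, r \<odot>\<^bsub>E\<^esub> e0) \<in> G" if "j \<in> J" "r \<in> carrier R" for j r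
    using that by (auto simp: G_def)
  obtain w where w: "w \<in> carrier E" "\<And>y e. (y, e) \<in> G \<Longrightarrow> e = y \<odot>\<^bsub>E\<^esub> w"
  proof (rule injective_module_graph[OF injective, of G])
    show "y \<in> carrier R \<and> e \<in> carrier E" if "(y, e) \<in> G" for y e
      using that Jc(2) \<pi> e0 by (auto simp: G_def)
    show "(\<zero>, \<zero>\<^bsub>E\<^esub>) \<in> G" using GI[OF Jc(1), of \<zero>] \<pi> e0 by simp
    fix y e assume "(y, e) \<in> G"
    then obtain j r where 1: "j \<in> J" "r \<in> carrier R" "y = j \<oplus> r \<otimes> \<pi>" "e = r \<odot>\<^bsub>E\<^esub> e0" by (auto simp: G_def)
    { fix z f assume "(z, f) \<in> G"
      then obtain i s where 2: "i \<in> J" "s \<in> carrier R" "z = i \<oplus> s \<otimes> \<pi>" "f = s \<odot>\<^bsub>E\<^esub> e0" by (auto simp: G_def)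
      have "y \<oplus> z = (j \<oplus> i) \<oplus> (r \<oplus> s) \<otimes> \<pi>"
        unfolding 1(3) 2(3) using 1(2) 2(2) \<pi> Jc(2)[OF 1(1)] Jc(2)[OF 2(1)] by algebra
      then show "(y \<oplus> z, e \<oplus>\<^bsub>E\<^esub> f) \<in> G"
        using GI[OF Jc(3)[OF 1(1) 2(1)], of "r \<oplus> s"] 1 2 e0 by (simp add: E.smult_l_distr) }
    fix s assume s: "s \<in> carrier R"
    have "s \<otimes> y = s \<otimes> j \<oplus> (s \<otimes> r) \<otimes> \<pi>"
      unfolding 1(3) using 1(2) s \<pi> Jc(2)[OF 1(1)] by algebra
    then show "(s \<otimes> y, s \<odot>\<^bsub>E\<^esub> e) \<in> G"
      using GI[OF Jc(5)[OF 1(1) s], of "s \<otimes> r"] 1 s e0 by (simp add: E.smult_assoc1)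
  next
    fix e assume "(\<zero>, e) \<in> G"
    then obtain j r where 1: "j \<in> J" "r \<in> carrier R" "\<zero> = j \<oplus> r \<otimes> \<pi>" "e = r \<odot>\<^bsub>E\<^esub> e0" by (auto simp: G_def)
    have "r \<otimes> \<pi> = \<zero> \<ominus> j" unfolding 1(3) using 1(2) \<pi> Jc(2)[OF 1(1)] by algebra
    then have "r \<otimes> \<pi> \<in> J" using Jc(4)[OF Jc(1) 1(1)] by simp
    then have "r \<in> \<mm>" using saturatedD[OF saturated_at_maximal[OF J] 1(2) _ \<pi>] XJ by blast
    then show "e = \<zero>\<^bsub>E\<^esub>" using e0_annihilator[OF 1(2)] 1(4) by simp
  qed blast
  have Jw: "j \<odot>\<^bsub>E\<^esub> w = \<zero>\<^bsub>E\<^esub>" if j: "j \<in> J" for j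
    using w(2)[OF GI[OF j zero_closed]] Jc(2)[OF j] \<pi> e0 by simp
  have Xw: "\<pi> \<odot>\<^bsub>E\<^esub> w = e0" using w(2)[OF GI[OF Jc(1) one_closed]] \<pi> e0 by simp
  have sJ: "s [^] Suc n \<in> J" if "s \<in> S" for s
    using that genideal_self[of "(\<lambda>s. s [^] Suc n) ` S"] S_carrier unfolding J_def power_ideal_def by auto
  have "r \<odot>\<^bsub>E\<^esub> w \<noteq> \<zero>\<^bsub>E\<^esub>" if r: "lex_bounded {\<zero>} xs n r" for r
  proof
    assume rw: "r \<odot>\<^bsub>E\<^esub> w = \<zero>\<^bsub>E\<^esub>"
    have rc: "r \<in> carrier R" using lex_bounded_carrier[OF r] .
    have fold: "foldl adjoin {\<zero>} xs = \<mm>"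
      using foldl_adjoin[of "{}" xs] xs S_carrier S_gen Idl_empty by simp
    have "\<exists>t\<in>carrier R. t \<otimes> (\<one> \<otimes> r) \<ominus> \<one> \<otimes> foldr (\<lambda>x. (\<otimes>) (x [^] n)) xs \<one> \<in> J"
      using xs S_carrier sJ unit Jc(1)
      by (intro lex_bounded_deep[OF zeroideal _ J one_closed _ _ _ r]) (auto simp: fold)
    then obtain t where t: "t \<in> carrier R" "t \<otimes> r \<ominus> \<pi> \<in> J"
      using foldr_finprod[OF xs(1), of n] xs(2) S_carrier rc \<pi> by (auto simp: \<pi>_def)
    have "t \<odot>\<^bsub>E\<^esub> (r \<odot>\<^bsub>E\<^esub> w) = (t \<otimes> r \<ominus> \<pi> \<oplus> \<pi>) \<odot>\<^bsub>E\<^esub> w"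
      using t(1) rc \<pi> w(1) by (simp add: E.smult_assoc1 minus_eq a_assoc l_neg)
    also have "\<dots> = e0" using Jw[OF t(2)] Xw Jc(2)[OF t(2)] \<pi> w(1) e0 by (simp add: E.smult_l_distr)
    finally have "e0 = \<zero>\<^bsub>E\<^esub>" using rw t(1) by simp
    then show False using e0_annihilator[OF one_closed] primeD(2)[OF maximal_prime] e0 by simp
  qed
  then show ?thesis using that[OF w(1)] Jw sJ by blast
qed

lemma maximal_minimal: "ideal I R \<Longrightarrow> S \<subseteq> I \<Longrightarrow> \<mm> \<subseteq> I"
  using genideal_minimal[of I S] S_gen by simp

text \<open>The graph of an additive partial map \<open>\<Phi>\<close> on \<open>E\<close> with \<open>\<Phi> (r e) = r\<^sup>q \<Phi> e\<close>.\<close>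

definition frobenius_graph :: "nat \<Rightarrow> ('e \<times> 'e) set \<Rightarrow> bool" where
  "frobenius_graph q G \<longleftrightarrow> G \<subseteq> carrier E \<times> carrier E \<and> (\<zero>\<^bsub>E\<^esub>, \<zero>\<^bsub>E\<^esub>) \<in> G \<and>
     (\<forall>e d e' d'. (e, d) \<in> G \<longrightarrow> (e', d') \<in> G \<longrightarrow> (e \<oplus>\<^bsub>E\<^esub> e', d \<oplus>\<^bsub>E\<^esub> d') \<in> G) \<and>
     (\<forall>r\<in>carrier R. \<forall>e d. (e, d) \<in> G \<longrightarrow> (r \<odot>\<^bsub>E\<^esub> e, r [^] q \<odot>\<^bsub>E\<^esub> d) \<in> G) \<and>
     (\<forall>d. (\<zero>\<^bsub>E\<^esub>, d) \<in> G \<longrightarrow> d = \<zero>\<^bsub>E\<^esub>)"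

lemma frobenius_graphD:
  assumes "frobenius_graph q G"
  shows "(e, d) \<in> G \<Longrightarrow> e \<in> carrier E" "(e, d) \<in> G \<Longrightarrow> d \<in> carrier E" "(\<zero>\<^bsub>E\<^esub>, \<zero>\<^bsub>E\<^esub>) \<in> G"
    "(e, d) \<in> G \<Longrightarrow> (e', d') \<in> G \<Longrightarrow> (e \<oplus>\<^bsub>E\<^esub> e', d \<oplus>\<^bsub>E\<^esub> d') \<in> G"
    "r \<in> carrier R \<Longrightarrow> (e, d) \<in> G \<Longrightarrow> (r \<odot>\<^bsub>E\<^esub> e, r [^] q \<odot>\<^bsub>E\<^esub> d) \<in> G"
    "(\<zero>\<^bsub>E\<^esub>, d) \<in> G \<Longrightarrow> d = \<zero>\<^bsub>E\<^esub>"
  using assms unfolding frobenius_graph_def by blast+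

section \<open>Semilinear maps on E\<close>

context
  fixes q j :: nat
  assumes q: "q = p ^ j"
begin

lemma q_pos: "0 < q"
  using prime_gt_0_nat[OF prime_p] by (simp add: q)

lemma pow_q_add: "a \<in> carrier R \<Longrightarrow> b \<in> carrier R \<Longrightarrow> (a \<oplus> b) [^] q = a [^] q \<oplus> b [^] q"
  unfolding q using frobenius_add[OF prime_p char_p] .

lemma zero_pow_q: "\<zero> [^] q = \<zero>"
  using q_pos by (simp add: nat_pow_zero)

lemma minus_one_pow_q: "(\<ominus> \<one>) [^] q = \<ominus> \<one>"
proof -
  have "\<one> \<oplus> (\<ominus> \<one>) [^] q = \<zero>"
    using pow_q_add[of \<one> "\<ominus> \<one>"] zero_pow_q by (simp add: r_neg)
  then show ?thesis by (metis add.inv_closed minus_equality minus_minus nat_pow_closed one_closed a_comm)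
qed

lemma minus_one_smult: "e \<in> carrier E \<Longrightarrow> (\<ominus> \<one>) \<odot>\<^bsub>E\<^esub> e = \<ominus>\<^bsub>E\<^esub> e"
  using E.smult_l_minus[of \<one> e] by simp

lemma frobenius_graph_neg:
  assumes "frobenius_graph q G" "(e, d) \<in> G"
  shows "(\<ominus>\<^bsub>E\<^esub> e, \<ominus>\<^bsub>E\<^esub> d) \<in> G"
  using frobenius_graphD(5)[OF assms(1) _ assms(2), of "\<ominus> \<one>"] frobenius_graphD(1,2)[OF assms]
  by (simp add: minus_one_pow_q minus_one_smult)

lemma frobenius_graph_unique:
  assumes G: "frobenius_graph q G" and e: "(e, d) \<in> G" "(e, d') \<in> G"
  shows "d = d'"
proof -
  have c: "e \<in> carrier E" "d \<in> carrier E" "d' \<in> carrier E" using frobenius_graphD(1,2)[OF G] e by auto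
  have "(e \<oplus>\<^bsub>E\<^esub> \<ominus>\<^bsub>E\<^esub> e, d \<oplus>\<^bsub>E\<^esub> \<ominus>\<^bsub>E\<^esub> d') \<in> G"
    using frobenius_graphD(4)[OF G e(1) frobenius_graph_neg[OF G e(2)]] .
  then have "d \<oplus>\<^bsub>E\<^esub> \<ominus>\<^bsub>E\<^esub> d' = \<zero>\<^bsub>E\<^esub>" using frobenius_graphD(6)[OF G] c by (simp add: E.r_neg)
  then show ?thesis using c by (metis E.minus_equality E.minus_minus E.a_inv_closed)
qed

text \<open>Lets a condition be checked on \<open>S\<close> and carried over to \<open>\<mm>\<close>
  by \<open>maximal_minimal\<close>. Closure under sums is the additivity of the \<open>q\<close>-th
  power.\<close>

lemma frobenius_graph_ideal:
  assumes G: "frobenius_graph q G" and e: "e \<in> carrier E" and f: "f \<in> carrier E"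
  shows "ideal {r \<in> carrier R. (r \<odot>\<^bsub>E\<^esub> e, r [^] q \<odot>\<^bsub>E\<^esub> f) \<in> G} R"
proof (rule cring_idealI)
  note D = frobenius_graphD[OF G]
  show "\<zero> \<in> {r \<in> carrier R. (r \<odot>\<^bsub>E\<^esub> e, r [^] q \<odot>\<^bsub>E\<^esub> f) \<in> G}" using D(3) e f by (simp add: zero_pow_q)
  fix a assume a: "a \<in> {r \<in> carrier R. (r \<odot>\<^bsub>E\<^esub> e, r [^] q \<odot>\<^bsub>E\<^esub> f) \<in> G}"
  { fix b assume b: "b \<in> {r \<in> carrier R. (r \<odot>\<^bsub>E\<^esub> e, r [^] q \<odot>\<^bsub>E\<^esub> f) \<in> G}"
    then show "a \<oplus> b \<in> {r \<in> carrier R. (r \<odot>\<^bsub>E\<^esub> e, r [^] q \<odot>\<^bsub>E\<^esub> f) \<in> G}"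
      using a D(4)[of "a \<odot>\<^bsub>E\<^esub> e" "a [^] q \<odot>\<^bsub>E\<^esub> f" "b \<odot>\<^bsub>E\<^esub> e" "b [^] q \<odot>\<^bsub>E\<^esub> f"] e f
      by (simp add: pow_q_add E.smult_l_distr) }
  fix r assume "r \<in> carrier R"
  then show "r \<otimes> a \<in> {r \<in> carrier R. (r \<odot>\<^bsub>E\<^esub> e, r [^] q \<odot>\<^bsub>E\<^esub> f) \<in> G}"
    using a D(5)[of r "a \<odot>\<^bsub>E\<^esub> e" "a [^] q \<odot>\<^bsub>E\<^esub> f"] e f
    by (simp add: nat_pow_distrib E.smult_assoc1)
qed auto

text \<open>The Koszul relations are what makes \<open>\<Sum>r\<^sub>s s\<^sup>q \<mapsto> \<Sum>r\<^sub>s \<Phi> (s b)\<close> well defined; they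
  replace the flatness of the Frobenius endomorphism of \<open>R\<close>.\<close>

lemma frobenius_graph_extend:
  assumes G: "frobenius_graph q G" and b: "b \<in> carrier E" "b \<notin> Domain G"
    and mb: "\<And>r. r \<in> \<mm> \<Longrightarrow> r \<odot>\<^bsub>E\<^esub> b \<in> Domain G"
  obtains G' where "frobenius_graph q G'" "G \<subset> G'"
proof -
  note D = frobenius_graphD[OF G]
  have Sm: "s \<in> \<mm>" "s \<in> carrier R" if "s \<in> S" for s using that S_maximal maximal_carrier by auto
  have "\<forall>s\<in>S. \<exists>d. (s \<odot>\<^bsub>E\<^esub> b, d) \<in> G" using mb Sm by blast
  then obtain v where v: "\<And>s. s \<in> S \<Longrightarrow> (s \<odot>\<^bsub>E\<^esub> b, v s) \<in> G" by metis
  have vc: "v ` S \<subseteq> carrier E" using D(2) v by blast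
  \<comment> \<open>Both sides are the value of the partial map at \<open>t s b\<close>; these are
    the Koszul relations.\<close>
  have comm: "t [^] q \<odot>\<^bsub>E\<^esub> v s = s [^] q \<odot>\<^bsub>E\<^esub> v t" if "s \<in> S" "t \<in> S" for s t
  proof (rule frobenius_graph_unique[OF G])
    show "(t \<odot>\<^bsub>E\<^esub> (s \<odot>\<^bsub>E\<^esub> b), t [^] q \<odot>\<^bsub>E\<^esub> v s) \<in> G" using D(5) v that Sm by blast
    have "t \<odot>\<^bsub>E\<^esub> (s \<odot>\<^bsub>E\<^esub> b) = s \<odot>\<^bsub>E\<^esub> (t \<odot>\<^bsub>E\<^esub> b)"
      using that Sm b by (simp add: m_comm flip: E.smult_assoc1)
    then show "(t \<odot>\<^bsub>E\<^esub> (s \<odot>\<^bsub>E\<^esub> b), s [^] q \<odot>\<^bsub>E\<^esub> v t) \<in> G" using D(5) v that Sm by metis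
  qed
  \<comment> \<open>\<open>f\<close> will be the value at \<open>b\<close>. Semilinearity prescribes
    \<open>s\<^sup>q f\<close> for each \<open>s \<in> S\<close>, and injectivity of
    \<open>E\<close> solves these equations.\<close>
  obtain f where f: "f \<in> carrier E" "\<And>y e. (y, e) \<in> combination_graph R E q v S \<Longrightarrow> e = y \<odot>\<^bsub>E\<^esub> f"
  proof (rule injective_module_graph[OF injective, of "combination_graph R E q v S"])
    show "e = \<zero>\<^bsub>E\<^esub>" if "(\<zero>, e) \<in> combination_graph R E q v S" for e
      using combination_graph_single_valued[OF E.module_axioms subset_refl q_pos vc comm that] .
  qed (use E.combination_graph_carrier[OF _ S_carrier vc] in \<open>auto intro: combination_graph.intros\<close>)
  have fs: "s [^] q \<odot>\<^bsub>E\<^esub> f = v s" if "s \<in> S" for s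
    using f(2)[OF combination_graph.gen[OF that]] by simp
  have mG: "(r \<odot>\<^bsub>E\<^esub> b, r [^] q \<odot>\<^bsub>E\<^esub> f) \<in> G" if "r \<in> \<mm>" for r
  proof -
    have "S \<subseteq> {r \<in> carrier R. (r \<odot>\<^bsub>E\<^esub> b, r [^] q \<odot>\<^bsub>E\<^esub> f) \<in> G}"
      using v fs Sm(2) by force
    then show ?thesis using maximal_minimal[OF frobenius_graph_ideal[OF G b(1) f(1)]] that by blast
  qed
  define G' where "G' = {(n \<oplus>\<^bsub>E\<^esub> r \<odot>\<^bsub>E\<^esub> b, d \<oplus>\<^bsub>E\<^esub> r [^] q \<odot>\<^bsub>E\<^esub> f) | n d r. (n, d) \<in> G \<and> r \<in> carrier R}"
  have G'I: "(n \<oplus>\<^bsub>E\<^esub> r \<odot>\<^bsub>E\<^esub> b, d \<oplus>\<^bsub>E\<^esub> r [^] q \<odot>\<^bsub>E\<^esub> f) \<in> G'" if "(n, d) \<in> G" "r \<in> carrier R" for n d r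
    using that by (auto simp: G'_def)
  have sub: "G \<subseteq> G'"
  proof (clarify)
    fix n d assume nd: "(n, d) \<in> G"
    show "(n, d) \<in> G'" using G'I[OF nd zero_closed] D(1,2)[OF nd] b f by (simp add: zero_pow_q)
  qed
  have "(b, f) \<in> G'" using G'I[OF D(3) one_closed] b f by simp
  then have "G \<subset> G'" using sub b(2) by blast
  moreover have "frobenius_graph q G'"
    unfolding frobenius_graph_def
  proof (intro conjI allI impI ballI)
    show "G' \<subseteq> carrier E \<times> carrier E" using D(1,2) b f by (auto simp: G'_def)
    show "(\<zero>\<^bsub>E\<^esub>, \<zero>\<^bsub>E\<^esub>) \<in> G'" using sub D(3) by blast
  next
    fix e d e' d' assume "(e, d) \<in> G'" "(e', d') \<in> G'"
    then obtain n c r n' c' r' where 1: "(n, c) \<in> G" "r \<in> carrier R" "e = n \<oplus>\<^bsub>E\<^esub> r \<odot>\<^bsub>E\<^esub> b" "d = c \<oplus>\<^bsub>E\<^esub> r [^] q \<odot>\<^bsub>E\<^esub> f"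
      and 2: "(n', c') \<in> G" "r' \<in> carrier R" "e' = n' \<oplus>\<^bsub>E\<^esub> r' \<odot>\<^bsub>E\<^esub> b" "d' = c' \<oplus>\<^bsub>E\<^esub> r' [^] q \<odot>\<^bsub>E\<^esub> f"
      unfolding G'_def by blast
    then show "(e \<oplus>\<^bsub>E\<^esub> e', d \<oplus>\<^bsub>E\<^esub> d') \<in> G'"
      using G'I[OF D(4)[OF 1(1) 2(1)], of "r \<oplus> r'"] D(1,2)[OF 1(1)] D(1,2)[OF 2(1)] b f
      by (simp add: pow_q_add E.smult_l_distr E.a_ac)
  next
    fix s e d assume s: "s \<in> carrier R" and "(e, d) \<in> G'"
    then obtain n c r where 1: "(n, c) \<in> G" "r \<in> carrier R" "e = n \<oplus>\<^bsub>E\<^esub> r \<odot>\<^bsub>E\<^esub> b" "d = c \<oplus>\<^bsub>E\<^esub> r [^] q \<odot>\<^bsub>E\<^esub> f"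
      unfolding G'_def by blast
    then show "(s \<odot>\<^bsub>E\<^esub> e, s [^] q \<odot>\<^bsub>E\<^esub> d) \<in> G'"
      using G'I[OF D(5)[OF s 1(1)], of "s \<otimes> r"] D(1,2)[OF 1(1)] b f s
      by (simp add: nat_pow_distrib E.smult_r_distr E.smult_assoc1)
  next
    fix d assume "(\<zero>\<^bsub>E\<^esub>, d) \<in> G'"
    then obtain n c r where 1: "(n, c) \<in> G" "r \<in> carrier R" "\<zero>\<^bsub>E\<^esub> = n \<oplus>\<^bsub>E\<^esub> r \<odot>\<^bsub>E\<^esub> b" "d = c \<oplus>\<^bsub>E\<^esub> r [^] q \<odot>\<^bsub>E\<^esub> f"
      unfolding G'_def by blast
    note nc = D(1,2)[OF 1(1)]
    have rb: "r \<odot>\<^bsub>E\<^esub> b = \<ominus>\<^bsub>E\<^esub> n"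
      using 1(2,3) nc b by (metis E.a_comm E.minus_equality E.smult_closed)
    then have rbG: "(r \<odot>\<^bsub>E\<^esub> b, \<ominus>\<^bsub>E\<^esub> c) \<in> G" using frobenius_graph_neg[OF G 1(1)] by simp
    have "r \<in> \<mm>"
    proof (rule ccontr)
      assume "r \<notin> \<mm>"
      then obtain s where s: "s \<in> carrier R" "s \<otimes> r = \<one>" using unit 1(2) by blast
      have "s \<odot>\<^bsub>E\<^esub> (r \<odot>\<^bsub>E\<^esub> b) = b" using s 1(2) b by (simp flip: E.smult_assoc1)
      then show False using D(5)[OF s(1) rbG] b(2) by (metis Domain.DomainI)
    qed
    then have "r [^] q \<odot>\<^bsub>E\<^esub> f = \<ominus>\<^bsub>E\<^esub> c" using frobenius_graph_unique[OF G mG rbG] by blast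
    then show "d = \<zero>\<^bsub>E\<^esub>" using 1(4) nc by (simp add: E.r_neg)
  qed
  ultimately show ?thesis using that by blast
qed

text \<open>The starting map \<open>r e0 \<mapsto> r\<^sup>q w\<close> is well defined because the
  \<open>q\<close>-th powers of elements of \<open>\<mm>\<close> kill \<open>w\<close>. A maximal
  extension is total: a smaller domain would leave some \<open>b\<close> outside with
  \<open>\<mm> b\<close> inside, and \<open>frobenius_graph_extend\<close> would enlarge it.\<close>

lemma frobenius_map_exists:
  assumes w: "w \<in> carrier E" "\<And>s. s \<in> S \<Longrightarrow> s [^] q \<odot>\<^bsub>E\<^esub> w = \<zero>\<^bsub>E\<^esub>"
  obtains \<Phi> where "\<Phi> \<in> carrier E \<rightarrow> carrier E" "\<Phi> e0 = w"
    "\<And>e e'. e \<in> carrier E \<Longrightarrow> e' \<in> carrier E \<Longrightarrow> \<Phi> (e \<oplus>\<^bsub>E\<^esub> e') = \<Phi> e \<oplus>\<^bsub>E\<^esub> \<Phi> e'"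
    "\<And>r e. r \<in> carrier R \<Longrightarrow> e \<in> carrier E \<Longrightarrow> \<Phi> (r \<odot>\<^bsub>E\<^esub> e) = r [^] q \<odot>\<^bsub>E\<^esub> \<Phi> e"
proof -
  have zero_graph: "frobenius_graph q {(\<zero>\<^bsub>E\<^esub>, \<zero>\<^bsub>E\<^esub>)}" by (auto simp: frobenius_graph_def)
  have "S \<subseteq> {r \<in> carrier R. (r \<odot>\<^bsub>E\<^esub> \<zero>\<^bsub>E\<^esub>, r [^] q \<odot>\<^bsub>E\<^esub> w) \<in> {(\<zero>\<^bsub>E\<^esub>, \<zero>\<^bsub>E\<^esub>)}}" using w S_carrier by auto
  then have mw: "r [^] q \<odot>\<^bsub>E\<^esub> w = \<zero>\<^bsub>E\<^esub>" if "r \<in> \<mm>" for r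
    using maximal_minimal[OF frobenius_graph_ideal[OF zero_graph E.zero_closed w(1)]] that by auto
  define G0 where "G0 = (\<lambda>r. (r \<odot>\<^bsub>E\<^esub> e0, r [^] q \<odot>\<^bsub>E\<^esub> w)) ` carrier R"
  have G0I: "(r \<odot>\<^bsub>E\<^esub> e0, r [^] q \<odot>\<^bsub>E\<^esub> w) \<in> G0" if "r \<in> carrier R" for r using that by (simp add: G0_def)
  have G0: "frobenius_graph q G0"
    unfolding frobenius_graph_def
  proof (intro conjI allI impI ballI)
    show "G0 \<subseteq> carrier E \<times> carrier E" using e0 w by (auto simp: G0_def)
    show "(\<zero>\<^bsub>E\<^esub>, \<zero>\<^bsub>E\<^esub>) \<in> G0" using G0I[OF zero_closed] e0 w by (simp add: zero_pow_q)
  next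
    fix e d e' d' assume "(e, d) \<in> G0" "(e', d') \<in> G0"
    then obtain r s where "r \<in> carrier R" "s \<in> carrier R" "e = r \<odot>\<^bsub>E\<^esub> e0" "d = r [^] q \<odot>\<^bsub>E\<^esub> w"
      "e' = s \<odot>\<^bsub>E\<^esub> e0" "d' = s [^] q \<odot>\<^bsub>E\<^esub> w" by (auto simp: G0_def)
    then show "(e \<oplus>\<^bsub>E\<^esub> e', d \<oplus>\<^bsub>E\<^esub> d') \<in> G0"
      using G0I[of "r \<oplus> s"] e0 w by (simp add: E.smult_l_distr pow_q_add)
  next
    fix s e d assume s: "s \<in> carrier R" and "(e, d) \<in> G0"
    then obtain r where "r \<in> carrier R" "e = r \<odot>\<^bsub>E\<^esub> e0" "d = r [^] q \<odot>\<^bsub>E\<^esub> w" by (auto simp: G0_def)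
    then show "(s \<odot>\<^bsub>E\<^esub> e, s [^] q \<odot>\<^bsub>E\<^esub> d) \<in> G0"
      using G0I[of "s \<otimes> r"] s e0 w by (simp add: E.smult_assoc1 nat_pow_distrib)
  next
    fix d assume "(\<zero>\<^bsub>E\<^esub>, d) \<in> G0"
    then obtain r where r: "r \<in> carrier R" "r \<odot>\<^bsub>E\<^esub> e0 = \<zero>\<^bsub>E\<^esub>" "d = r [^] q \<odot>\<^bsub>E\<^esub> w"
      unfolding G0_def by force
    then show "d = \<zero>\<^bsub>E\<^esub>" using e0_annihilator[OF r(1)] mw by blast
  qed
  define A where "A = {G. frobenius_graph q G \<and> G0 \<subseteq> G}"
  have "\<exists>G\<in>A. \<forall>Z\<in>A. G \<subseteq> Z \<longrightarrow> Z = G"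
  proof (rule subset_Zorn_nonempty)
    show "A \<noteq> {}" using G0 by (auto simp: A_def)
    fix \<C> assume ne: "\<C> \<noteq> {}" and ch: "subset.chain A \<C>"
    then have CA: "\<And>Z. Z \<in> \<C> \<Longrightarrow> frobenius_graph q Z" "\<And>Z. Z \<in> \<C> \<Longrightarrow> G0 \<subseteq> Z"
      and lin: "\<And>Z Y. Z \<in> \<C> \<Longrightarrow> Y \<in> \<C> \<Longrightarrow> Z \<subseteq> Y \<or> Y \<subseteq> Z"
      by (auto simp: subset_chain_def A_def)
    have "frobenius_graph q (\<Union>\<C>)"
      unfolding frobenius_graph_def
    proof (intro conjI allI impI ballI)
      have "Z \<subseteq> carrier E \<times> carrier E" if "Z \<in> \<C>" for Z
        using CA(1)[OF that] by (simp add: frobenius_graph_def)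
      then show "\<Union>\<C> \<subseteq> carrier E \<times> carrier E" by blast
      obtain Z where "Z \<in> \<C>" using ne by blast
      then show "(\<zero>\<^bsub>E\<^esub>, \<zero>\<^bsub>E\<^esub>) \<in> \<Union>\<C>" using frobenius_graphD(3)[OF CA(1)] by blast
    next
      fix e d e' d' assume "(e, d) \<in> \<Union>\<C>" "(e', d') \<in> \<Union>\<C>"
      then obtain Z where Z: "Z \<in> \<C>" "(e, d) \<in> Z" "(e', d') \<in> Z" using lin by blast
      then show "(e \<oplus>\<^bsub>E\<^esub> e', d \<oplus>\<^bsub>E\<^esub> d') \<in> \<Union>\<C>" using frobenius_graphD(4)[OF CA(1)[OF Z(1)]] by blast
    next
      fix r e d assume r: "r \<in> carrier R" and "(e, d) \<in> \<Union>\<C>"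
      then obtain Z where Z: "Z \<in> \<C>" "(e, d) \<in> Z" by blast
      then show "(r \<odot>\<^bsub>E\<^esub> e, r [^] q \<odot>\<^bsub>E\<^esub> d) \<in> \<Union>\<C>" using frobenius_graphD(5)[OF CA(1)[OF Z(1)] r] by blast
    next
      fix d assume "(\<zero>\<^bsub>E\<^esub>, d) \<in> \<Union>\<C>"
      then obtain Z where Z: "Z \<in> \<C>" "(\<zero>\<^bsub>E\<^esub>, d) \<in> Z" by blast
      then show "d = \<zero>\<^bsub>E\<^esub>" using frobenius_graphD(6)[OF CA(1)[OF Z(1)]] by blast
    qed
    then show "\<Union>\<C> \<in> A" using CA(2) ne by (auto simp: A_def)
  qed
  then obtain G where GA: "G \<in> A" and maxA: "\<And>Z. Z \<in> A \<Longrightarrow> G \<subseteq> Z \<Longrightarrow> Z = G" by blast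
  from GA have G: "frobenius_graph q G" "G0 \<subseteq> G" by (auto simp: A_def)
  have max: "Z = G" if "frobenius_graph q Z" "G \<subseteq> Z" for Z
    using maxA[of Z] that G(2) by (auto simp: A_def)
  note D = frobenius_graphD[OF G(1)]
  have total: "e \<in> Domain G" if e: "e \<in> carrier E" for e
  proof (rule ccontr)
    assume "e \<notin> Domain G"
    moreover have N: "submodule (Domain G) R E"
    proof (rule E.submoduleI)
      show "Domain G \<subseteq> carrier E" using D(1) by blast
      show "\<zero>\<^bsub>E\<^esub> \<in> Domain G" using D(3) by blast
      show "\<ominus>\<^bsub>E\<^esub> a \<in> Domain G" if "a \<in> Domain G" for a
        using that frobenius_graph_neg[OF G(1)] by blast
      show "a \<oplus>\<^bsub>E\<^esub> b \<in> Domain G" if "a \<in> Domain G" "b \<in> Domain G" for a b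
        using that D(4) by blast
      show "r \<odot>\<^bsub>E\<^esub> a \<in> Domain G" if "r \<in> carrier R" "a \<in> Domain G" for r a
        using that D(5) by blast
    qed
    ultimately obtain b where b: "b \<in> carrier E" "b \<notin> Domain G"
      and P: "primeideal {r \<in> carrier R. r \<odot>\<^bsub>E\<^esub> b \<in> Domain G} R"
      using associated_prime_exists[OF E.module_axioms N e] by blast
    have "r \<odot>\<^bsub>E\<^esub> b \<in> Domain G" if r: "r \<in> \<mm>" for r
    proof -
      \<comment> \<open>Elements of \<open>\<mm>\<close> act nilpotently on each element of
        \<open>E\<close>, so the associated prime of \<open>E\<close> modulo the domain contains
        \<open>\<mm>\<close>.\<close>
      obtain n :: nat where "r [^] n \<odot>\<^bsub>E\<^esub> b = \<zero>\<^bsub>E\<^esub>" using maximal_torsion[OF b(1) r] by blast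
      then have "r [^] n \<in> {r \<in> carrier R. r \<odot>\<^bsub>E\<^esub> b \<in> Domain G}"
        using D(3) maximal_carrier[OF r] by auto
      then show ?thesis using pow_notin_prime[OF P maximal_carrier[OF r], of n] by blast
    qed
    then obtain G' where "frobenius_graph q G'" "G \<subset> G'" using frobenius_graph_extend[OF G(1) b] by blast
    then show False using max by blast
  qed
  define \<Phi> where "\<Phi> e = (THE d. (e, d) \<in> G)" for e
  have \<Phi>I: "\<Phi> e = d" if "(e, d) \<in> G" for e d
    unfolding \<Phi>_def using that frobenius_graph_unique[OF G(1)] by blast
  have \<Phi>: "(e, \<Phi> e) \<in> G" if "e \<in> carrier E" for e using total[OF that] \<Phi>I by auto
  show ?thesis
  proof (rule that)
    show "\<Phi> \<in> carrier E \<rightarrow> carrier E" using \<Phi> D(2) by blast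
    show "\<Phi> e0 = w" using G0I[OF one_closed] G(2) e0 w(1) by (intro \<Phi>I) auto
    show "\<Phi> (e \<oplus>\<^bsub>E\<^esub> e') = \<Phi> e \<oplus>\<^bsub>E\<^esub> \<Phi> e'" if "e \<in> carrier E" "e' \<in> carrier E" for e e'
      using \<Phi>I[OF D(4)[OF \<Phi>[OF that(1)] \<Phi>[OF that(2)]]] .
    show "\<Phi> (r \<odot>\<^bsub>E\<^esub> e) = r [^] q \<odot>\<^bsub>E\<^esub> \<Phi> e" if "r \<in> carrier R" "e \<in> carrier E" for r e
      using \<Phi>I[OF D(5)[OF that(1) \<Phi>[OF that(2)]]] .
  qed
qed

end

end

section \<open>Functionals on F-modules\<close>

abbreviation tensor :: "('a, 'r) ring_scheme \<Rightarrow> nat \<Rightarrow> ('a, 'b) module \<Rightarrow> 'a \<Rightarrow> 'b \<Rightarrow> ('a \<times> 'b \<Rightarrow>\<^sub>0 int) set" where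
  "tensor R p M a x \<equiv> frob_rels R p M #>\<^bsub>frob_free R M\<^esub> frag_of (a, x)"

lemma tensor_carrier:
  assumes "module R M" "a \<in> carrier R" "x \<in> carrier M"
  shows "tensor R p M a x \<in> carrier (frob R p M)"
  unfolding carrier_frob[OF assms(1)] using assms(2,3) by fastforce

text \<open>For \<open>q = 1\<close> this is the universal property of \<open>F(M)\<close>; powers \<open>q\<close> of \<open>p\<close> allow the iterates
  \<open>F\<^sup>j\<close> to be unwound one at a time.\<close>

lemma frob_lift:
  fixes R :: "('a, 'r) ring_scheme" and M :: "('a, 'b) module" and E :: "('a, 'e) module"
  assumes M: "module R M" and E: "module R E"
    and q: "\<And>a b. a \<in> carrier R \<Longrightarrow> b \<in> carrier R \<Longrightarrow>
      (a \<oplus>\<^bsub>R\<^esub> b) [^]\<^bsub>R\<^esub> (q::nat) = a [^]\<^bsub>R\<^esub> q \<oplus>\<^bsub>R\<^esub> b [^]\<^bsub>R\<^esub> q"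
    and \<Psi>: "\<Psi> \<in> carrier M \<rightarrow> carrier E"
      "\<And>x y. x \<in> carrier M \<Longrightarrow> y \<in> carrier M \<Longrightarrow> \<Psi> (x \<oplus>\<^bsub>M\<^esub> y) = \<Psi> x \<oplus>\<^bsub>E\<^esub> \<Psi> y"
      "\<And>r x. r \<in> carrier R \<Longrightarrow> x \<in> carrier M \<Longrightarrow> \<Psi> (r \<odot>\<^bsub>M\<^esub> x) = r [^]\<^bsub>R\<^esub> (p * q) \<odot>\<^bsub>E\<^esub> \<Psi> x"
  shows "\<exists>H\<in>carrier (frob R p M) \<rightarrow> carrier E.
    (\<forall>C\<in>carrier (frob R p M). \<forall>D\<in>carrier (frob R p M). H (C \<oplus>\<^bsub>frob R p M\<^esub> D) = H C \<oplus>\<^bsub>E\<^esub> H D) \<and>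
    (\<forall>r\<in>carrier R. \<forall>C\<in>carrier (frob R p M). H (r \<odot>\<^bsub>frob R p M\<^esub> C) = r [^]\<^bsub>R\<^esub> q \<odot>\<^bsub>E\<^esub> H C) \<and>
    (\<forall>x\<in>carrier M. H (tensor R p M \<one>\<^bsub>R\<^esub> x) = \<Psi> x)"
proof -
  interpret M: module R M by fact
  interpret E: module R E by fact
  let ?S = "carrier R \<times> carrier M" and ?K = "frob_rels R p M"
  have \<Psi>c: "\<Psi> x \<in> carrier E" if "x \<in> carrier M" for x using \<Psi>(1) that by blast
  \<comment> \<open>The map to be induced is
    \<open>a \<otimes> x \<mapsto> a\<^sup>q \<Psi> x\<close>. Moving \<open>r\<close> across the
    tensor sign turns it into \<open>r\<^sup>p\<close>, whose \<open>q\<close>-th power is the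
    scalar that \<open>\<Psi>\<close> produces.\<close>
  have im: "(\<lambda>(a, x). a [^]\<^bsub>R\<^esub> q \<odot>\<^bsub>E\<^esub> \<Psi> x) ` ?S \<subseteq> carrier (add_monoid E)" using \<Psi>c by auto
  obtain h where h: "h \<in> hom (free_Abelian_group ?S) (add_monoid E)"
    and hof: "\<And>t. t \<in> ?S \<Longrightarrow> h (frag_of t) = (case t of (a, x) \<Rightarrow> a [^]\<^bsub>R\<^esub> q \<odot>\<^bsub>E\<^esub> \<Psi> x)"
    using comm_group.free_Abelian_group_universal[OF E.a_comm_group im] by blast
  have hof': "h (frag_of (a, x)) = a [^]\<^bsub>R\<^esub> q \<odot>\<^bsub>E\<^esub> \<Psi> x" if "a \<in> carrier R" "x \<in> carrier M" for a x
    using hof[of "(a, x)"] that by simp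
  have hc: "h c \<in> carrier E" if "Poly_Mapping.keys c \<subseteq> ?S" for c
    using h that by (auto simp: hom_def Pi_iff)
  have hadd: "h (c + d) = h c \<oplus>\<^bsub>E\<^esub> h d" if "Poly_Mapping.keys c \<subseteq> ?S" "Poly_Mapping.keys d \<subseteq> ?S" for c d
    using h that by (auto simp: hom_def)
  have kdiff: "Poly_Mapping.keys (c - d) \<subseteq> ?S"
    if "Poly_Mapping.keys c \<subseteq> ?S" "Poly_Mapping.keys d \<subseteq> ?S" for c d :: "'a \<times> 'b \<Rightarrow>\<^sub>0 int"
    using that keys_diff[of c d] by blast
  have h0: "h 0 = \<zero>\<^bsub>E\<^esub>"
    using hadd[of 0 0] hc[of 0] by (metis E.add.r_cancel_one' add.right_neutral empty_subsetI keys_zero)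
  have hdiff: "h (c - d) = h c \<ominus>\<^bsub>E\<^esub> h d" if c: "Poly_Mapping.keys c \<subseteq> ?S" and d: "Poly_Mapping.keys d \<subseteq> ?S" for c d
  proof -
    have "h c = h (c - d) \<oplus>\<^bsub>E\<^esub> h d" using hadd[OF kdiff[OF c d] d] by simp
    then show ?thesis
      using hc[OF kdiff[OF c d]] hc[OF d] by (simp add: E.minus_eq E.a_assoc E.r_neg)
  qed
  have cancel: "x \<oplus>\<^bsub>E\<^esub> y \<ominus>\<^bsub>E\<^esub> x \<ominus>\<^bsub>E\<^esub> y = \<zero>\<^bsub>E\<^esub>" if "x \<in> carrier E" "y \<in> carrier E" for x y
    using that by (simp add: E.a_comm[of x y] E.minus_eq E.a_assoc E.r_neg E.r_neg2)
  have kof: "Poly_Mapping.keys (frag_of t) \<subseteq> ?S" if "t \<in> ?S" for t using that by simp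
  have hK: "h k = \<zero>\<^bsub>E\<^esub>" if "k \<in> ?K" for k
    using that unfolding frob_rels_def
  proof (induction rule: generate.induct)
    case one
    then show ?case using h0 by simp
  next
    have gen: "Poly_Mapping.keys k \<subseteq> ?S \<and> h k = \<zero>\<^bsub>E\<^esub>" if
      "k \<in> {frag_of (a \<oplus>\<^bsub>R\<^esub> b, x) - frag_of (a, x) - frag_of (b, x) | a b x.
          a \<in> carrier R \<and> b \<in> carrier R \<and> x \<in> carrier M} \<union>
      {frag_of (a, x \<oplus>\<^bsub>M\<^esub> y) - frag_of (a, x) - frag_of (a, y) | a x y.
          a \<in> carrier R \<and> x \<in> carrier M \<and> y \<in> carrier M} \<union>
      {frag_of ((r [^]\<^bsub>R\<^esub> p) \<otimes>\<^bsub>R\<^esub> a, x) - frag_of (a, r \<odot>\<^bsub>M\<^esub> x) | r a x.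
          r \<in> carrier R \<and> a \<in> carrier R \<and> x \<in> carrier M}" for k
      using that
    proof (elim UnE CollectE exE conjE)
      fix a b x assume *: "k = frag_of (a \<oplus>\<^bsub>R\<^esub> b, x) - frag_of (a, x) - frag_of (b, x)"
        "a \<in> carrier R" "b \<in> carrier R" "x \<in> carrier M"
      then have "h k = h (frag_of (a \<oplus>\<^bsub>R\<^esub> b, x)) \<ominus>\<^bsub>E\<^esub> h (frag_of (a, x)) \<ominus>\<^bsub>E\<^esub> h (frag_of (b, x))"
        using hdiff kdiff kof by simp
      then show ?thesis using * kdiff kof \<Psi>c
        by (simp add: hof' q E.smult_l_distr cancel)
    next
      fix a x y assume *: "k = frag_of (a, x \<oplus>\<^bsub>M\<^esub> y) - frag_of (a, x) - frag_of (a, y)"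
        "a \<in> carrier R" "x \<in> carrier M" "y \<in> carrier M"
      then have "h k = h (frag_of (a, x \<oplus>\<^bsub>M\<^esub> y)) \<ominus>\<^bsub>E\<^esub> h (frag_of (a, x)) \<ominus>\<^bsub>E\<^esub> h (frag_of (a, y))"
        using hdiff kdiff kof by simp
      then show ?thesis using * kdiff kof \<Psi>c
        by (simp add: hof' \<Psi>(2) E.smult_r_distr cancel)
    next
      fix r a x assume *: "k = frag_of ((r [^]\<^bsub>R\<^esub> p) \<otimes>\<^bsub>R\<^esub> a, x) - frag_of (a, r \<odot>\<^bsub>M\<^esub> x)"
        "r \<in> carrier R" "a \<in> carrier R" "x \<in> carrier M"
      then have "h k = h (frag_of ((r [^]\<^bsub>R\<^esub> p) \<otimes>\<^bsub>R\<^esub> a, x)) \<ominus>\<^bsub>E\<^esub> h (frag_of (a, r \<odot>\<^bsub>M\<^esub> x))"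
        using hdiff kof by simp
      moreover have "a [^]\<^bsub>R\<^esub> q \<odot>\<^bsub>E\<^esub> (r [^]\<^bsub>R\<^esub> (p * q) \<odot>\<^bsub>E\<^esub> \<Psi> x) = (r [^]\<^bsub>R\<^esub> p \<otimes>\<^bsub>R\<^esub> a) [^]\<^bsub>R\<^esub> q \<odot>\<^bsub>E\<^esub> \<Psi> x"
        using * \<Psi>c by (simp add: M.R.nat_pow_distrib M.R.nat_pow_pow M.R.m_comm flip: E.smult_assoc1)
      ultimately show ?thesis using * kdiff kof \<Psi>c by (simp add: hof' \<Psi>(3) E.minus_eq E.r_neg)
    qed
    { case (incl k)
      then show ?case using gen by blast
    next
      case (inv k)
      then have "Poly_Mapping.keys k \<subseteq> ?S" "h k = \<zero>\<^bsub>E\<^esub>" using gen by blast+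
      then show ?case using hdiff[of 0 k] h0 by (simp add: E.minus_eq)
    next
      case (eng k l)
      from eng(1,2) have "k \<in> ?K" "l \<in> ?K" by (simp_all add: frob_rels_def)
      then show ?case using frob_rels_keys[OF M] hadd[of k l] eng(3,4) by simp }
  qed
  define H where "H C = h (SOME c. c \<in> C)" for C
  have H: "H (?K #>\<^bsub>frob_free R M\<^esub> c) = h c" if c: "Poly_Mapping.keys c \<subseteq> ?S" for c
  proof -
    have "\<exists>d. d \<in> ?K #>\<^bsub>frob_free R M\<^esub> c" unfolding frob_coset[OF M] using frob_rels_zero[OF M] by blast
    then have "(SOME d. d \<in> ?K #>\<^bsub>frob_free R M\<^esub> c) \<in> ?K #>\<^bsub>frob_free R M\<^esub> c" by (rule someI_ex)
    then obtain k where k: "k \<in> ?K" "(SOME d. d \<in> ?K #>\<^bsub>frob_free R M\<^esub> c) = c + k"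
      unfolding frob_coset[OF M] by blast
    then show ?thesis unfolding H_def using hadd[OF c frob_rels_keys[OF M k(1)]] hK[OF k(1)] hc[OF c] by simp
  qed
  have cE: "\<exists>c. C = ?K #>\<^bsub>frob_free R M\<^esub> c \<and> Poly_Mapping.keys c \<subseteq> ?S" if "C \<in> carrier (frob R p M)" for C
    using that carrier_frob[OF M] by blast
  have kadd: "Poly_Mapping.keys (c + d) \<subseteq> ?S"
    if "Poly_Mapping.keys c \<subseteq> ?S" "Poly_Mapping.keys d \<subseteq> ?S" for c d :: "'a \<times> 'b \<Rightarrow>\<^sub>0 int"
    using that Poly_Mapping.keys_add[of c d] by blast
  have hs: "h (frag_extend (\<lambda>(a, x). frag_of (r \<otimes>\<^bsub>R\<^esub> a, x)) c) = r [^]\<^bsub>R\<^esub> q \<odot>\<^bsub>E\<^esub> h c"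
    if r: "r \<in> carrier R" and c: "Poly_Mapping.keys c \<subseteq> ?S" for r c
  proof -
    let ?\<phi> = "frag_extend (\<lambda>(a, x). frag_of (r \<otimes>\<^bsub>R\<^esub> a, x))"
    have "Poly_Mapping.keys c \<subseteq> ?S \<and> h (?\<phi> c) = r [^]\<^bsub>R\<^esub> q \<odot>\<^bsub>E\<^esub> h c"
      using c
    proof (induction c rule: frag_induction)
      case zero
      then show ?case using r h0 by simp
    next
      case (one t)
      then show ?case
        using r \<Psi>c by (auto simp: hof' M.R.nat_pow_distrib E.smult_assoc1)
    next
      case (diff c d)
      have "?\<phi> (c - d) = ?\<phi> c - ?\<phi> d" by (simp add: frag_extend_diff)
      then show ?case
        using diff r hdiff frob_smult_keys[OF M r] hc kdiff
        by (simp add: E.minus_eq E.smult_r_distr E.smult_r_minus)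
    qed
    then show ?thesis by blast
  qed
  show ?thesis
  proof (intro bexI[of _ H] conjI ballI)
    show "H \<in> carrier (frob R p M) \<rightarrow> carrier E" using cE H hc by fastforce
    show "H (tensor R p M \<one>\<^bsub>R\<^esub> x) = \<Psi> x" if "x \<in> carrier M" for x
      using H[of "frag_of (\<one>\<^bsub>R\<^esub>, x)"] hof' \<Psi>c that by simp
  next
    fix C D assume "C \<in> carrier (frob R p M)" "D \<in> carrier (frob R p M)"
    then obtain c d where c: "C = ?K #>\<^bsub>frob_free R M\<^esub> c" "Poly_Mapping.keys c \<subseteq> ?S"
      and d: "D = ?K #>\<^bsub>frob_free R M\<^esub> d" "Poly_Mapping.keys d \<subseteq> ?S" using cE by meson
    show "H (C \<oplus>\<^bsub>frob R p M\<^esub> D) = H C \<oplus>\<^bsub>E\<^esub> H D"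
      unfolding c(1) d(1) frob_add[OF M] using H kadd hadd c(2) d(2) by simp
  next
    fix r C assume r: "r \<in> carrier R" and "C \<in> carrier (frob R p M)"
    then obtain c where c: "C = ?K #>\<^bsub>frob_free R M\<^esub> c" "Poly_Mapping.keys c \<subseteq> ?S" using cE by meson
    show "H (r \<odot>\<^bsub>frob R p M\<^esub> C) = r [^]\<^bsub>R\<^esub> q \<odot>\<^bsub>E\<^esub> H C"
      unfolding c(1) frob_smult[OF M r] using H frob_smult_keys[OF M r c(2)] hs[OF r c(2)] c(2) by simp
  qed
qed

lemma frob_map_coset:
  assumes M: "module R M" and N: "module R N" and h: "h \<in> mod_hom R M N"
  shows "frob_map R p N h (frob_rels R p M #>\<^bsub>frob_free R M\<^esub> c)
      = frob_rels R p N #>\<^bsub>frob_free R N\<^esub> frag_extend (\<lambda>(a, x). frag_of (a, h x)) c"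
proof -
  note hD = mod_homD[OF h]
  have rels: "frag_extend (\<lambda>(a, x). frag_of (a, h x)) k \<in> frob_rels R p N" if "k \<in> frob_rels R p M" for k
    by (rule induced_rels[OF M N _ _ _ that]) (simp_all add: hD frob_rels_gens[OF N])
  show ?thesis unfolding frob_map_def by (rule induced_coset[OF M N rels])
qed

section \<open>From semilinear maps on E to functionals\<close>

context residue_hull
begin

text \<open>A \<open>p\<^sup>j\<^sup>+\<^sup>1\<close>-linear map factors through
  \<open>F(M)\<close> as a \<open>p\<^sup>j\<close>-linear one whose value at
  \<open>1 \<otimes> x\<close> is the old value at \<open>x\<close>, and \<open>\<theta>\<close>
  brings it back to \<open>M\<close>. Only the value survives each round; \<open>x\<close> is
  replaced by the preimage of \<open>1 \<otimes> x\<close> under \<open>\<theta>\<close>.\<close>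

lemma frob_descend:
  assumes F: "F_module R p M \<theta>" and x: "x \<in> carrier M" and \<Psi>: "\<Psi> \<in> carrier M \<rightarrow> carrier E"
      "\<And>x y. x \<in> carrier M \<Longrightarrow> y \<in> carrier M \<Longrightarrow> \<Psi> (x \<oplus>\<^bsub>M\<^esub> y) = \<Psi> x \<oplus>\<^bsub>E\<^esub> \<Psi> y"
      "\<And>r x. r \<in> carrier R \<Longrightarrow> x \<in> carrier M \<Longrightarrow> \<Psi> (r \<odot>\<^bsub>M\<^esub> x) = r [^] (p ^ j) \<odot>\<^bsub>E\<^esub> \<Psi> x"
  shows "\<exists>g\<in>mod_hom R M E. \<exists>s\<in>carrier M. g s = \<Psi> x"
  using x \<Psi>
proof (induction j arbitrary: \<Psi> x)
  case 0
  then show ?case by (intro bexI[of _ \<Psi>] bexI[of _ x]) (auto simp: mod_hom_def)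
next
  case (Suc j)
  from F have M: "module R M" and \<theta>: "\<theta> \<in> mod_hom R M (frob R p M)" "bij_betw \<theta> (carrier M) (carrier (frob R p M))"
    by (auto simp: F_module_def mod_iso_def)
  note \<theta>D = mod_homD[OF \<theta>(1)]
  have semi: "\<Psi> (r \<odot>\<^bsub>M\<^esub> x) = r [^] (p * p ^ j) \<odot>\<^bsub>E\<^esub> \<Psi> x" if "r \<in> carrier R" "x \<in> carrier M" for r x
    using Suc.prems(4)[OF that] by simp
  have "\<exists>H\<in>carrier (frob R p M) \<rightarrow> carrier E.
    (\<forall>C\<in>carrier (frob R p M). \<forall>D\<in>carrier (frob R p M). H (C \<oplus>\<^bsub>frob R p M\<^esub> D) = H C \<oplus>\<^bsub>E\<^esub> H D) \<and>
    (\<forall>r\<in>carrier R. \<forall>C\<in>carrier (frob R p M). H (r \<odot>\<^bsub>frob R p M\<^esub> C) = r [^] (p ^ j) \<odot>\<^bsub>E\<^esub> H C) \<and>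
    (\<forall>x\<in>carrier M. H (tensor R p M \<one> x) = \<Psi> x)"
    by (rule frob_lift[OF M E.module_axioms])
       (use frobenius_add[OF prime_p char_p] Suc.prems(2,3) semi in simp_all)
  then obtain H where H: "H \<in> carrier (frob R p M) \<rightarrow> carrier E"
    "\<forall>C\<in>carrier (frob R p M). \<forall>D\<in>carrier (frob R p M). H (C \<oplus>\<^bsub>frob R p M\<^esub> D) = H C \<oplus>\<^bsub>E\<^esub> H D"
    "\<forall>r\<in>carrier R. \<forall>C\<in>carrier (frob R p M). H (r \<odot>\<^bsub>frob R p M\<^esub> C) = r [^] (p ^ j) \<odot>\<^bsub>E\<^esub> H C"
    "\<forall>x\<in>carrier M. H (tensor R p M \<one> x) = \<Psi> x" by blast
  have "tensor R p M \<one> x \<in> \<theta> ` carrier M"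
    unfolding bij_betw_imp_surj_on[OF \<theta>(2)] by (rule tensor_carrier[OF M one_closed Suc.prems(1)])
  then obtain s where s: "tensor R p M \<one> x = \<theta> s" "s \<in> carrier M" by (rule imageE)
  have "\<exists>g\<in>mod_hom R M E. \<exists>t\<in>carrier M. g t = (H \<circ> \<theta>) s"
    by (rule Suc.IH[OF s(2)]) (use H \<theta>D in \<open>auto simp: Pi_iff\<close>)
  moreover have "H (\<theta> s) = \<Psi> x" using H(4) Suc.prems(1) s(1) by metis
  ultimately show ?case by simp
qed

lemma deep_functional:
  assumes F: "F_module R p M \<theta>" and x: "x \<in> carrier M" "x \<noteq> \<zero>\<^bsub>M\<^esub>"
    and xs: "distinct xs" "set xs = S"
  obtains g s where "g \<in> mod_hom R M E" "s \<in> carrier M"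
    "\<And>r. lex_bounded {\<zero>} xs n r \<Longrightarrow> r \<odot>\<^bsub>E\<^esub> g s \<noteq> \<zero>\<^bsub>E\<^esub>"
proof -
  have M: "module R M" using F by (simp add: F_module_def)
  interpret M: module R M by fact
  \<comment> \<open>With \<open>q = p\<^sup>n\<close> the exponent given to
    \<open>deep_element\<close> is \<open>k = q - 1\<close>: then \<open>w\<close> is killed by all
    \<open>s\<^sup>q\<close>, as the semilinear map requires, and \<open>n < q\<close> gives the
    depth \<open>n\<close>.\<close>
  have "n < p ^ n" using prime_gt_1_nat[OF prime_p] by (simp add: power_gt_expt)
  then obtain k where k: "p ^ n = Suc k" "n \<le> k" by (cases "p ^ n") auto
  obtain w where w: "w \<in> carrier E" "\<And>s. s \<in> S \<Longrightarrow> s [^] Suc k \<odot>\<^bsub>E\<^esub> w = \<zero>\<^bsub>E\<^esub>"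
    and deep: "\<And>r. lex_bounded {\<zero>} xs k r \<Longrightarrow> r \<odot>\<^bsub>E\<^esub> w \<noteq> \<zero>\<^bsub>E\<^esub>"
    using deep_element[OF xs, of k] by blast
  obtain \<Phi> where \<Phi>: "\<Phi> \<in> carrier E \<rightarrow> carrier E" "\<Phi> e0 = w"
    "\<And>e e'. e \<in> carrier E \<Longrightarrow> e' \<in> carrier E \<Longrightarrow> \<Phi> (e \<oplus>\<^bsub>E\<^esub> e') = \<Phi> e \<oplus>\<^bsub>E\<^esub> \<Phi> e'"
    "\<And>r e. r \<in> carrier R \<Longrightarrow> e \<in> carrier E \<Longrightarrow> \<Phi> (r \<odot>\<^bsub>E\<^esub> e) = r [^] (p ^ n) \<odot>\<^bsub>E\<^esub> \<Phi> e"
    using frobenius_map_exists[OF refl w(1), of n] w(2) unfolding k(1) by blast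
  \<comment> \<open>The annihilator of a nonzero \<open>x\<close> lies in \<open>\<mm>\<close>, so
    \<open>x\<close> can be sent to \<open>e0\<close>.\<close>
  have ann: "r \<odot>\<^bsub>E\<^esub> e0 = \<zero>\<^bsub>E\<^esub>" if r: "r \<in> carrier R" "r \<odot>\<^bsub>M\<^esub> x = \<zero>\<^bsub>M\<^esub>" for r
  proof (rule ccontr)
    assume "r \<odot>\<^bsub>E\<^esub> e0 \<noteq> \<zero>\<^bsub>E\<^esub>"
    then obtain b where b: "b \<in> carrier R" "b \<otimes> r = \<one>" using e0_annihilator[OF r(1)] unit[OF r(1)] by blast
    have "x = b \<odot>\<^bsub>M\<^esub> (r \<odot>\<^bsub>M\<^esub> x)" using b r(1) x(1) by (simp flip: M.smult_assoc1)
    then show False using r(2) b x(2) by simp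
  qed
  obtain g where g: "g \<in> mod_hom R M E" "g x = e0"
    using injective_module_hom_at[OF injective M x(1) e0 ann] by blast
  note gD = mod_homD[OF g(1)]
  have "\<exists>h\<in>mod_hom R M E. \<exists>s\<in>carrier M. h s = (\<Phi> \<circ> g) x"
    by (rule frob_descend[OF F x(1), of _ n]) (use \<Phi> gD in \<open>auto simp: Pi_iff\<close>)
  then obtain h s where "h \<in> mod_hom R M E" "s \<in> carrier M" "h s = w" using g(2) \<Phi>(2) by auto
  then show ?thesis using that deep lex_bounded_mono[OF _ k(2)] by metis
qed

end

section \<open>Filtration by the images of the iterated Frobenius functors\<close>

context
  fixes R :: "('a, 'r) ring_scheme" and N :: "nat \<Rightarrow> ('a, 'b) module" and f :: "nat \<Rightarrow> 'b \<Rightarrow> 'b"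
  assumes N: "\<And>i. module R (N i)" and f: "\<And>i. f i \<in> mod_hom R (N i) (N (Suc i))"
begin

lemma limit_class_in_carrier:
  "x \<in> carrier (N i) \<Longrightarrow> limit_rel N f `` {(i, x)} \<in> carrier (direct_limit N f)"
  unfolding direct_limit_def by (auto intro: quotientI)

lemma limit_class_Suc:
  assumes x: "x \<in> carrier (N i)"
  shows "limit_rel N f `` {(i, x)} = limit_rel N f `` {(Suc i, f i x)}"
proof (rule equiv_class_eq[OF equiv_limit_rel[where N = N and f = f, OF N f]])
  have "system_map f i (Suc i - i) x = system_map f (Suc i) (Suc i - Suc i) (f i x)"
    by (simp add: Suc_diff_le)
  then show "((i, x), (Suc i, f i x)) \<in> limit_rel N f"
    using x mod_homD(1)[OF f x] unfolding limit_rel_def by (auto intro!: exI[of _ "Suc i"])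
qed

lemma limit_class_smult:
  assumes r: "r \<in> carrier R" and x: "x \<in> carrier (N i)"
  shows "r \<odot>\<^bsub>direct_limit N f\<^esub> limit_rel N f `` {(i, x)} = limit_rel N f `` {(i, r \<odot>\<^bsub>N i\<^esub> x)}"
proof -
  let ?r = "limit_rel N f"
  note eq = equiv_limit_rel[where N = N and f = f, OF N f]
  let ?S = "{(k, r \<odot>\<^bsub>N k\<^esub> u) | k u. (k, u) \<in> ?r `` {(i, x)}}"
  have 1: "(i, r \<odot>\<^bsub>N i\<^esub> x) \<in> ?S"
    using x eq by (fastforce simp: equiv_def refl_on_def)
  have 2: "((i, r \<odot>\<^bsub>N i\<^esub> x), s) \<in> ?r" if "s \<in> ?S" for s
  proof -
    from that obtain k u where s: "s = (k, r \<odot>\<^bsub>N k\<^esub> u)" and u: "((i, x), (k, u)) \<in> ?r" by blast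
    then obtain m where *: "i \<le> m" "k \<le> m" "system_map f i (m - i) x = system_map f k (m - k) u"
      and c: "u \<in> carrier (N k)" by (auto simp: limit_rel_def)
    have "system_map f i (m - i) (r \<odot>\<^bsub>N i\<^esub> x) = system_map f k (m - k) (r \<odot>\<^bsub>N k\<^esub> u)"
      using mod_homD(3)[OF system_map_hom[where N = N and f = f, OF N f] r] x c * by simp
    moreover have "r \<odot>\<^bsub>N i\<^esub> x \<in> carrier (N i)" "r \<odot>\<^bsub>N k\<^esub> u \<in> carrier (N k)"
      using module.smult_closed[OF N r] x c by auto
    ultimately show ?thesis using * s by (auto simp: limit_rel_def intro!: exI[of _ m])
  qed
  have "?r `` ?S = ?r `` {(i, r \<odot>\<^bsub>N i\<^esub> x)}"
  proof (intro equalityI subsetI)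
    fix t assume "t \<in> ?r `` ?S"
    then obtain s where "s \<in> ?S" "(s, t) \<in> ?r" by blast
    then show "t \<in> ?r `` {(i, r \<odot>\<^bsub>N i\<^esub> x)}"
      using 2 eq unfolding equiv_def by (blast dest: transD)
  next
    fix t assume "t \<in> ?r `` {(i, r \<odot>\<^bsub>N i\<^esub> x)}"
    then show "t \<in> ?r `` ?S" using 1 by blast
  qed
  then show ?thesis by (simp add: direct_limit_def)
qed

lemma direct_limit_maps:
  assumes "is_direct_limit R N f L \<psi>"
  shows "\<psi> i \<in> mod_hom R (N i) L"
    and "x \<in> carrier (N i) \<Longrightarrow> \<psi> i x = \<psi> (Suc i) (f i x)"
    and "y \<in> carrier L \<Longrightarrow> \<exists>i. y \<in> \<psi> i ` carrier (N i)"
proof -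
  from assms obtain g where g: "g \<in> mod_hom R (direct_limit N f) L"
    "bij_betw g (carrier (direct_limit N f)) (carrier L)"
    and g\<psi>: "\<And>i x. x \<in> carrier (N i) \<Longrightarrow> g (limit_rel N f `` {(i, x)}) = \<psi> i x"
    unfolding is_direct_limit_def mod_iso_def by blast
  note gD = mod_homD[OF g(1)] and cl = limit_class_in_carrier
  interpret N: module R "N i" for i by (rule N)
  show "\<psi> i \<in> mod_hom R (N i) L"
    unfolding mod_hom_def
  proof (intro CollectI conjI ballI funcsetI)
    show "\<psi> i x \<in> carrier L" if "x \<in> carrier (N i)" for x
      using gD(1)[OF cl[OF that]] g\<psi>[OF that] by simp
    show "\<psi> i (x \<oplus>\<^bsub>N i\<^esub> y) = \<psi> i x \<oplus>\<^bsub>L\<^esub> \<psi> i y" if "x \<in> carrier (N i)" "y \<in> carrier (N i)" for x y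
      using gD(2)[OF cl[OF that(1)] cl[OF that(2)]] g\<psi> that limit_class_add[where N = N and f = f, OF N f that] by simp
    show "\<psi> i (r \<odot>\<^bsub>N i\<^esub> x) = r \<odot>\<^bsub>L\<^esub> \<psi> i x" if "r \<in> carrier R" "x \<in> carrier (N i)" for r x
      using gD(3)[OF that(1) cl[OF that(2)]] g\<psi> that limit_class_smult[OF that] by simp
  qed
  show "\<psi> i x = \<psi> (Suc i) (f i x)" if "x \<in> carrier (N i)"
    using g\<psi>[OF that] g\<psi>[OF mod_homD(1)[OF f that]] limit_class_Suc[OF that] by simp
  show "\<exists>i. y \<in> \<psi> i ` carrier (N i)" if "y \<in> carrier L"
  proof -
    have "y \<in> g ` carrier (direct_limit N f)" using that bij_betw_imp_surj_on[OF g(2)] by simp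
    then obtain C where C: "C \<in> carrier (direct_limit N f)" "y = g C" by blast
    then obtain i x where "x \<in> carrier (N i)" "C = limit_rel N f `` {(i, x)}"
      unfolding direct_limit_def by (auto elim!: quotientE)
    then show ?thesis using C(2) g\<psi> by auto
  qed
qed

end

text \<open>On pure tensors \<open>c\<^sup>p (a \<otimes> h x) = a \<otimes> c h x\<close>, and
  \<open>a \<otimes> 0 = 0\<close>.\<close>

lemma frob_annihilator:
  assumes M: "module R M" and N: "module R N" and h: "h \<in> mod_hom R M N" and c: "c \<in> carrier R"
    and kill: "\<And>x. x \<in> carrier M \<Longrightarrow> c \<odot>\<^bsub>N\<^esub> h x = \<zero>\<^bsub>N\<^esub>" and C: "C \<in> carrier (frob R p M)"
  shows "c [^]\<^bsub>R\<^esub> p \<odot>\<^bsub>frob R p N\<^esub> frob_map R p N h C = \<zero>\<^bsub>frob R p N\<^esub>"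
proof -
  interpret N: module R N by fact
  let ?K = "frob_rels R p N"
  have cp: "c [^]\<^bsub>R\<^esub> p \<in> carrier R" using c by simp
  obtain d where d: "C = frob_rels R p M #>\<^bsub>frob_free R M\<^esub> d" "Poly_Mapping.keys d \<subseteq> carrier R \<times> carrier M"
    using C carrier_frob[OF M] by blast
  let ?s = "frag_extend (\<lambda>(a, x). frag_of (c [^]\<^bsub>R\<^esub> p \<otimes>\<^bsub>R\<^esub> a, x))" and ?h = "frag_extend (\<lambda>(a, x). frag_of (a, h x))"
  have "?s (?h d) \<in> ?K" using d(2)
  proof (induction d rule: frag_induction)
    case zero
    then show ?case using frob_rels_zero[OF N] by simp
  next
    case (one t)
    then obtain a x where t: "t = (a, x)" "a \<in> carrier R" "x \<in> carrier M" by auto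
    have hx: "h x \<in> carrier N" using mod_homD(1)[OF h t(3)] .
    have "frag_of (c [^]\<^bsub>R\<^esub> p \<otimes>\<^bsub>R\<^esub> a, h x) - frag_of (a, \<zero>\<^bsub>N\<^esub>) \<in> ?K"
      using frob_rels_gens(3)[OF N t(2) c hx, of p] kill[OF t(3)] by simp
    moreover have "- frag_of (a, \<zero>\<^bsub>N\<^esub>) \<in> ?K"
      using frob_rels_gens(2)[OF N t(2) N.zero_closed N.zero_closed, of p] by simp
    ultimately have "frag_of (c [^]\<^bsub>R\<^esub> p \<otimes>\<^bsub>R\<^esub> a, h x) - frag_of (a, \<zero>\<^bsub>N\<^esub>) - (- frag_of (a, \<zero>\<^bsub>N\<^esub>)) \<in> ?K"
      by (rule frob_rels_diff[OF N])
    then show ?case by (simp add: t(1))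
  next
    case (diff a b)
    then show ?case using frob_rels_diff[OF N] by (simp add: frag_extend_diff)
  qed
  then show ?thesis
    unfolding d(1) frob_map_coset[OF M N h] frob_smult[OF N cp] frob_zero[OF N] frob_coset_eq[OF N] by simp
qed

lemma frob_map_comp_cong:
  assumes M: "module R M" and N: "module R N" and L: "module R L"
    and h: "h \<in> mod_hom R M N" and k: "k \<in> mod_hom R N L" and l: "l \<in> mod_hom R M L"
    and eq: "\<And>x. x \<in> carrier M \<Longrightarrow> l x = k (h x)" and C: "C \<in> carrier (frob R p M)"
  shows "frob_map R p L k (frob_map R p N h C) = frob_map R p L l C"
proof -
  obtain d where d: "C = frob_rels R p M #>\<^bsub>frob_free R M\<^esub> d" "Poly_Mapping.keys d \<subseteq> carrier R \<times> carrier M"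
    using C carrier_frob[OF M] by blast
  have "frag_extend (\<lambda>(a, x). frag_of (a, k x)) (frag_extend (\<lambda>(a, x). frag_of (a, h x)) d)
      = frag_extend (\<lambda>(a, x). frag_of (a, l x)) d"
    using d(2) by (induction d rule: frag_induction) (auto simp: frag_extend_diff eq)
  then show ?thesis
    unfolding d(1) frob_map_coset[OF M N h] frob_map_coset[OF N L k] frob_map_coset[OF M L l] by simp
qed

text \<open>\<open>N i\<close> is the image of \<open>F\<^sup>i(M)\<close>. Stage 0 is finitely
  generated and torsion over a domain, so a product of annihilators of generators kills it.
  \<open>\<theta>\<close> takes stage \<open>Suc i\<close> into the image of \<open>F\<close>
  applied to the canonical map of stage \<open>i\<close>, where the \<open>p\<close>-th power of the
  previous killer acts as zero; injectivity of \<open>\<theta>\<close> carries this back.\<close>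

lemma (in regular_system) F_finite_filtration:
  fixes \<M> :: "('a, 'c) module" and M :: "('a, 'm) module"
  assumes F: "F_module R p \<M> \<theta>" and fg: "finitely_generated R M" and gen: "generating_morphism R p \<M> \<theta> M \<beta>"
    and torsion: "\<And>y. y \<in> carrier \<M> \<Longrightarrow> \<exists>r\<in>carrier R. r \<noteq> \<zero> \<and> r \<odot>\<^bsub>\<M>\<^esub> y = \<zero>\<^bsub>\<M>\<^esub>"
  obtains N :: "nat \<Rightarrow> 'c set" where "\<And>i. N i \<subseteq> carrier \<M>" "\<And>i. N i \<subseteq> N (Suc i)"
    "\<And>y. y \<in> carrier \<M> \<Longrightarrow> \<exists>i. y \<in> N i"
    "\<And>i. \<exists>c\<in>carrier R. c \<noteq> \<zero> \<and> (\<forall>y\<in>N i. c \<odot>\<^bsub>\<M>\<^esub> y = \<zero>\<^bsub>\<M>\<^esub>)"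
proof -
  from F have modM: "module R \<M>" and \<theta>: "\<theta> \<in> mod_hom R \<M> (frob R p \<M>)" "inj_on \<theta> (carrier \<M>)"
    by (auto simp: F_module_def mod_iso_def bij_betw_def)
  interpret \<M>: module R \<M> by (rule modM)
  let ?N = "frob_iter R p M" and ?b = "frob_iter_map R p M \<beta>"
  let ?f = "\<lambda>i. frob_code \<circ> ?b i"
  from gen obtain \<psi> where M: "module R M" and \<beta>: "\<beta> \<in> mod_hom R M (frob R p M)"
    and lim: "is_direct_limit R ?N ?f \<M> \<psi>"
    and \<theta>\<psi>: "\<And>i z. z \<in> carrier (?N i) \<Longrightarrow> \<theta> (\<psi> i z) = frob_map R p \<M> (\<psi> i) (?b i z)"
    unfolding generating_morphism_def by blast
  interpret M: module R M by (rule M)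
  have N: "module R (?N i)" for i by (rule frob_iter_module[OF M])
  have code: "frob_code \<in> mod_hom R (frob R p (?N i)) (?N (Suc i))"
    "bij_betw frob_code (carrier (frob R p (?N i))) (carrier (?N (Suc i)))" for i
    using frob_iter_Suc_iso[OF M, of p i] by (auto simp: mod_iso_def simp del: frob_iter.simps)
  have f: "?f i \<in> mod_hom R (?N i) (?N (Suc i))" for i
    by (rule mod_hom_comp[OF frob_iter_map_hom[OF M \<beta>] code(1)])
  note \<psi> = direct_limit_maps[where N = ?N and f = ?f, OF N f lim]
  define A where "A i = \<psi> i ` carrier (?N i)" for i
  show ?thesis
  proof (rule that[of A])
    show "A i \<subseteq> carrier \<M>" for i using mod_homD(1)[OF \<psi>(1)] unfolding A_def by blast
    show "A i \<subseteq> A (Suc i)" for i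
      using \<psi>(2) mod_homD(1)[OF f[of i]] unfolding A_def by blast
    show "\<exists>i. y \<in> A i" if "y \<in> carrier \<M>" for y using \<psi>(3)[OF that] unfolding A_def .
    show "\<exists>c\<in>carrier R. c \<noteq> \<zero> \<and> (\<forall>y\<in>A i. c \<odot>\<^bsub>\<M>\<^esub> y = \<zero>\<^bsub>\<M>\<^esub>)" for i
    proof (induction i)
      case 0
      obtain G where G: "finite G" "G \<subseteq> carrier M" "\<And>L. submodule L R M \<Longrightarrow> G \<subseteq> L \<Longrightarrow> L = carrier M"
        using fg unfolding finitely_generated_def by blast
      define h where "h = \<psi> 0 \<circ> FBase"
      have h: "h \<in> mod_hom R M \<M>"
        unfolding h_def using frob_iter_0_iso[OF M, of p]
        by (intro mod_hom_comp[OF _ \<psi>(1)]) (auto simp: mod_iso_def)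
      note hD = mod_homD[OF h]
      have A0: "A 0 = h ` carrier M" by (auto simp: A_def h_def transport_def Let_def image_image)
      have "\<exists>c\<in>carrier R. c \<noteq> \<zero> \<and> (\<forall>x\<in>G. c \<odot>\<^bsub>\<M>\<^esub> h x = \<zero>\<^bsub>\<M>\<^esub>)"
        using G(1,2)
      proof (induction G rule: finite_induct)
        case empty
        then show ?case using primeD(2)[OF zero_prime] by (intro bexI[of _ \<one>]) auto
      next
        case (insert x G)
        then obtain c where c: "c \<in> carrier R" "c \<noteq> \<zero>" "\<And>x. x \<in> G \<Longrightarrow> c \<odot>\<^bsub>\<M>\<^esub> h x = \<zero>\<^bsub>\<M>\<^esub>" by auto
        have hx: "h x \<in> carrier \<M>" using hD(1) insert by auto
        obtain d where d: "d \<in> carrier R" "d \<noteq> \<zero>" "d \<odot>\<^bsub>\<M>\<^esub> h x = \<zero>\<^bsub>\<M>\<^esub>" using torsion[OF hx] by blast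
        have "(d \<otimes> c) \<odot>\<^bsub>\<M>\<^esub> h y = \<zero>\<^bsub>\<M>\<^esub>" if "y \<in> insert x G" for y
        proof -
          have hy: "h y \<in> carrier \<M>" using hD(1) insert that by auto
          have "(d \<otimes> c) \<odot>\<^bsub>\<M>\<^esub> h y = d \<odot>\<^bsub>\<M>\<^esub> (c \<odot>\<^bsub>\<M>\<^esub> h y)" "(d \<otimes> c) \<odot>\<^bsub>\<M>\<^esub> h y = c \<odot>\<^bsub>\<M>\<^esub> (d \<odot>\<^bsub>\<M>\<^esub> h y)"
            using hy c d by (simp_all add: m_comm flip: \<M>.smult_assoc1)
          then show ?thesis using that c d by auto
        qed
        then show ?case using c d no_zero_divisors by (intro bexI[of _ "d \<otimes> c"]) auto
      qed
      then obtain c where c: "c \<in> carrier R" "c \<noteq> \<zero>" "\<And>x. x \<in> G \<Longrightarrow> c \<odot>\<^bsub>\<M>\<^esub> h x = \<zero>\<^bsub>\<M>\<^esub>" by blast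
      have h0: "h \<zero>\<^bsub>M\<^esub> = \<zero>\<^bsub>\<M>\<^esub>" using hD(3)[OF zero_closed M.zero_closed] hD(1)[OF M.zero_closed] by simp
      let ?L = "{x \<in> carrier M. c \<odot>\<^bsub>\<M>\<^esub> h x = \<zero>\<^bsub>\<M>\<^esub>}"
      have smul: "r \<odot>\<^bsub>M\<^esub> x \<in> ?L" if "r \<in> carrier R" "x \<in> ?L" for r x
      proof -
        have x: "x \<in> carrier M" "c \<odot>\<^bsub>\<M>\<^esub> h x = \<zero>\<^bsub>\<M>\<^esub>" using that by auto
        have "c \<odot>\<^bsub>\<M>\<^esub> (r \<odot>\<^bsub>\<M>\<^esub> h x) = r \<odot>\<^bsub>\<M>\<^esub> (c \<odot>\<^bsub>\<M>\<^esub> h x)"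
          using that(1) hD(1)[OF x(1)] c(1) by (simp add: m_comm flip: \<M>.smult_assoc1)
        then have "c \<odot>\<^bsub>\<M>\<^esub> h (r \<odot>\<^bsub>M\<^esub> x) = \<zero>\<^bsub>\<M>\<^esub>" using hD(3)[OF that(1) x(1)] x(2) that(1) by simp
        then show ?thesis using that by simp
      qed
      have "submodule ?L R M"
      proof (rule M.submoduleI)
        show "\<ominus>\<^bsub>M\<^esub> a \<in> ?L" if "a \<in> ?L" for a
          using smul[of "\<ominus> \<one>" a] that M.smult_l_minus[of \<one> a] by simp
        show "a \<oplus>\<^bsub>M\<^esub> b \<in> ?L" if "a \<in> ?L" "b \<in> ?L" for a b
          using that hD(1,2) c(1) by (simp add: \<M>.smult_r_distr)
      qed (use h0 c(1) smul in auto)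
      then have L: "?L = carrier M" using G(2) c(3) by (intro G(3)) auto
      have "c \<odot>\<^bsub>\<M>\<^esub> h x = \<zero>\<^bsub>\<M>\<^esub>" if "x \<in> carrier M" for x using subsetD[OF equalityD2[OF L] that] by simp
      then show ?case using c(1,2) A0 by (intro bexI[of _ c]) auto
    next
      case (Suc i)
      then obtain c where c: "c \<in> carrier R" "c \<noteq> \<zero>" "\<And>y. y \<in> A i \<Longrightarrow> c \<odot>\<^bsub>\<M>\<^esub> y = \<zero>\<^bsub>\<M>\<^esub>" by blast
      have "c [^] p \<odot>\<^bsub>\<M>\<^esub> y = \<zero>\<^bsub>\<M>\<^esub>" if "y \<in> A (Suc i)" for y
      proof -
        from that obtain z where z: "z \<in> carrier (?N (Suc i))" "y = \<psi> (Suc i) z" unfolding A_def by blast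
        have yc: "y \<in> carrier \<M>" using z mod_homD(1)[OF \<psi>(1)] by blast
        have "z \<in> frob_code ` carrier (frob R p (?N i))" using z(1) bij_betw_imp_surj_on[OF code(2)] by metis
        then obtain C where C: "C \<in> carrier (frob R p (?N i))" "z = frob_code C" by blast
        have "?b (Suc i) z = frob_map R p (?N (Suc i)) (?f i) C"
          using C frob_code_inj[OF N] by (simp del: frob_iter.simps)
        then have "\<theta> y = frob_map R p \<M> (\<psi> (Suc i)) (frob_map R p (?N (Suc i)) (?f i) C)"
          using \<theta>\<psi>[OF z(1)] z(2) by simp
        \<comment> \<open>\<open>F\<close> applied to the compatibility of
          \<open>\<psi> (Suc i)\<close> with \<open>\<psi> i\<close> along the transition
          map.\<close>
        also have "\<dots> = frob_map R p \<M> (\<psi> i) C"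
          by (rule frob_map_comp_cong[OF N N modM f \<psi>(1) \<psi>(1) \<psi>(2) C(1)])
        finally have \<theta>y: "\<theta> y = frob_map R p \<M> (\<psi> i) C" .
        have "c [^] p \<odot>\<^bsub>frob R p \<M>\<^esub> frob_map R p \<M> (\<psi> i) C = \<zero>\<^bsub>frob R p \<M>\<^esub>"
          by (rule frob_annihilator[OF N modM \<psi>(1) c(1) _ C(1)]) (use c(3) in \<open>auto simp: A_def\<close>)
        then have "\<theta> (c [^] p \<odot>\<^bsub>\<M>\<^esub> y) = \<zero>\<^bsub>frob R p \<M>\<^esub>"
          using mod_homD(3)[OF \<theta>(1) nat_pow_closed[OF c(1)] yc] \<theta>y by simp
        moreover have "\<theta> \<zero>\<^bsub>\<M>\<^esub> = \<zero>\<^bsub>frob R p \<M>\<^esub>"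
          using mod_homD(3)[OF \<theta>(1) zero_closed \<M>.zero_closed] mod_homD(1)[OF \<theta>(1) \<M>.zero_closed]
            module.smult_l_null[OF frob_module[OF modM]] by simp
        ultimately show ?thesis
          using inj_onD[OF \<theta>(2), of "c [^] p \<odot>\<^bsub>\<M>\<^esub> y" "\<zero>\<^bsub>\<M>\<^esub>"] c(1) yc by simp
      qed
      moreover have "c [^] p \<noteq> \<zero>" using pow_notin_prime[OF zero_prime c(1)] c(2) by blast
      ultimately show ?case using c(1) by blast
    qed
  qed
qed

lemma (in regular_system) foldl_adjoin_maximal:
  "set xs = S \<Longrightarrow> foldl adjoin {\<zero>} xs = \<mm>"
  using foldl_adjoin[of "{}" xs] S_carrier S_gen Idl_empty by simp

section \<open>Successive approximation of a faithful functional\<close>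

context residue_hull
begin

text \<open>If \<open>\<phi>\<close> itself fails, some \<open>r\<close> of level \<open>n\<close>
  kills it on \<open>N j\<close>, in particular at \<open>s\<close>. This one \<open>r\<close>
  serves against every \<open>t\<close> that might kill the corrected functional: \<open>r t\<close>
  wipes out the \<open>\<phi>\<close>-part of its value at \<open>s\<close> and leaves
  \<open>r t c\<close> applied to \<open>g s\<close>.\<close>

lemma separating_functional:
  fixes M :: "('a, 'b) module" and N :: "nat \<Rightarrow> 'b set"
  assumes F: "F_module R p M \<theta>" and x: "x \<in> carrier M" "x \<noteq> \<zero>\<^bsub>M\<^esub>"
    and N: "\<And>i. N i \<subseteq> carrier M" "\<And>i. N i \<subseteq> N (Suc i)" "\<And>y. y \<in> carrier M \<Longrightarrow> \<exists>i. y \<in> N i"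
    and kill: "\<exists>c\<in>carrier R. c \<noteq> \<zero> \<and> (\<forall>y\<in>N i. c \<odot>\<^bsub>M\<^esub> y = \<zero>\<^bsub>M\<^esub>)"
    and xs: "distinct xs" "set xs = S" and \<phi>: "\<phi> \<in> mod_hom R M E"
  shows "\<exists>\<phi>'\<in>mod_hom R M E. \<exists>j\<ge>max i n. (\<forall>y\<in>N i. \<phi>' y = \<phi> y) \<and>
    (\<forall>r. lex_bounded {\<zero>} xs n r \<longrightarrow> (\<exists>y\<in>N j. r \<odot>\<^bsub>E\<^esub> \<phi>' y \<noteq> \<zero>\<^bsub>E\<^esub>))"
proof -
  have M: "module R M" using F by (simp add: F_module_def)
  interpret M: module R M by fact
  have Nm: "N i \<subseteq> N j" if "i \<le> j" for i j using lift_Suc_mono_le[of N, OF N(2) that] .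
  obtain c where c: "c \<in> carrier R" "c \<noteq> \<zero>" "\<And>y. y \<in> N i \<Longrightarrow> c \<odot>\<^bsub>M\<^esub> y = \<zero>\<^bsub>M\<^esub>" using kill by blast
  obtain k where k: "lex_bounded {\<zero>} xs k c"
    using lex_bounded_exists[of "{}" xs c] xs c Idl_empty by auto
  \<comment> \<open>The constant bounds the level of the product \<open>r t c\<close>:
    \<open>n\<close> each for \<open>r\<close> and \<open>t\<close>, and \<open>k\<close> for
    \<open>c\<close>.\<close>
  obtain g s where g: "g \<in> mod_hom R M E" and s: "s \<in> carrier M"
    and deep: "\<And>r. lex_bounded {\<zero>} xs (n + n + k) r \<Longrightarrow> r \<odot>\<^bsub>E\<^esub> g s \<noteq> \<zero>\<^bsub>E\<^esub>"
    using deep_functional[OF F x xs, of "n + n + k"] by blast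
  note gD = mod_homD[OF g] and \<phi>D = mod_homD[OF \<phi>]
  obtain i' where i': "s \<in> N i'" using N(3)[OF s] by blast
  \<comment> \<open>\<open>i'\<close> brings the witness \<open>s\<close> into \<open>N j\<close>;
    \<open>max i n\<close> keeps the stages increasing and, as \<open>n\<close> grows, exhausting
    \<open>M\<close>.\<close>
  define j where "j = max i' (max i n)"
  have sj: "s \<in> N j" using i' Nm[of i' j] by (auto simp: j_def)
  have j: "j \<ge> max i n" by (simp add: j_def)
  have mult: "lex_bounded {\<zero>} xs (a + b) (r \<otimes> t)" if "lex_bounded {\<zero>} xs a r" "lex_bounded {\<zero>} xs b t" for a b r t
    using lex_bounded_mult[OF zeroideal _ _ that] xs S_carrier foldl_adjoin_maximal maximal_prime by simp
  let ?\<phi>' = "\<lambda>y. \<phi> y \<oplus>\<^bsub>E\<^esub> c \<odot>\<^bsub>E\<^esub> g y"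
  have \<phi>': "?\<phi>' \<in> mod_hom R M E"
    unfolding mod_hom_def
  proof (intro CollectI conjI ballI funcsetI)
    show "?\<phi>' y \<in> carrier E" if "y \<in> carrier M" for y using gD(1) \<phi>D(1) c(1) that by simp
    show "?\<phi>' (y \<oplus>\<^bsub>M\<^esub> z) = ?\<phi>' y \<oplus>\<^bsub>E\<^esub> ?\<phi>' z" if "y \<in> carrier M" "z \<in> carrier M" for y z
      using gD(1,2) \<phi>D(1,2) c(1) that by (simp add: E.smult_r_distr E.a_ac)
    show "?\<phi>' (r \<odot>\<^bsub>M\<^esub> y) = r \<odot>\<^bsub>E\<^esub> ?\<phi>' y" if "r \<in> carrier R" "y \<in> carrier M" for r y
    proof -
      have "c \<odot>\<^bsub>E\<^esub> (r \<odot>\<^bsub>E\<^esub> g y) = r \<odot>\<^bsub>E\<^esub> (c \<odot>\<^bsub>E\<^esub> g y)"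
        using gD(1)[OF that(2)] c(1) that(1) by (simp add: m_comm flip: E.smult_assoc1)
      then show ?thesis using gD(1,3) \<phi>D(1,3) c(1) that by (simp add: E.smult_r_distr)
    qed
  qed
  have agree: "?\<phi>' y = \<phi> y" if y: "y \<in> N i" for y
  proof -
    have yc: "y \<in> carrier M" using y N(1) by blast
    have "c \<odot>\<^bsub>E\<^esub> g y = g (\<zero> \<odot>\<^bsub>M\<^esub> y)" using gD(3)[OF c(1) yc] c(3)[OF y] yc by simp
    also have "\<dots> = \<zero>\<^bsub>E\<^esub>" using gD(3)[OF zero_closed yc] gD(1)[OF yc] by simp
    finally show ?thesis using \<phi>D(1)[OF yc] by simp
  qed
  show ?thesis
  proof (cases "\<forall>r. lex_bounded {\<zero>} xs n r \<longrightarrow> (\<exists>y\<in>N j. r \<odot>\<^bsub>E\<^esub> \<phi> y \<noteq> \<zero>\<^bsub>E\<^esub>)")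
    case True
    then show ?thesis using \<phi> j by blast
  next
    case False
    then obtain r where r: "lex_bounded {\<zero>} xs n r" "\<And>y. y \<in> N j \<Longrightarrow> r \<odot>\<^bsub>E\<^esub> \<phi> y = \<zero>\<^bsub>E\<^esub>" by blast
    have "\<exists>y\<in>N j. t \<odot>\<^bsub>E\<^esub> ?\<phi>' y \<noteq> \<zero>\<^bsub>E\<^esub>" if t: "lex_bounded {\<zero>} xs n t" for t
    proof (rule ccontr)
      assume "\<not> ?thesis"
      then have 0: "t \<odot>\<^bsub>E\<^esub> ?\<phi>' s = \<zero>\<^bsub>E\<^esub>" using sj by blast
      have rt: "r \<in> carrier R" "t \<in> carrier R" using lex_bounded_carrier r(1) t by blast+
      note sc = gD(1)[OF s] \<phi>D(1)[OF s]
      have "\<zero>\<^bsub>E\<^esub> = r \<odot>\<^bsub>E\<^esub> (t \<odot>\<^bsub>E\<^esub> ?\<phi>' s)" using 0 rt by simp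
      also have "\<dots> = t \<odot>\<^bsub>E\<^esub> (r \<odot>\<^bsub>E\<^esub> \<phi> s) \<oplus>\<^bsub>E\<^esub> (r \<otimes> t \<otimes> c) \<odot>\<^bsub>E\<^esub> g s"
        using rt c(1) sc by (simp add: E.smult_r_distr m_ac flip: E.smult_assoc1)
      also have "\<dots> = (r \<otimes> t \<otimes> c) \<odot>\<^bsub>E\<^esub> g s" using r(2)[OF sj] rt c(1) sc by simp
      finally show False using deep[OF mult[OF mult[OF r(1) t] k]] by simp
    qed
    then show ?thesis using \<phi>' j agree by (intro bexI[of _ ?\<phi>'] exI[of _ j]) auto
  qed
qed

text \<open>Round \<open>n\<close> secures all \<open>r\<close> of level at most \<open>n\<close> by
  witnesses inside \<open>A (Suc n)\<close>, where later rounds leave the functional unchanged.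
  Every nonzero \<open>r\<close> has some level, so it does not kill the glued functional.\<close>

lemma faithful_functional:
  fixes M :: "('a, 'b) module" and N :: "nat \<Rightarrow> 'b set"
  assumes F: "F_module R p M \<theta>" and x: "x \<in> carrier M" "x \<noteq> \<zero>\<^bsub>M\<^esub>"
    and N: "\<And>i. N i \<subseteq> carrier M" "\<And>i. N i \<subseteq> N (Suc i)" "\<And>y. y \<in> carrier M \<Longrightarrow> \<exists>i. y \<in> N i"
    and kill: "\<And>i. \<exists>c\<in>carrier R. c \<noteq> \<zero> \<and> (\<forall>y\<in>N i. c \<odot>\<^bsub>M\<^esub> y = \<zero>\<^bsub>M\<^esub>)"
  obtains \<phi> where "\<phi> \<in> mod_hom R M E"
    "\<And>r. r \<in> carrier R \<Longrightarrow> r \<noteq> \<zero> \<Longrightarrow> \<exists>y\<in>carrier M. r \<odot>\<^bsub>E\<^esub> \<phi> y \<noteq> \<zero>\<^bsub>E\<^esub>"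
proof -
  have M: "module R M" using F by (simp add: F_module_def)
  interpret M: module R M by fact
  have Nm: "N i \<subseteq> N j" if "i \<le> j" for i j using lift_Suc_mono_le[of N, OF N(2) that] .
  obtain xs where xs: "distinct xs" "set xs = S" using finite_distinct_list[OF finite_S] by blast
  \<comment> \<open>A state pairs the current functional with the index of the stage on which it is
    frozen.\<close>
  let ?Q = "\<lambda>n s s'. snd s' \<ge> max (snd s) n \<and> (\<forall>y\<in>N (snd s). fst s' y = fst s y) \<and>
    (\<forall>r. lex_bounded {\<zero>} xs n r \<longrightarrow> (\<exists>y\<in>N (snd s'). r \<odot>\<^bsub>E\<^esub> fst s' y \<noteq> \<zero>\<^bsub>E\<^esub>))"
  have "\<exists>\<sigma>. \<forall>n. fst (\<sigma> n) \<in> mod_hom R M E \<and> ?Q n (\<sigma> n) (\<sigma> (Suc n))"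
  proof (rule dependent_nat_choice)
    have "(\<lambda>_. \<zero>\<^bsub>E\<^esub>) \<in> mod_hom R M E" by (simp add: mod_hom_def)
    then show "\<exists>s. fst s \<in> mod_hom R M E" by auto
    fix s :: "('b \<Rightarrow> 'e) \<times> nat" and n assume s: "fst s \<in> mod_hom R M E"
    obtain \<phi>' j where "\<phi>' \<in> mod_hom R M E" "j \<ge> max (snd s) n" "\<forall>y\<in>N (snd s). \<phi>' y = fst s y"
      "\<forall>r. lex_bounded {\<zero>} xs n r \<longrightarrow> (\<exists>y\<in>N j. r \<odot>\<^bsub>E\<^esub> \<phi>' y \<noteq> \<zero>\<^bsub>E\<^esub>)"
      using separating_functional[OF F x N kill xs s, of "snd s" n] by blast
    then show "\<exists>s'. fst s' \<in> mod_hom R M E \<and> ?Q n s s'" by (intro exI[of _ "(\<phi>', j)"]) simp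
  qed
  then obtain \<sigma> where \<sigma>: "\<And>n. fst (\<sigma> n) \<in> mod_hom R M E" "\<And>n. ?Q n (\<sigma> n) (\<sigma> (Suc n))" by blast
  define f where "f n = fst (\<sigma> n)" for n
  define A where "A n = N (snd (\<sigma> n))" for n
  have f: "f n \<in> mod_hom R M E" for n using \<sigma>(1) by (simp add: f_def)
  have fS: "f (Suc n) y = f n y" if "y \<in> A n" for n y using \<sigma>(2)[of n] that by (simp add: f_def A_def)
  have AS: "A n \<subseteq> A (Suc n)" for n using \<sigma>(2)[of n] Nm[of "snd (\<sigma> n)" "snd (\<sigma> (Suc n))"] by (simp add: A_def)
  have sep: "\<exists>y\<in>A (Suc n). r \<odot>\<^bsub>E\<^esub> f (Suc n) y \<noteq> \<zero>\<^bsub>E\<^esub>" if "lex_bounded {\<zero>} xs n r" for n r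
    using \<sigma>(2)[of n] that by (simp add: f_def A_def)
  have NA: "N n \<subseteq> A (Suc n)" for n using \<sigma>(2)[of n] Nm[of n "snd (\<sigma> (Suc n))"] by (simp add: A_def)
  have AM: "A n \<subseteq> carrier M" for n using N(1) by (simp add: A_def)
  have Am: "A m \<subseteq> A n" if "m \<le> n" for m n using lift_Suc_mono_le[of A, OF AS that] .
  have ev: "\<exists>n. y \<in> A n" if "y \<in> carrier M" for y using N(3)[OF that] NA by blast
  have fm: "f n y = f m y" if "m \<le> n" "y \<in> A m" for m n y
    using that(1)
  proof (induction n rule: dec_induct)
    case (step n)
    then show ?case using fS[of y n] Am[of m n] that(2) by auto
  qed simp
  define \<phi> where "\<phi> y = f (SOME n. y \<in> A n) y" for y
  have \<phi>: "\<phi> y = f n y" if y: "y \<in> A n" for y n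
  proof -
    let ?m = "SOME n. y \<in> A n"
    have m: "y \<in> A ?m" using y by (rule someI)
    have "f ?m y = f n y" using fm[OF max.cobounded1 m, of n] fm[OF max.cobounded2 y, of ?m] by (rule trans[OF sym])
    then show ?thesis unfolding \<phi>_def .
  qed
  have "\<phi> \<in> mod_hom R M E"
    unfolding mod_hom_def
  proof (intro CollectI conjI ballI funcsetI)
    fix y assume y: "y \<in> carrier M"
    then obtain n where n: "y \<in> A n" using ev by blast
    show "\<phi> y \<in> carrier E" using \<phi>[OF n] mod_homD(1)[OF f y] by simp
    { fix z assume z: "z \<in> carrier M"
      then obtain m where m: "z \<in> A m" using ev by blast
      obtain l where l: "y \<oplus>\<^bsub>M\<^esub> z \<in> A l" using ev y z by blast
      obtain k where k: "n \<le> k" "m \<le> k" "l \<le> k" by (meson linorder_linear order_trans)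
      have "y \<in> A k" "z \<in> A k" "y \<oplus>\<^bsub>M\<^esub> z \<in> A k"
        using n m l Am[OF k(1)] Am[OF k(2)] Am[OF k(3)] by auto
      then show "\<phi> (y \<oplus>\<^bsub>M\<^esub> z) = \<phi> y \<oplus>\<^bsub>E\<^esub> \<phi> z" using \<phi> mod_homD(2)[OF f y z] by metis }
    fix r assume r: "r \<in> carrier R"
    obtain l where l: "r \<odot>\<^bsub>M\<^esub> y \<in> A l" using ev r y by blast
    have "y \<in> A (max n l)" "r \<odot>\<^bsub>M\<^esub> y \<in> A (max n l)"
      using n l Am[OF max.cobounded1, of n l] Am[OF max.cobounded2, of l n] by auto
    then show "\<phi> (r \<odot>\<^bsub>M\<^esub> y) = r \<odot>\<^bsub>E\<^esub> \<phi> y" using \<phi> mod_homD(3)[OF f r y] by metis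
  qed
  moreover have "\<exists>y\<in>carrier M. r \<odot>\<^bsub>E\<^esub> \<phi> y \<noteq> \<zero>\<^bsub>E\<^esub>" if r: "r \<in> carrier R" "r \<noteq> \<zero>" for r
  proof -
    obtain k where "lex_bounded {\<zero>} xs k r"
      using lex_bounded_exists[of "{}" xs r] xs r Idl_empty by auto
    then obtain y where y: "y \<in> A (Suc k)" "r \<odot>\<^bsub>E\<^esub> f (Suc k) y \<noteq> \<zero>\<^bsub>E\<^esub>" using sep by blast
    then show ?thesis using \<phi>[OF y(1)] subsetD[OF AM y(1)] by (intro bexI[of _ y]) auto
  qed
  ultimately show ?thesis using that by blast
qed

end

section \<open>The hypotheses of the theorem in terms of elements\<close>

lemma injective_hull_residue:
  fixes R (structure)
  assumes R: "cring R" and m: "ideal \<mm> R" and hull: "injective_hull R (residue_module R \<mm>) E \<iota>"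
  defines "e0 \<equiv> \<iota> (\<mm> +> \<one>)"
  shows "e0 \<in> carrier E" and "r \<in> carrier R \<Longrightarrow> r \<odot>\<^bsub>E\<^esub> e0 = \<zero>\<^bsub>E\<^esub> \<longleftrightarrow> r \<in> \<mm>"
    and "f \<in> carrier E \<Longrightarrow> f \<noteq> \<zero>\<^bsub>E\<^esub> \<Longrightarrow>
      \<exists>r\<in>carrier R. r \<odot>\<^bsub>E\<^esub> f \<noteq> \<zero>\<^bsub>E\<^esub> \<and> (\<forall>y\<in>\<mm>. y \<odot>\<^bsub>E\<^esub> (r \<odot>\<^bsub>E\<^esub> f) = \<zero>\<^bsub>E\<^esub>)"
proof -
  interpret cring R by fact
  interpret m: ideal \<mm> R by fact
  from hull have inj: "injective_module R E" and \<iota>: "\<iota> \<in> mod_hom R (residue_module R \<mm>) E"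
    and \<iota>i: "inj_on \<iota> (carrier (residue_module R \<mm>))"
    and ess: "\<And>N. submodule N R E \<Longrightarrow> N \<noteq> {\<zero>\<^bsub>E\<^esub>} \<Longrightarrow> N \<inter> \<iota> ` carrier (residue_module R \<mm>) \<noteq> {\<zero>\<^bsub>E\<^esub>}"
    by (auto simp: injective_hull_def)
  interpret E: module R E using inj by (simp add: injective_module_def)
  let ?k = "residue_module R \<mm>"
  note \<iota>D = mod_homD[OF \<iota>]
  have car: "carrier ?k = {\<mm> +> a | a. a \<in> carrier R}"
    by (auto simp: residue_module_def FactRing_def A_RCOSETS_def')
  have smult: "r \<odot>\<^bsub>?k\<^esub> (\<mm> +> a) = \<mm> +> (r \<otimes> a)" if "r \<in> carrier R" "a \<in> carrier R" for r a
    using that by (simp add: residue_module_def FactRing_def m.rcoset_mult_add)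
  have ca: "\<mm> +> a \<in> carrier ?k" if "a \<in> carrier R" for a using that car by blast
  have \<iota>a: "\<iota> (\<mm> +> r) = r \<odot>\<^bsub>E\<^esub> e0" if "r \<in> carrier R" for r
    using \<iota>D(3)[OF that ca[OF one_closed]] smult[OF that one_closed] that by (simp add: e0_def)
  show e0: "e0 \<in> carrier E" unfolding e0_def using \<iota>D(1) ca by simp
  show ann: "r \<odot>\<^bsub>E\<^esub> e0 = \<zero>\<^bsub>E\<^esub> \<longleftrightarrow> r \<in> \<mm>" if r: "r \<in> carrier R" for r
  proof -
    have "r \<odot>\<^bsub>E\<^esub> e0 = \<zero>\<^bsub>E\<^esub> \<longleftrightarrow> \<iota> (\<mm> +> r) = \<iota> (\<mm> +> \<zero>)" using \<iota>a[OF r] \<iota>a[OF zero_closed] e0 by simp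
    also have "\<dots> \<longleftrightarrow> \<mm> +> r = \<mm> +> \<zero>" using inj_on_eq_iff[OF \<iota>i ca[OF r] ca[OF zero_closed]] .
    also have "\<dots> \<longleftrightarrow> r \<in> \<mm>"
      using quotient_eq_iff_same_a_r_cos[OF m r zero_closed] r by (simp add: minus_eq)
    finally show ?thesis .
  qed
  assume f: "f \<in> carrier E" "f \<noteq> \<zero>\<^bsub>E\<^esub>"
  let ?H = "(\<lambda>r. r \<odot>\<^bsub>E\<^esub> f) ` carrier R"
  have "submodule ?H R E"
  proof (rule E.submoduleI)
    show "?H \<subseteq> carrier E" using f by auto
    show z: "\<zero>\<^bsub>E\<^esub> \<in> ?H" using f by (intro image_eqI[of _ _ \<zero>]) auto
    show "\<ominus>\<^bsub>E\<^esub> a \<in> ?H" if "a \<in> ?H" for a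
      using that f by (auto simp flip: E.smult_l_minus)
    show "a \<oplus>\<^bsub>E\<^esub> b \<in> ?H" if "a \<in> ?H" "b \<in> ?H" for a b
      using that f by (auto simp flip: E.smult_l_distr)
    show "r \<odot>\<^bsub>E\<^esub> a \<in> ?H" if "r \<in> carrier R" "a \<in> ?H" for r a
      using that f by (auto simp flip: E.smult_assoc1)
  qed
  moreover have "f \<in> ?H" using f by (intro image_eqI[of _ _ \<one>]) auto
  \<comment> \<open>Zero lies in both sets, so an intersection other than \<open>{0}\<close> has a
    nonzero element; it is the image of a residue class and therefore killed by
    \<open>\<mm>\<close>.\<close>
  ultimately have "?H \<inter> \<iota> ` carrier ?k \<noteq> {\<zero>\<^bsub>E\<^esub>}" using ess f(2) by blast
  moreover have "\<zero>\<^bsub>E\<^esub> \<in> ?H" using f by (intro image_eqI[of _ _ \<zero>]) auto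
  moreover have "\<zero>\<^bsub>E\<^esub> \<in> \<iota> ` carrier ?k"
    using \<iota>a[OF zero_closed] e0 ca[OF zero_closed] by (metis E.smult_l_null imageI)
  ultimately obtain r a where r: "r \<in> carrier R" "r \<odot>\<^bsub>E\<^esub> f \<noteq> \<zero>\<^bsub>E\<^esub>" and a: "a \<in> carrier R" "r \<odot>\<^bsub>E\<^esub> f = \<iota> (\<mm> +> a)"
    unfolding car by blast
  have "y \<odot>\<^bsub>E\<^esub> (r \<odot>\<^bsub>E\<^esub> f) = \<zero>\<^bsub>E\<^esub>" if y: "y \<in> \<mm>" for y
  proof -
    have yc: "y \<in> carrier R" using m.Icarr[OF y] .
    have "y \<odot>\<^bsub>E\<^esub> (r \<odot>\<^bsub>E\<^esub> f) = (y \<otimes> a) \<odot>\<^bsub>E\<^esub> e0"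
      unfolding a(2) \<iota>a[OF a(1)] using yc a(1) e0 by (simp add: E.smult_assoc1)
    then show ?thesis using ann[of "y \<otimes> a"] m.I_r_closed[OF y a(1)] yc a(1) by simp
  qed
  then show "\<exists>r\<in>carrier R. r \<odot>\<^bsub>E\<^esub> f \<noteq> \<zero>\<^bsub>E\<^esub> \<and> (\<forall>y\<in>\<mm>. y \<odot>\<^bsub>E\<^esub> (r \<odot>\<^bsub>E\<^esub> f) = \<zero>\<^bsub>E\<^esub>)" using r by blast
qed

text \<open>Multiples of \<open>\<one>\<close> are unaffected by restricting the carrier, so those
  in \<open>K\<close> are computed in \<open>R\<close>. As \<open>R\<close> is a domain, a proper
  factorization of \<open>p\<close> would give a smaller vanishing multiple.\<close>

lemma (in regular_system) prime_characteristic: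
  assumes p: "p > 0" "characteristic (R\<lparr>carrier := K\<rparr>) = p"
  shows "Factorial_Ring.prime p" "add_pow R p \<one> = \<zero>"
proof -
  have pow: "add_pow (R\<lparr>carrier := K\<rparr>) n \<one> = add_pow R n \<one>" for n :: nat
    by (simp add: add_pow_def nat_pow_def)
  have ex: "\<exists>n>0. add_pow R (n::nat) \<one> = \<zero>"
    using p unfolding characteristic_def by (auto simp: pow split: if_splits)
  then have least: "p = (LEAST n. n > 0 \<and> add_pow R n \<one> = \<zero>)"
    using p(2) unfolding characteristic_def by (simp add: pow)
  from LeastI_ex[OF ex] show p0: "add_pow R p \<one> = \<zero>" unfolding least by blast
  have min: "p \<le> n" if "n > 0" "add_pow R n \<one> = \<zero>" for n unfolding least using that by (intro Least_le) simp
  have "\<one> \<noteq> \<zero>" using primeD(2)[OF zero_prime] by auto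
  then have p1: "p \<noteq> 1" using p0 by (metis add.nat_pow_eone one_closed)
  have "a = 1 \<or> a = p" if "a dvd p" for a
  proof -
    from that obtain b where b: "p = a * b" by blast
    have ab: "0 < a" "0 < b" using p(1) b by auto
    have "add_pow R a \<one> \<otimes> add_pow R b \<one> = add_pow R p \<one>"
      by (simp add: b add_pow_ldistr add_pow_rdistr add.nat_pow_pow mult.commute)
    then have "add_pow R a \<one> = \<zero> \<or> add_pow R b \<one> = \<zero>"
      using no_zero_divisors[of "add_pow R a \<one>" "add_pow R b \<one>"] p0 by simp
    then have "p \<le> a \<or> p \<le> b" using min ab by blast
    moreover have "a \<le> p" "b \<le> p" using b ab by auto
    ultimately have "a = p \<or> b = p" by auto
    then show ?thesis using b ab by auto
  qed
  then show "Factorial_Ring.prime p" using p(1) p1 by (auto simp: prime_nat_iff)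
qed

theorem theorem1p1:
  fixes R :: "('a, 'r) ring_scheme"
    and \<mm> :: "'a set"
    and p :: nat
    and \<M> :: "('a, 'b) module"
    and \<theta> :: "'b \<Rightarrow> ('a \<times> 'b \<Rightarrow>\<^sub>0 int) set"
    and E :: "('a, 'e) module"
    and \<iota> :: "'a set \<Rightarrow> 'e"
  assumes "regular_local_ring R \<mm>"
    and "adically_complete R \<mm>"
    and "p > 0"
    and "\<exists>K. subfield K R \<and> characteristic (R\<lparr>carrier := K\<rparr>) = p"
    and "F_finite TYPE('m) R p \<M> \<theta>"
    and "carrier \<M> \<noteq> {\<zero>\<^bsub>\<M>\<^esub>}"
    and "{\<zero>\<^bsub>R\<^esub>} \<notin> Ass R \<M>"
    and "injective_hull R (residue_module R \<mm>) E \<iota>"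
  shows "{\<zero>\<^bsub>R\<^esub>} \<in> Ass R (Hom_module R \<M> E)"
proof -
  obtain S where "regular_system R \<mm> S" using regular_local_ring_system[OF assms(1)] .
  then interpret regular_system R \<mm> S .
  from assms(3,4) have p: "Factorial_Ring.prime p" "add_pow R p \<one>\<^bsub>R\<^esub> = \<zero>\<^bsub>R\<^esub>"
    using prime_characteristic by blast+
  note e0 = injective_hull_residue[OF is_cring maximal_ideal assms(8)]
  interpret residue_hull R \<mm> S E "\<iota> (\<mm> +>\<^bsub>R\<^esub> \<one>\<^bsub>R\<^esub>)" p
    using assms(8) e0 p
    by (intro residue_hull.intro regular_system_axioms residue_hull_axioms.intro) (auto simp: injective_hull_def)
  from assms(5) obtain M :: "('a, 'm) module" and \<beta> where F: "F_module R p \<M> \<theta>"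
    and M: "finitely_generated R M" "generating_morphism R p \<M> \<theta> M \<beta>"
    by (auto simp: F_finite_def root_morphism_def)
  have modM: "module R \<M>" using F by (simp add: F_module_def)
  interpret \<M>: module R \<M> by (rule modM)
  have torsion: "\<exists>r\<in>carrier R. r \<noteq> \<zero>\<^bsub>R\<^esub> \<and> r \<odot>\<^bsub>\<M>\<^esub> y = \<zero>\<^bsub>\<M>\<^esub>" if y: "y \<in> carrier \<M>" for y
  proof -
    \<comment> \<open>Since \<open>(0)\<close> is prime, its absence from the associated primes
      means that no element has zero annihilator.\<close>
    have "annihilator R \<M> y \<noteq> {\<zero>\<^bsub>R\<^esub>}" using assms(7) zero_prime y by (auto simp: Ass_def)
    moreover have "\<zero>\<^bsub>R\<^esub> \<in> annihilator R \<M> y" using y by (simp add: annihilator_def)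
    ultimately show ?thesis by (auto simp: annihilator_def)
  qed
  obtain x where x: "x \<in> carrier \<M>" "x \<noteq> \<zero>\<^bsub>\<M>\<^esub>" using assms(6) \<M>.zero_closed by blast
  obtain N :: "nat \<Rightarrow> 'b set" where N: "\<And>i. N i \<subseteq> carrier \<M>" "\<And>i. N i \<subseteq> N (Suc i)"
    "\<And>y. y \<in> carrier \<M> \<Longrightarrow> \<exists>i. y \<in> N i"
    "\<And>i. \<exists>c\<in>carrier R. c \<noteq> \<zero>\<^bsub>R\<^esub> \<and> (\<forall>y\<in>N i. c \<odot>\<^bsub>\<M>\<^esub> y = \<zero>\<^bsub>\<M>\<^esub>)"
    using F_finite_filtration[OF F M torsion] by metis
  obtain \<phi> where \<phi>: "\<phi> \<in> mod_hom R \<M> E"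
    "\<And>r. r \<in> carrier R \<Longrightarrow> r \<noteq> \<zero>\<^bsub>R\<^esub> \<Longrightarrow> \<exists>y\<in>carrier \<M>. r \<odot>\<^bsub>E\<^esub> \<phi> y \<noteq> \<zero>\<^bsub>E\<^esub>"
    using faithful_functional[OF F x N] by metis
  \<comment> \<open>The carrier of \<open>Hom_module\<close> consists of extensional maps; on
    \<open>carrier \<M>\<close> nothing changes.\<close>
  let ?\<phi> = "restrict \<phi> (carrier \<M>)"
  have "?\<phi> \<in> carrier (Hom_module R \<M> E)"
    using \<phi>(1) by (auto simp: Hom_module_def mod_hom_def)
  moreover have "{\<zero>\<^bsub>R\<^esub>} = annihilator R (Hom_module R \<M> E) ?\<phi>"
  proof -
    have "r \<odot>\<^bsub>Hom_module R \<M> E\<^esub> ?\<phi> = \<zero>\<^bsub>Hom_module R \<M> E\<^esub> \<longleftrightarrow> r = \<zero>\<^bsub>R\<^esub>" if r: "r \<in> carrier R" for r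
    proof -
      have "r \<odot>\<^bsub>Hom_module R \<M> E\<^esub> ?\<phi> = \<zero>\<^bsub>Hom_module R \<M> E\<^esub> \<longleftrightarrow> (\<forall>y\<in>carrier \<M>. r \<odot>\<^bsub>E\<^esub> \<phi> y = \<zero>\<^bsub>E\<^esub>)"
        by (auto simp: Hom_module_def restrict_def fun_eq_iff)
      also have "\<dots> \<longleftrightarrow> r = \<zero>\<^bsub>R\<^esub>" using \<phi>(2)[OF r] mod_homD(1)[OF \<phi>(1)] by auto
      finally show ?thesis .
    qed
    then show ?thesis by (auto simp: annihilator_def)
  qed
  ultimately show ?thesis unfolding Ass_def using zero_prime by blast
qed

end
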